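(* Let $U\subset\mathbb C$ be a simply connected domain with coordinate $z$, and let $\theta_1=f_1\,dz$, $\theta_2=f_2\,dz$, where $f_1,f_2:U\to\mathbb C$ are two holomorphic functions such that $f_1^2-f_2^2\neq0$ on $U$. Suppose that $h_1,h_2:U\to\mathbb R$ are smooth functions such that $$\alpha_1:=-i\,\frac{h_1f_1+i\,h_2f_2}{f_1^2-f_2^2}\qquad\text{and}\qquad\alpha_2:=\frac{h_2f_1-i\,h_1f_2}{f_1^2-f_2^2},$$ considered as real vector fields on $U$, are independent at every point and satisfy $[\alpha_1,\alpha_2]=0$. Then, if $g:U\to Spin(3,1)\subset\mathbb H^{\mathbb C}$ is a map solving $$dg\,g^{-1}=\theta_1J+\theta_2\,iK,$$ and if we set $$\xi:=g^{-1}\,(\omega_1\,i1+\omega_2\,I)\,\widehat g,$$ where $\omega_1,\omega_2:TU\to\mathbb R$ are the dual $1$-forms of $\alpha_1,\alpha_2\in\Gamma(TU)$, the function $F=\int\xi:U\to\mathbb R^{3,1}$ defines a timelike isometric immersion with $K=K_N=0$. Reciprocally, the isometric immersions of timelike surfaces $M$ in $\mathbb R^{3,1}$ such that $K=K_N=0$, with regular Gauss map and whose osculating spaces are everywhere not degenerate, are locally of this form.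
   Context: $\mathbb H^{\mathbb C}=\{q_1 1+q_2I+q_3J+q_4K: q_j\in\mathbb C\}$ is the algebra of quaternions with complex coefficients ($I^2=J^2=K^2=-1$, $IJ=-JI=K$); $\widehat q$ is obtained from $q$ by complex-conjugating each coefficient, and $H(p,p')=\sum_kp_kp_k'\in\mathbb C$. $Spin(3,1)=\{p\in\mathbb H^{\mathbb C}:H(p,p)=1\}$. Minkowski space $\mathbb R^{3,1}$ (metric $-dx_1^2+dx_2^2+dx_3^2+dx_4^2$) is identified with $\{ix_1 1+x_2I+x_3J+x_4K: x_j\in\mathbb R\}\subset\mathbb H^{\mathbb C}$. A complex-valued function $\alpha$ on $U$ is viewed as a real vector field via $\mathbb C\simeq\mathbb R^2$, and $[\alpha_1,\alpha_2]$ is the Lie bracket of real vector fields. $F=\int\xi$ means $dF=\xi$ (part of the assertion is that $\xi$ is closed and $\mathbb R^{3,1}$-valued); $U$ carries the metric $-\omega_1^2+\omega_2^2$. $K$ is the Gauss curvature of the surface and $K_N$ the curvature of its normal bundle. The Gauss map of an oriented timelike surface is $G:M\to\mathbb H^{\mathbb C}$, $G(x)=u_1\widehat{u_2}$ (the Clifford product $u_1\cdot u_2$), with $(u_1,u_2)$ a positively oriented orthogonal basis of $T_xM$, $|u_1|^2=-1$, $|u_2|^2=1$. $G$ is regular if $dG_x$ is injective at every $x\in M$. "Osculating spaces everywhere not degenerate" means that the complex-valued quadratic form $G^*H=H(dG,dG)$ on $TM$ is nonzero at every point. *)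

theory Defs
  imports "HOL-Analysis.Analysis"
begin

section \<open>Complex quaternions, the spin group and Minkowski space\<close>

text \<open>
  The quaternion $q_1 1 + q_2 I + q_3 J + q_4 K$ is the vector with components $q_1,\dots,q_4$.
  Beware that \<open>*\<close> on \<^typ>\<open>complex ^ 4\<close> is the componentwise product; the quaternion product
  is \<open>\<odot>\<close>. The complex multiple of \<open>q\<close> by \<open>c\<close> is \<open>c *s q\<close>.
\<close>

type_synonym cquat = "complex ^ 4"

definition qone :: cquat where "qone = axis 1 1"
definition qI :: cquat where "qI = axis 2 1"
definition qJ :: cquat where "qJ = axis 3 1"
definition qK :: cquat where "qK = axis 4 1"

definition qmult :: "cquat \<Rightarrow> cquat \<Rightarrow> cquat"  (infixl "\<odot>" 70) where
  "p \<odot> q = vector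
     [p$1 * q$1 - p$2 * q$2 - p$3 * q$3 - p$4 * q$4,
      p$1 * q$2 + p$2 * q$1 + p$3 * q$4 - p$4 * q$3,
      p$1 * q$3 - p$2 * q$4 + p$3 * q$1 + p$4 * q$2,
      p$1 * q$4 + p$2 * q$3 - p$3 * q$2 + p$4 * q$1]"

definition qhat :: "cquat \<Rightarrow> cquat" where
  "qhat q = (\<chi> k. cnj (q $ k))"

definition qH :: "cquat \<Rightarrow> cquat \<Rightarrow> complex" where
  "qH p p' = (\<Sum>k\<in>UNIV. p $ k * p' $ k)"

definition qconj :: "cquat \<Rightarrow> cquat" where
  "qconj q = vector [q$1, - (q$2), - (q$3), - (q$4)]"

text \<open>The inverse of an element with \<open>qH q q \<noteq> 0\<close>; see \<open>qmult_qinv\<close>.\<close>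

definition qinv :: "cquat \<Rightarrow> cquat" where
  "qinv q = (1 / qH q q) *s qconj q"

definition Spin31 :: "cquat set" where
  "Spin31 = {p. qH p p = 1}"

definition R31 :: "cquat set" where
  "R31 = {vector [\<i> * of_real x1, of_real x2, of_real x3, of_real x4] | x1 x2 x3 x4 :: real. True}"

text \<open>On \<open>R31\<close> the form \<open>qH\<close> is real-valued and equals $-dx_1^2+dx_2^2+dx_3^2+dx_4^2$.\<close>

definition mink :: "cquat \<Rightarrow> cquat \<Rightarrow> real" where
  "mink p p' = Re (qH p p')"

lemma vector_4_nth:
  "(vector [a,b,c,d] :: 'a::zero ^ 4) $ 1 = a"
  "(vector [a,b,c,d] :: 'a::zero ^ 4) $ 2 = b"
  "(vector [a,b,c,d] :: 'a::zero ^ 4) $ 3 = c"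
  "(vector [a,b,c,d] :: 'a::zero ^ 4) $ 4 = d"
  by (simp_all add: vector_def)

lemma qmult_nth:
  "(p \<odot> q) $ 1 = p$1 * q$1 - p$2 * q$2 - p$3 * q$3 - p$4 * q$4"
  "(p \<odot> q) $ 2 = p$1 * q$2 + p$2 * q$1 + p$3 * q$4 - p$4 * q$3"
  "(p \<odot> q) $ 3 = p$1 * q$3 - p$2 * q$4 + p$3 * q$1 + p$4 * q$2"
  "(p \<odot> q) $ 4 = p$1 * q$4 + p$2 * q$3 - p$3 * q$2 + p$4 * q$1"
  by (simp_all add: qmult_def vector_4_nth)

lemmas cquat_nth = qmult_nth qhat_def qconj_def vector_4_nth
  qone_def qI_def qJ_def qK_def axis_def

lemma quaternion_relations:
  "qI \<odot> qI = - qone" "qJ \<odot> qJ = - qone" "qK \<odot> qK = - qone"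
  "qI \<odot> qJ = qK" "qJ \<odot> qI = - qK" "qone \<odot> q = q" "q \<odot> qone = q"
  by (simp_all add: vec_eq_iff forall_4 cquat_nth)

lemma qmult_assoc: "(p \<odot> q) \<odot> r = p \<odot> (q \<odot> r)"
  unfolding vec_eq_iff forall_4 qmult_nth by (intro conjI; algebra)

lemma qmult_bilinear:
  "(p + p') \<odot> q = p \<odot> q + p' \<odot> q" "p \<odot> (q + q') = p \<odot> q + p \<odot> q'"
  "(c *s p) \<odot> q = c *s (p \<odot> q)" "p \<odot> (c *s q) = c *s (p \<odot> q)"
  unfolding vec_eq_iff forall_4 qmult_nth vector_smult_component vector_add_component
  by (intro conjI; algebra)+

lemma qhat_qmult: "qhat (p \<odot> q) = qhat p \<odot> qhat q"
  by (simp add: vec_eq_iff forall_4 cquat_nth)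

lemma qmult_qconj: "q \<odot> qconj q = qH q q *s qone" "qconj q \<odot> q = qH q q *s qone"
  by (simp_all add: vec_eq_iff forall_4 cquat_nth qH_def sum_4)

lemma qmult_qinv:
  assumes "qH q q \<noteq> 0"
  shows "q \<odot> qinv q = qone" "qinv q \<odot> q = qone"
  using assms by (simp_all add: qinv_def qmult_bilinear qmult_qconj)

lemma mink_R31:
  "qH (vector [\<i> * of_real x1, of_real x2, of_real x3, of_real x4])
      (vector [\<i> * of_real y1, of_real y2, of_real y3, of_real y4])
    = of_real (- x1 * y1 + x2 * y2 + x3 * y3 + x4 * y4)"
  by (simp add: qH_def sum_4 vector_4_nth complex_eq_iff)


section \<open>Calculus on open subsets of the plane\<close>

primrec Ck_on :: "nat \<Rightarrow> 'a::real_normed_vector set \<Rightarrow> ('a \<Rightarrow> 'b::real_normed_vector) \<Rightarrow> bool" where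
  "Ck_on 0 U f \<longleftrightarrow> continuous_on U f"
| "Ck_on (Suc k) U f \<longleftrightarrow>
     (\<forall>x\<in>U. f differentiable (at x)) \<and> (\<forall>v. Ck_on k U (\<lambda>x. frechet_derivative f (at x) v))"

text \<open>Only used for open \<open>U\<close> in finite dimension.\<close>

definition smooth_on :: "'a::real_normed_vector set \<Rightarrow> ('a \<Rightarrow> 'b::real_normed_vector) \<Rightarrow> bool" where
  "smooth_on U f \<longleftrightarrow> (\<forall>k. Ck_on k U f)"

text \<open>
  The real differential \<open>D f z v\<close> of \<open>f\<close> at \<open>z\<close> in the direction \<open>v\<close>. As in the identification
  $\mathbb C \simeq \mathbb R^2$, the plane is \<^typ>\<open>complex\<close> with coordinate frame \<open>1\<close>, \<open>\<i>\<close>.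
\<close>

abbreviation D :: "(complex \<Rightarrow> 'b::real_normed_vector) \<Rightarrow> complex \<Rightarrow> complex \<Rightarrow> 'b" where
  "D f z v \<equiv> frechet_derivative f (at z) v"

definition lie_bracket :: "(complex \<Rightarrow> complex) \<Rightarrow> (complex \<Rightarrow> complex) \<Rightarrow> complex \<Rightarrow> complex" where
  "lie_bracket X Y z = D Y z (X z) - D X z (Y z)"

definition dual_coframe_on ::
  "complex set \<Rightarrow> (complex \<Rightarrow> complex) \<Rightarrow> (complex \<Rightarrow> complex) \<Rightarrow>
   (complex \<Rightarrow> complex \<Rightarrow> real) \<Rightarrow> (complex \<Rightarrow> complex \<Rightarrow> real) \<Rightarrow> bool" where
  "dual_coframe_on U \<alpha>1 \<alpha>2 \<omega>1 \<omega>2 \<longleftrightarrow>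
     (\<forall>z\<in>U. linear (\<omega>1 z) \<and> linear (\<omega>2 z) \<and>
        \<omega>1 z (\<alpha>1 z) = 1 \<and> \<omega>1 z (\<alpha>2 z) = 0 \<and> \<omega>2 z (\<alpha>1 z) = 0 \<and> \<omega>2 z (\<alpha>2 z) = 1)"

text \<open>On constant vector fields $d\xi(v,w) = D_v(\xi(w)) - D_w(\xi(v))$.\<close>

definition closed_form_on :: "complex set \<Rightarrow> (complex \<Rightarrow> complex \<Rightarrow> cquat) \<Rightarrow> bool" where
  "closed_form_on U \<xi> \<longleftrightarrow>
     (\<forall>z\<in>U. linear (\<xi> z) \<and> (\<forall>v. (\<lambda>u. \<xi> u v) differentiable (at z)) \<and>
        (\<forall>v w. D (\<lambda>u. \<xi> u w) z v - D (\<lambda>u. \<xi> u v) z w = 0))"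

text \<open>\<open>F = \<integral>\<xi>\<close> as a map into \<open>R31\<close>; the constant of integration is thereby constrained to \<open>R31\<close>.\<close>

definition primitive_on ::
  "complex set \<Rightarrow> (complex \<Rightarrow> complex \<Rightarrow> cquat) \<Rightarrow> (complex \<Rightarrow> cquat) \<Rightarrow> bool" where
  "primitive_on U \<xi> F \<longleftrightarrow> F ` U \<subseteq> R31 \<and> (\<forall>z\<in>U. (F has_derivative \<xi> z) (at z))"


section \<open>Curvature of a parametrized timelike surface\<close>

definition coord :: "2 \<Rightarrow> complex" where
  "coord i = (if i = 1 then 1 else \<i>)"

abbreviation pd :: "2 \<Rightarrow> (complex \<Rightarrow> 'b::real_normed_vector) \<Rightarrow> complex \<Rightarrow> 'b" where
  "pd i f z \<equiv> D f z (coord i)"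

type_synonym metric = "complex \<Rightarrow> complex \<Rightarrow> complex \<Rightarrow> real"

definition gram :: "metric \<Rightarrow> complex \<Rightarrow> real ^ 2 ^ 2" where
  "gram \<gamma> z = (\<chi> i j. \<gamma> z (coord i) (coord j))"

definition christoffel :: "metric \<Rightarrow> 2 \<Rightarrow> 2 \<Rightarrow> 2 \<Rightarrow> complex \<Rightarrow> real" where
  "christoffel \<gamma> k i j z =
     (\<Sum>l\<in>UNIV. matrix_inv (gram \<gamma> z) $ k $ l *
        (pd i (\<lambda>u. gram \<gamma> u $ j $ l) z + pd j (\<lambda>u. gram \<gamma> u $ i $ l) z
           - pd l (\<lambda>u. gram \<gamma> u $ i $ j) z)) / 2"

text \<open>\<open>riemann \<gamma> l k i j\<close> is the component along $\partial_l$ of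
  $R(\partial_i,\partial_j)\partial_k = \nabla_i\nabla_j\partial_k - \nabla_j\nabla_i\partial_k$
  for the Levi-Civita connection.\<close>

definition riemann :: "metric \<Rightarrow> 2 \<Rightarrow> 2 \<Rightarrow> 2 \<Rightarrow> 2 \<Rightarrow> complex \<Rightarrow> real" where
  "riemann \<gamma> l k i j z =
     pd i (christoffel \<gamma> l j k) z - pd j (christoffel \<gamma> l i k) z
     + (\<Sum>m\<in>UNIV. christoffel \<gamma> l i m z * christoffel \<gamma> m j k z
                  - christoffel \<gamma> l j m z * christoffel \<gamma> m i k z)"

text \<open>$\langle R(\partial_1,\partial_2)\partial_2,\partial_1\rangle$ divided by
  $\gamma_{11}\gamma_{22}-\gamma_{12}^2$.\<close>

definition gauss_curvature :: "metric \<Rightarrow> complex \<Rightarrow> real" where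
  "gauss_curvature \<gamma> z =
     (\<Sum>l\<in>UNIV. riemann \<gamma> l 2 1 2 z * gram \<gamma> z $ l $ 1) / det (gram \<gamma> z)"

definition induced_metric :: "(complex \<Rightarrow> cquat) \<Rightarrow> metric" where
  "induced_metric F z v w = mink (D F z v) (D F z w)"

text \<open>The induced metric is required to have signature $(-,+)$; this forces \<open>D F z\<close> to be injective.\<close>

definition timelike_immersion_on :: "complex set \<Rightarrow> (complex \<Rightarrow> cquat) \<Rightarrow> bool" where
  "timelike_immersion_on U F \<longleftrightarrow>
     F ` U \<subseteq> R31 \<and> smooth_on U F \<and>
     (\<forall>z\<in>U. inj (D F z) \<and>
        (\<exists>v w. induced_metric F z v v = -1 \<and> induced_metric F z w w = 1 \<and>
               induced_metric F z v w = 0))"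

definition tangential_part :: "(complex \<Rightarrow> cquat) \<Rightarrow> complex \<Rightarrow> cquat \<Rightarrow> cquat" where
  "tangential_part F z x =
     (\<Sum>k\<in>UNIV. \<Sum>l\<in>UNIV.
        (matrix_inv (gram (induced_metric F) z) $ k $ l * mink x (pd l F z)) *\<^sub>R pd k F z)"

definition normal_connection ::
  "(complex \<Rightarrow> cquat) \<Rightarrow> 2 \<Rightarrow> (complex \<Rightarrow> cquat) \<Rightarrow> complex \<Rightarrow> cquat" where
  "normal_connection F i \<nu> z = pd i \<nu> z - tangential_part F z (pd i \<nu> z)"

definition orthonormal_normal_frame_on ::
  "complex set \<Rightarrow> (complex \<Rightarrow> cquat) \<Rightarrow> (complex \<Rightarrow> cquat) \<Rightarrow> (complex \<Rightarrow> cquat) \<Rightarrow> bool" where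
  "orthonormal_normal_frame_on V F n1 n2 \<longleftrightarrow>
     smooth_on V n1 \<and> smooth_on V n2 \<and> n1 ` V \<subseteq> R31 \<and> n2 ` V \<subseteq> R31 \<and>
     (\<forall>z\<in>V. mink (n1 z) (n1 z) = 1 \<and> mink (n2 z) (n2 z) = 1 \<and> mink (n1 z) (n2 z) = 0 \<and>
        (\<forall>v. mink (n1 z) (D F z v) = 0 \<and> mink (n2 z) (D F z v) = 0))"

text \<open>
  The normal curvature in a frame \<open>n1\<close>, \<open>n2\<close>:
  $\langle R^N(\partial_1,\partial_2)n_2, n_1\rangle$ divided by the area density. Replacing
  the frame changes it at most by a sign (the relative orientation of the frames).
\<close>

definition normal_curvature ::
  "(complex \<Rightarrow> cquat) \<Rightarrow> (complex \<Rightarrow> cquat) \<Rightarrow> (complex \<Rightarrow> cquat) \<Rightarrow> complex \<Rightarrow> real" where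
  "normal_curvature F n1 n2 z =
     mink (normal_connection F 1 (normal_connection F 2 n2) z
           - normal_connection F 2 (normal_connection F 1 n2) z) (n1 z)
     / sqrt (- det (gram (induced_metric F) z))"

text \<open>
  $K_N = 0$. The quantification is over all local frames; since the normal planes are spacelike,
  such frames exist around every point (project two constant vectors and orthonormalize).
\<close>

definition normal_curvature_vanishes_on :: "complex set \<Rightarrow> (complex \<Rightarrow> cquat) \<Rightarrow> bool" where
  "normal_curvature_vanishes_on U F \<longleftrightarrow>
     (\<forall>V n1 n2. open V \<and> V \<subseteq> U \<and> orthonormal_normal_frame_on V F n1 n2 \<longrightarrow>
        (\<forall>z\<in>V. normal_curvature F n1 n2 z = 0))"

text \<open>
  The Gauss map, for the orientation of the plane in which \<open>(1, \<i>)\<close> is positive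
  (so \<open>(v, w)\<close> is positive iff \<open>Im (cnj v * w) > 0\<close>). The value does not depend on the basis.
\<close>

definition gauss_map :: "(complex \<Rightarrow> cquat) \<Rightarrow> complex \<Rightarrow> cquat" where
  "gauss_map F z = (THE q. \<exists>v w. Im (cnj v * w) > 0 \<and>
     induced_metric F z v v = -1 \<and> induced_metric F z w w = 1 \<and> induced_metric F z v w = 0 \<and>
     q = D F z v \<odot> qhat (D F z w))"

definition regular_gauss_map_on :: "complex set \<Rightarrow> (complex \<Rightarrow> cquat) \<Rightarrow> bool" where
  "regular_gauss_map_on U F \<longleftrightarrow> (\<forall>z\<in>U. inj (D (gauss_map F) z))"

definition nondegenerate_osculating_on :: "complex set \<Rightarrow> (complex \<Rightarrow> cquat) \<Rightarrow> bool" where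
  "nondegenerate_osculating_on U F \<longleftrightarrow>
     (\<forall>z\<in>U. \<exists>v. qH (D (gauss_map F) z v) (D (gauss_map F) z v) \<noteq> 0)"


section \<open>Immersed surfaces\<close>

text \<open>
  An oriented smooth surface is a topological space with an oriented smooth atlas; a chart is a
  pair of an open set and a homeomorphism of it onto an open subset of the plane.
\<close>

type_synonym 'a chart = "'a set \<times> ('a \<Rightarrow> complex)"

definition topological_chart :: "'a topology \<Rightarrow> 'a chart \<Rightarrow> bool" where
  "topological_chart M = (\<lambda>(W, \<phi>). openin M W \<and> open (\<phi> ` W) \<and>
     homeomorphic_map (subtopology M W) (top_of_set (\<phi> ` W)) \<phi>)"

definition chart_inv :: "'a chart \<Rightarrow> complex \<Rightarrow> 'a" where
  "chart_inv = (\<lambda>(W, \<phi>). inv_into W \<phi>)"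

definition transition :: "'a chart \<Rightarrow> 'a chart \<Rightarrow> complex \<Rightarrow> complex" where
  "transition c c' = snd c' \<circ> chart_inv c"

definition overlap :: "'a chart \<Rightarrow> 'a chart \<Rightarrow> complex set" where
  "overlap c c' = snd c ` (fst c \<inter> fst c')"

definition oriented_smooth_surface :: "'a topology \<Rightarrow> 'a chart set \<Rightarrow> bool" where
  "oriented_smooth_surface M \<A> \<longleftrightarrow>
     Hausdorff_space M \<and> second_countable M \<and>
     (\<forall>c\<in>\<A>. topological_chart M c) \<and> (\<Union>c\<in>\<A>. fst c) = topspace M \<and>
     (\<forall>c\<in>\<A>. \<forall>c'\<in>\<A>. smooth_on (overlap c c') (transition c c') \<and>
        (\<forall>z\<in>overlap c c'. Im (cnj (D (transition c c') z 1) * D (transition c c') z \<i>) > 0))"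

text \<open>A smooth chart not necessarily in the atlas, and not necessarily orientation preserving.\<close>

definition smooth_chart :: "'a topology \<Rightarrow> 'a chart set \<Rightarrow> 'a chart \<Rightarrow> bool" where
  "smooth_chart M \<A> c \<longleftrightarrow> topological_chart M c \<and>
     (\<forall>c'\<in>\<A>. smooth_on (overlap c c') (transition c c') \<and>
             smooth_on (overlap c' c) (transition c' c))"

text \<open>
  \<open>M\<close> carries the metric induced by \<open>F\<close>, so that \<open>F\<close> is isometric. All notions are
  invariant under the (oriented) changes of charts of the atlas.
\<close>

definition in_all_charts ::
  "'a chart set \<Rightarrow> ('a \<Rightarrow> cquat) \<Rightarrow> (complex set \<Rightarrow> (complex \<Rightarrow> cquat) \<Rightarrow> bool) \<Rightarrow> bool" where
  "in_all_charts \<A> F P \<longleftrightarrow> (\<forall>c\<in>\<A>. P (snd c ` fst c) (F \<circ> chart_inv c))"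


section \<open>The representation data\<close>

definition alpha1 ::
  "(complex \<Rightarrow> complex) \<Rightarrow> (complex \<Rightarrow> complex) \<Rightarrow> (complex \<Rightarrow> real) \<Rightarrow> (complex \<Rightarrow> real) \<Rightarrow>
   complex \<Rightarrow> complex" where
  "alpha1 f1 f2 h1 h2 z =
     - \<i> * ((of_real (h1 z) * f1 z + \<i> * of_real (h2 z) * f2 z) / ((f1 z)\<^sup>2 - (f2 z)\<^sup>2))"

definition alpha2 ::
  "(complex \<Rightarrow> complex) \<Rightarrow> (complex \<Rightarrow> complex) \<Rightarrow> (complex \<Rightarrow> real) \<Rightarrow> (complex \<Rightarrow> real) \<Rightarrow>
   complex \<Rightarrow> complex" where
  "alpha2 f1 f2 h1 h2 z =
     (of_real (h2 z) * f1 z - \<i> * of_real (h1 z) * f2 z) / ((f1 z)\<^sup>2 - (f2 z)\<^sup>2)"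

text \<open>$\theta_j = f_j\,dz$ takes the value \<open>fj z * v\<close> on the tangent vector \<open>v\<close> at \<open>z\<close>.\<close>

definition representation_data ::
  "complex set \<Rightarrow> (complex \<Rightarrow> complex) \<Rightarrow> (complex \<Rightarrow> complex) \<Rightarrow>
   (complex \<Rightarrow> real) \<Rightarrow> (complex \<Rightarrow> real) \<Rightarrow> (complex \<Rightarrow> cquat) \<Rightarrow>
   (complex \<Rightarrow> complex \<Rightarrow> real) \<Rightarrow> (complex \<Rightarrow> complex \<Rightarrow> real) \<Rightarrow> bool" where
  "representation_data U f1 f2 h1 h2 g \<omega>1 \<omega>2 \<longleftrightarrow>
     U \<noteq> {} \<and> open U \<and> simply_connected U \<and>
     f1 holomorphic_on U \<and> f2 holomorphic_on U \<and> (\<forall>z\<in>U. (f1 z)\<^sup>2 - (f2 z)\<^sup>2 \<noteq> 0) \<and>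
     smooth_on U h1 \<and> smooth_on U h2 \<and>
     (\<forall>z\<in>U. \<forall>a b :: real.
        a *\<^sub>R alpha1 f1 f2 h1 h2 z + b *\<^sub>R alpha2 f1 f2 h1 h2 z = 0 \<longrightarrow> a = 0 \<and> b = 0) \<and>
     (\<forall>z\<in>U. lie_bracket (alpha1 f1 f2 h1 h2) (alpha2 f1 f2 h1 h2) z = 0) \<and>
     g ` U \<subseteq> Spin31 \<and>
     (\<forall>z\<in>U. g differentiable (at z) \<and>
        (\<forall>v. D g z v \<odot> qinv (g z) = (f1 z * v) *s qJ + (f2 z * v) *s (\<i> *s qK))) \<and>
     dual_coframe_on U (alpha1 f1 f2 h1 h2) (alpha2 f1 f2 h1 h2) \<omega>1 \<omega>2"

definition xi ::
  "(complex \<Rightarrow> cquat) \<Rightarrow> (complex \<Rightarrow> complex \<Rightarrow> real) \<Rightarrow> (complex \<Rightarrow> complex \<Rightarrow> real) \<Rightarrow>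
   complex \<Rightarrow> complex \<Rightarrow> cquat" where
  "xi g \<omega>1 \<omega>2 z v =
     qinv (g z) \<odot> (of_real (\<omega>1 z v) *s (\<i> *s qone) + of_real (\<omega>2 z v) *s qI) \<odot> qhat (g z)"

end

theory Submission
  imports Defs "HOL-Complex_Analysis.Complex_Analysis"
begin

text \<open>
  For a spin-valued \<open>g\<close> the vectors \<open>g\<^sup>-\<^sup>1 e\<^sub>j qhat g\<close> with \<open>e\<^sub>j = \<i>, I, J, K\<close> form a Lorentz
  frame, and the form \<open>\<eta> = dg g\<^sup>-\<^sup>1 = \<eta>\<^sub>I I + \<eta>\<^sub>J J + \<eta>\<^sub>K K\<close> collects its connection: if the first two vectors
  are tangent to a surface, the imaginary and real parts of \<open>2 \<eta>\<^sub>I\<close> are the connection forms of the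
  tangent and of the normal bundle, and \<open>\<eta>\<^sub>J\<close>, \<open>\<eta>\<^sub>K\<close> are the second fundamental form. When \<open>\<eta>\<^sub>I = 0\<close> both
  bundles are flat, and \<open>d\<xi> = 0\<close> reduces to \<open>d\<omega>\<^sub>1 = d\<omega>\<^sub>2 = 0\<close>, which is \<open>[\<alpha>\<^sub>1, \<alpha>\<^sub>2] = 0\<close>, and to the reality of
  \<open>\<i> (f\<^sub>1 \<alpha>\<^sub>1 - f\<^sub>2 \<alpha>\<^sub>2) = h\<^sub>1\<close> and \<open>f\<^sub>1 \<alpha>\<^sub>2 - f\<^sub>2 \<alpha>\<^sub>1 = h\<^sub>2\<close>.

  Conversely, an orthonormal tangent frame of the surface lifts explicitly to some \<open>g\<close>. The condition
  \<open>K = K\<^sub>N = 0\<close> means that the complex form \<open>\<eta>\<^sub>I\<close> is closed, so that multiplying \<open>g\<close> by \<open>cos \<tau> + sin \<tau> I\<close> with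
  \<open>d\<tau> = - \<eta>\<^sub>I\<close> makes it vanish. Then \<open>d\<eta> = \<eta> \<and> \<eta>\<close> says that \<open>\<eta>\<^sub>J\<close> and \<open>\<eta>\<^sub>K\<close> are closed and linearly dependent
  over the complex numbers. As the Gauss map is regular, one of them is injective, and its primitive is
  the coordinate \<open>z\<close>; the other one is then \<open>f dz\<close> with \<open>f\<close> holomorphic because it is closed. The Gauss
  map satisfies \<open>H(dG, dG) = - 4 (\<eta>\<^sub>J\<^sup>2 + \<eta>\<^sub>K\<^sup>2)\<close>, which gives \<open>f\<^sub>1\<^sup>2 - f\<^sub>2\<^sup>2 \<noteq> 0\<close>.
\<close>

text \<open>The formulas for \<open>alpha1\<close> and \<open>alpha2\<close> are Cramer's rule for
  the complex system \<open>f1 \<alpha>1 - f2 \<alpha>2 = - \<i> h1\<close>,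
  \<open>f1 \<alpha>2 - f2 \<alpha>1 = h2\<close> of determinant
  \<open>f1\<^sup>2 - f2\<^sup>2\<close>. That \<open>h1\<close> and \<open>h2\<close> are real is
  the symmetry of the second fundamental form, one equation for each normal direction, so both
  halves of the theorem pass through the same equivalence \<open>D_xi_symmetric_iff\<close>. In the
  converse the obstacle is that regularity of the Gauss map concerns the pair of the J- and
  K-components of dg g^{-1}, while a coordinate needs one injective component. Their linear
  dependence bridges the gap: if each had a nonzero kernel vector, one of these vectors would lie in
  both kernels and be annihilated by dG. The explicit lift to the spin group degenerates at
  antipodal positions. These are avoided by choosing the signs of two tangent vectors at one point,
  which may reverse the orientation of the frame; the price is only a sign in the formula for the
  Gauss map.\<close>

no_notation fps_nth (infixl "$" 75)

section \<open>Smooth maps\<close>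

lemma has_derivative_frechet:
  "f differentiable (at x) \<Longrightarrow> (f has_derivative frechet_derivative f (at x)) (at x)"
  by (simp add: frechet_derivative_works)

lemma frechet_derivative_eqI:
  "(f has_derivative f') (at x) \<Longrightarrow> frechet_derivative f (at x) = f'"
  by (rule frechet_derivative_at [symmetric])

lemma Ck_on_subset: "Ck_on k U f \<Longrightarrow> V \<subseteq> U \<Longrightarrow> Ck_on k V f"
  by (induction k arbitrary: f) (auto intro: continuous_on_subset)

lemma differentiable_on_imp_continuous_on_at:
  "(\<And>x. x \<in> U \<Longrightarrow> f differentiable (at x)) \<Longrightarrow> continuous_on U f"
  by (simp add: continuous_at_imp_continuous_on differentiable_imp_continuous_within)

lemma Ck_on_SucD: "Ck_on (Suc k) U f \<Longrightarrow> Ck_on k U f"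
  by (induction k arbitrary: f) (auto intro: differentiable_on_imp_continuous_on_at)

text \<open>The derivative at a point sees only the germ of the map, so on an open set equality of
  values passes to all derivatives.\<close>

lemma Ck_on_cong:
  assumes "open U" "\<And>x. x \<in> U \<Longrightarrow> f x = g x" "Ck_on k U f"
  shows "Ck_on k U g"
  using assms(2,3)
proof (induction k arbitrary: f g)
  case 0
  then show ?case by (auto cong: continuous_on_cong)
next
  case (Suc k)
  have *: "g differentiable (at x) \<and> frechet_derivative f (at x) = frechet_derivative g (at x)"
    if "x \<in> U" for x
  proof -
    have "(f has_derivative frechet_derivative f (at x)) (at x)"
      using Suc.prems that by (simp add: has_derivative_frechet)
    then have "(g has_derivative frechet_derivative f (at x)) (at x)"
      using Suc.prems that assms(1) by (blast intro: has_derivative_transform_within_open)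
    then show ?thesis
      using differentiableI frechet_derivative_at by blast
  qed
  have "Ck_on k U (\<lambda>x. frechet_derivative g (at x) v)" for v
    by (rule Suc.IH[of "\<lambda>x. frechet_derivative f (at x) v"]) (use Suc.prems * in auto)
  then show ?case
    using * by auto
qed

text \<open>Lets a derivative be supplied by formula, so that the closure properties below reduce to
  a differentiation rule and the induction hypothesis.\<close>

lemma Ck_on_SucI:
  assumes "\<And>x. x \<in> U \<Longrightarrow> (f has_derivative f' x) (at x)"
    and "\<And>v. Ck_on k U (\<lambda>x. f' x v)" and "open U"
  shows "Ck_on (Suc k) U f"
proof -
  have "Ck_on k U (\<lambda>x. frechet_derivative f (at x) v)" for v
    by (rule Ck_on_cong[OF assms(3) _ assms(2)]) (simp add: frechet_derivative_eqI[OF assms(1)])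
  then show ?thesis
    using assms(1) by (auto intro: differentiableI)
qed

lemma Ck_on_const: "Ck_on k U (\<lambda>x. c)"
  by (induction k arbitrary: c) auto

lemma Ck_on_bounded_linear:
  assumes "bounded_linear f"
  shows "Ck_on k U f"
proof (cases k)
  case 0
  then show ?thesis using assms by (simp add: linear_continuous_on)
next
  case (Suc j)
  have der: "(f has_derivative f) (at x)" for x
    using assms by (rule bounded_linear_imp_has_derivative)
  show ?thesis
    using Suc by (auto simp: Ck_on_const frechet_derivative_eqI[OF der] intro: differentiableI[OF der])
qed

lemma Ck_on_compose_linear:
  assumes "bounded_linear h" "open U" "Ck_on k U f"
  shows "Ck_on k U (\<lambda>x. h (f x))"
  using assms(3)
proof (induction k arbitrary: f)
  case 0
  then show ?case using assms(1) by (auto intro: bounded_linear.continuous_on)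
next
  case (Suc k)
  show ?case
  proof (rule Ck_on_SucI[OF _ _ assms(2)])
    show "((\<lambda>x. h (f x)) has_derivative (\<lambda>v. h (frechet_derivative f (at x) v))) (at x)"
      if "x \<in> U" for x
      using Suc.prems that by (auto intro!: bounded_linear.has_derivative[OF assms(1)] has_derivative_frechet)
    show "Ck_on k U (\<lambda>x. h (frechet_derivative f (at x) v))" for v
      using Suc by simp
  qed
qed

lemma Ck_on_add:
  assumes "open U" "Ck_on k U f" "Ck_on k U g"
  shows "Ck_on k U (\<lambda>x. f x + g x)"
  using assms(2,3)
proof (induction k arbitrary: f g)
  case 0
  then show ?case by (auto intro: continuous_on_add)
next
  case (Suc k)
  show ?case
  proof (rule Ck_on_SucI[OF _ _ assms(1)])
    show "((\<lambda>x. f x + g x) has_derivative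
        (\<lambda>v. frechet_derivative f (at x) v + frechet_derivative g (at x) v)) (at x)" if "x \<in> U" for x
      using Suc.prems that by (intro has_derivative_add has_derivative_frechet) auto
  qed (use Suc in auto)
qed

lemma Ck_on_bilinear:
  assumes "bounded_bilinear P" "open U" "Ck_on k U f" "Ck_on k U g"
  shows "Ck_on k U (\<lambda>x. P (f x) (g x))"
  using assms(3,4)
proof (induction k arbitrary: f g)
  case 0
  then show ?case using assms(1) by (auto intro: bounded_bilinear.continuous_on)
next
  case (Suc k)
  have fg: "Ck_on k U f" "Ck_on k U g"
    using Suc.prems by (blast dest: Ck_on_SucD)+
  show ?case
  proof (rule Ck_on_SucI[OF _ _ assms(2)])
    show "((\<lambda>x. P (f x) (g x)) has_derivative
        (\<lambda>v. P (f x) (frechet_derivative g (at x) v) + P (frechet_derivative f (at x) v) (g x))) (at x)"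
      if "x \<in> U" for x
      using Suc.prems that by (intro bounded_bilinear.FDERIV[OF assms(1)] has_derivative_frechet) auto
    show "Ck_on k U (\<lambda>x. P (f x) (frechet_derivative g (at x) v) + P (frechet_derivative f (at x) v) (g x))"
      for v
      using Suc.prems fg by (intro Ck_on_add[OF assms(2)] Suc.IH) auto
  qed
qed

lemma Ck_on_sum:
  assumes "open U" "\<And>i. i \<in> I \<Longrightarrow> Ck_on k U (f i)"
  shows "Ck_on k U (\<lambda>x. \<Sum>i\<in>I. f i x)"
  using assms(2)
  by (induction I rule: infinite_finite_induct) (auto intro: Ck_on_const Ck_on_add assms(1))

text \<open>The chain rule evaluates the derivative of \<open>h\<close> in the direction
  \<open>frechet_derivative f (at x) v\<close>, which moves with \<open>x\<close>, whereas
  \<open>Ck_on\<close> speaks of fixed directions. Expanding that direction in a basis gives a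
  finite sum of products to which the induction hypothesis applies.\<close>

lemma Ck_on_compose:
  fixes f :: "'a::real_normed_vector \<Rightarrow> 'b::euclidean_space"
  assumes "open U" "open V" "f ` U \<subseteq> V" "Ck_on k U f" "Ck_on k V h"
  shows "Ck_on k U (\<lambda>x. h (f x))"
  using assms(4,5)
proof (induction k arbitrary: h)
  case 0
  then show ?case using assms(3) by (auto intro: continuous_on_compose2)
next
  case (Suc k)
  show ?case
  proof (rule Ck_on_SucI[OF _ _ assms(1)])
    fix x assume x: "x \<in> U"
    have f: "(f has_derivative frechet_derivative f (at x)) (at x)"
      using Suc.prems x by (simp add: has_derivative_frechet)
    have h: "(h has_derivative frechet_derivative h (at (f x))) (at (f x))"
      using Suc.prems x assms(3) by (auto intro!: has_derivative_frechet)
    have lin: "linear (frechet_derivative h (at (f x)))"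
      using h by (rule has_derivative_linear)
    have sum: "frechet_derivative h (at (f x)) w
        = (\<Sum>b\<in>Basis. (w \<bullet> b) *\<^sub>R frechet_derivative h (at (f x)) b)" for w
      using linear_sum[OF lin, of "\<lambda>b. (w \<bullet> b) *\<^sub>R b" Basis]
      by (simp add: euclidean_representation linear_cmul[OF lin])
    show "((\<lambda>x. h (f x)) has_derivative
       (\<lambda>v. \<Sum>b\<in>Basis. (frechet_derivative f (at x) v \<bullet> b) *\<^sub>R frechet_derivative h (at (f x)) b)) (at x)"
      by (rule has_derivative_eq_rhs[OF has_derivative_compose[OF f h]]) (rule ext, rule sum)
  next
    fix v
    have f: "Ck_on k U (\<lambda>x. frechet_derivative f (at x) v)"
      and h: "\<And>b. Ck_on k V (\<lambda>y. frechet_derivative h (at y) b)"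
      using Suc.prems by auto
    have "Ck_on k U f"
      using Suc.prems(1) by (rule Ck_on_SucD)
    show "Ck_on k U (\<lambda>x. \<Sum>b\<in>Basis. (frechet_derivative f (at x) v \<bullet> b)
        *\<^sub>R frechet_derivative h (at (f x)) b)"
      using f h Suc.IH \<open>Ck_on k U f\<close>
      by (intro Ck_on_sum Ck_on_bilinear[OF bounded_bilinear_scaleR] assms(1)
            Ck_on_compose_linear[OF bounded_linear_inner_left]) auto
  qed
qed

section \<open>Calculus of smooth maps and elementary functions\<close>

lemma smooth_on_subset: "smooth_on U f \<Longrightarrow> V \<subseteq> U \<Longrightarrow> smooth_on V f"
  using Ck_on_subset unfolding smooth_on_def by blast

lemma smooth_on_cong:
  "open U \<Longrightarrow> (\<And>x. x \<in> U \<Longrightarrow> f x = g x) \<Longrightarrow> smooth_on U f \<Longrightarrow> smooth_on U g"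
  using Ck_on_cong unfolding smooth_on_def by blast

lemma smooth_on_differentiable: "smooth_on U f \<Longrightarrow> x \<in> U \<Longrightarrow> f differentiable (at x)"
  unfolding smooth_on_def using Ck_on.simps(2) by blast

lemma smooth_on_continuous: "smooth_on U f \<Longrightarrow> continuous_on U f"
  unfolding smooth_on_def using Ck_on.simps(1) by blast

lemma smooth_on_frechet: "smooth_on U f \<Longrightarrow> smooth_on U (\<lambda>x. frechet_derivative f (at x) v)"
  unfolding smooth_on_def using Ck_on.simps(2) by blast

lemma smooth_onI_derivative:
  assumes "open U" "\<And>x. x \<in> U \<Longrightarrow> (f has_derivative f' x) (at x)"
    and "\<And>v. smooth_on U (\<lambda>x. f' x v)"
  shows "smooth_on U f"
  unfolding smooth_on_def
proof
  fix k
  show "Ck_on k U f"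
    by (rule Ck_on_SucD, rule Ck_on_SucI) (use assms in \<open>auto simp: smooth_on_def\<close>)
qed

text \<open>Bootstrapping: a differential equation expressing \<open>f'\<close> through \<open>f\<close> yields all derivatives.\<close>

lemma smooth_onI_bootstrap:
  assumes "open U" "\<And>x. x \<in> U \<Longrightarrow> (f has_derivative f' x) (at x)"
    and "\<And>k v. Ck_on k U f \<Longrightarrow> Ck_on k U (\<lambda>x. f' x v)"
  shows "smooth_on U f"
  unfolding smooth_on_def
proof
  fix k
  show "Ck_on k U f"
  proof (induction k)
    case 0
    have "\<And>x. x \<in> U \<Longrightarrow> f differentiable at x"
      using assms(2) differentiableI by blast
    then show ?case
      by (simp add: differentiable_on_imp_continuous_on_at)
  qed (use assms Ck_on_SucI in blast)
qed

lemma smooth_on_const: "smooth_on U (\<lambda>x. c)"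
  by (simp add: smooth_on_def Ck_on_const)

lemma smooth_on_linear: "bounded_linear f \<Longrightarrow> smooth_on U f"
  by (simp add: smooth_on_def Ck_on_bounded_linear)

lemma smooth_on_compose_linear:
  "bounded_linear h \<Longrightarrow> open U \<Longrightarrow> smooth_on U f \<Longrightarrow> smooth_on U (\<lambda>x. h (f x))"
  by (simp add: smooth_on_def Ck_on_compose_linear)

lemma smooth_on_add:
  "open U \<Longrightarrow> smooth_on U f \<Longrightarrow> smooth_on U g \<Longrightarrow> smooth_on U (\<lambda>x. f x + g x)"
  by (simp add: smooth_on_def Ck_on_add)

lemma smooth_on_bilinear:
  "bounded_bilinear P \<Longrightarrow> open U \<Longrightarrow> smooth_on U f \<Longrightarrow> smooth_on U g \<Longrightarrow> smooth_on U (\<lambda>x. P (f x) (g x))"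
  by (simp add: smooth_on_def Ck_on_bilinear)

lemma smooth_on_compose:
  fixes f :: "'a::real_normed_vector \<Rightarrow> 'b::euclidean_space"
  shows "open U \<Longrightarrow> open V \<Longrightarrow> f ` U \<subseteq> V \<Longrightarrow> smooth_on U f \<Longrightarrow> smooth_on V h
    \<Longrightarrow> smooth_on U (\<lambda>x. h (f x))"
  by (simp add: smooth_on_def Ck_on_compose)

lemma smooth_on_minus: "open U \<Longrightarrow> smooth_on U f \<Longrightarrow> smooth_on U (\<lambda>x. - f x)"
  using smooth_on_compose_linear[OF bounded_linear_minus[OF bounded_linear_ident]] .

lemma smooth_on_diff:
  "open U \<Longrightarrow> smooth_on U f \<Longrightarrow> smooth_on U g \<Longrightarrow> smooth_on U (\<lambda>x. f x - g x)"
  using smooth_on_add[of U f "\<lambda>x. - g x"] smooth_on_minus[of U g] by simp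

lemmas smooth_on_mult = smooth_on_bilinear[OF bounded_bilinear_mult]
lemmas smooth_on_scaleR = smooth_on_bilinear[OF bounded_bilinear_scaleR]
lemmas smooth_on_Re = smooth_on_compose_linear[OF bounded_linear_Re]
lemmas smooth_on_Im = smooth_on_compose_linear[OF bounded_linear_Im]
lemmas smooth_on_cnj = smooth_on_compose_linear[OF bounded_linear_cnj]
lemmas smooth_on_of_real = smooth_on_compose_linear[OF bounded_linear_of_real]

lemma holomorphic_imp_smooth_on:
  fixes f :: "complex \<Rightarrow> complex"
  assumes "open U" "f holomorphic_on U"
  shows "smooth_on U f"
proof -
  have "Ck_on k U f" for k
    using assms(2)
  proof (induction k arbitrary: f)
    case 0
    then show ?case by (simp add: holomorphic_on_imp_continuous_on)
  next
    case (Suc k)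
    show ?case
    proof (rule Ck_on_SucI[OF _ _ assms(1)])
      show "(f has_derivative (\<lambda>v. deriv f x * v)) (at x)" if "x \<in> U" for x
        using holomorphic_derivI[OF Suc.prems assms(1) that] by (simp add: has_field_derivative_def)
      have "Ck_on k U (deriv f)"
        using Suc holomorphic_deriv[OF Suc.prems assms(1)] by blast
      then show "Ck_on k U (\<lambda>x. deriv f x * v)" for v
        by (intro Ck_on_bilinear[OF bounded_bilinear_mult] Ck_on_const assms(1))
    qed
  qed
  then show ?thesis by (simp add: smooth_on_def)
qed

text \<open>Complex analysis is the source of all nonlinear smooth functions here: cosine, sine and
  inverse directly, real quotients as real parts of complex ones, and the real square root from
  \<open>csqrt\<close> on the slit plane.\<close>

lemma smooth_on_holomorphic_compose:
  fixes f :: "'a::real_normed_vector \<Rightarrow> complex"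
  assumes "open U" "open V" "h holomorphic_on V" "f ` U \<subseteq> V" "smooth_on U f"
  shows "smooth_on U (\<lambda>x. h (f x))"
  using smooth_on_compose[OF assms(1,2,4,5) holomorphic_imp_smooth_on[OF assms(2,3)]] .

lemma smooth_on_cos: 
  fixes f :: "'a::real_normed_vector \<Rightarrow> complex"
  shows "open U \<Longrightarrow> smooth_on U f \<Longrightarrow> smooth_on U (\<lambda>x. cos (f x))"
  by (rule smooth_on_holomorphic_compose[where V=UNIV]) (auto intro: holomorphic_intros)

lemma smooth_on_sin: 
  fixes f :: "'a::real_normed_vector \<Rightarrow> complex"
  shows "open U \<Longrightarrow> smooth_on U f \<Longrightarrow> smooth_on U (\<lambda>x. sin (f x))"
  by (rule smooth_on_holomorphic_compose[where V=UNIV]) (auto intro: holomorphic_intros)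

lemma smooth_on_inverse:
  fixes f :: "'a::real_normed_vector \<Rightarrow> complex"
  shows "open U \<Longrightarrow> (\<And>x. x \<in> U \<Longrightarrow> f x \<noteq> 0) \<Longrightarrow> smooth_on U f \<Longrightarrow> smooth_on U (\<lambda>x. inverse (f x))"
  by (rule smooth_on_holomorphic_compose[where V="-{0}"]) (auto intro!: holomorphic_intros)

lemma smooth_on_divide:
  fixes f :: "'a::real_normed_vector \<Rightarrow> complex"
  shows "open U \<Longrightarrow> (\<And>x. x \<in> U \<Longrightarrow> g x \<noteq> 0) \<Longrightarrow> smooth_on U f \<Longrightarrow> smooth_on U g
    \<Longrightarrow> smooth_on U (\<lambda>x. f x / g x)"
  by (simp add: divide_inverse smooth_on_mult smooth_on_inverse)

lemma smooth_on_divide_real: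
  fixes f :: "'a::real_normed_vector \<Rightarrow> real"
  assumes "open U" "\<And>x. x \<in> U \<Longrightarrow> g x \<noteq> 0" "smooth_on U f" "smooth_on U g"
  shows "smooth_on U (\<lambda>x. f x / g x)"
proof -
  have "smooth_on U (\<lambda>x. Re (of_real (f x) / of_real (g x)))"
    using assms by (intro smooth_on_Re smooth_on_divide smooth_on_of_real) auto
  then show ?thesis by simp
qed

lemma smooth_on_sqrt:
  fixes f :: "'a::real_normed_vector \<Rightarrow> real"
  assumes "open U" "\<And>x. x \<in> U \<Longrightarrow> f x > 0" "smooth_on U f"
  shows "smooth_on U (\<lambda>x. sqrt (f x))"
proof -
  have "open (- \<real>\<^sub>\<le>\<^sub>0 :: complex set)" "csqrt holomorphic_on - \<real>\<^sub>\<le>\<^sub>0"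
    by (auto intro: holomorphic_intros)
  moreover have "(\<lambda>x. of_real (f x)) ` U \<subseteq> - \<real>\<^sub>\<le>\<^sub>0"
    using assms(2) by (force simp: complex_nonpos_Reals_iff)
  ultimately have sm: "smooth_on U (\<lambda>x. Re (csqrt (of_real (f x))))"
    using smooth_on_of_real[OF assms(1,3)]
    by (intro smooth_on_Re assms(1)) (rule smooth_on_holomorphic_compose[OF assms(1)])
  show ?thesis
    by (rule smooth_on_cong[OF assms(1) _ sm]) (use assms(2) in \<open>force simp: less_imp_le\<close>)
qed

section \<open>Mixed derivatives, the Poincare lemma and local inverses\<close>

lemma smooth_on_has_derivative:
  "smooth_on U f \<Longrightarrow> x \<in> U \<Longrightarrow> (f has_derivative frechet_derivative f (at x)) (at x)"
  by (simp add: has_derivative_frechet smooth_on_differentiable)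

lemma has_vector_derivative_smooth_compose:
  assumes "smooth_on U f" "c t \<in> U" "(c has_vector_derivative w) (at t within S)"
  shows "((\<lambda>t. f (c t)) has_vector_derivative frechet_derivative f (at (c t)) w) (at t within S)"
  using vector_derivative_diff_chain_within[OF assms(3)
      has_derivative_at_withinI[OF smooth_on_has_derivative[OF assms(1,2)]]]
  by (simp add: o_def)

text \<open>On the parallelogram \<open>P s t\<close>, integrating the \<open>w\<close>-derivative
  of \<open>f\<close> in \<open>t\<close> gives \<open>f (P s t) - f (P s 0)\<close>.
  Differentiating this in \<open>s\<close> at 0, under the integral on one side and directly on the
  other, expresses the increment of the \<open>v\<close>-derivative as an integral of the mixed
  derivative; differentiating once more in \<open>t\<close> at 0 gives the claim.\<close>

lemma mixed_derivatives_commute: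
  fixes f :: "'a::euclidean_space \<Rightarrow> 'b::euclidean_space"
  assumes U: "open U" "x \<in> U" and f: "smooth_on U f"
  shows "frechet_derivative (\<lambda>u. frechet_derivative f (at u) w) (at x) v
       = frechet_derivative (\<lambda>u. frechet_derivative f (at u) v) (at x) w"
proof -
  define \<phi> where "\<phi> = (\<lambda>u. frechet_derivative f (at u) w)"
  define \<psi> where "\<psi> = (\<lambda>u. frechet_derivative f (at u) v)"
  define \<rho> where "\<rho> = (\<lambda>u. frechet_derivative \<phi> (at u) v)"
  have sm: "smooth_on U \<phi>" "smooth_on U \<psi>" "smooth_on U \<rho>"
    unfolding \<phi>_def \<psi>_def \<rho>_def by (intro smooth_on_frechet f)+
  define P where "P s t = x + s *\<^sub>R v + t *\<^sub>R w" for s t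
  have P0: "P 0 0 = x" by (simp add: P_def)
  have dP: "((\<lambda>s. P s t) has_vector_derivative v) (at s within S)"
    "((\<lambda>t. P s t) has_vector_derivative w) (at t within S)" for s t S
    unfolding P_def by (auto intro!: derivative_eq_intros)
  obtain d where d: "d > 0" and mem: "\<And>s t. \<bar>s\<bar> \<le> d \<Longrightarrow> \<bar>t\<bar> \<le> d \<Longrightarrow> P s t \<in> U"
  proof -
    have "continuous_on UNIV (\<lambda>p. P (fst p) (snd p))"
      unfolding P_def by (intro continuous_intros)
    then have "open ((\<lambda>p. P (fst p) (snd p)) -` U)"
      using U(1) continuous_on_open_vimage[OF open_UNIV] by auto
    moreover have "(0, 0) \<in> (\<lambda>p. P (fst p) (snd p)) -` U"
      using U(2) by (simp add: P0)
    ultimately obtain A B where AB: "open A" "open B" "(0, 0) \<in> A \<times> B" "A \<times> B \<subseteq> (\<lambda>p. P (fst p) (snd p)) -` U"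
      by (rule open_prod_elim)
    then have "0 \<in> A \<inter> B" "open (A \<inter> B)" by auto
    then obtain d where "d > 0" "cball 0 d \<subseteq> A \<inter> B"
      using open_contains_cball by blast
    with AB(4) show ?thesis
      by (intro that[of d]) (auto simp: subset_iff dist_real_def)
  qed
  have cont: "continuous_on {0..t} (\<lambda>\<sigma>. k (P s \<sigma>))" if "continuous_on U k" "\<bar>s\<bar> \<le> d" "t \<le> d"
    for s t and k :: "'a \<Rightarrow> 'b"
    by (rule continuous_on_compose2[OF that(1)])
       (use that in \<open>auto intro!: mem continuous_on_vector_derivative[OF dP(2)]\<close>)
  have step: "\<psi> (P 0 t) - \<psi> (P 0 0) = integral {0..t} (\<lambda>\<sigma>. \<rho> (P 0 \<sigma>))" if t: "t \<in> {0..d}" for t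
  proof -
    define S where "S = {-d<..<d}"
    have S: "open S" "0 \<in> S" "convex S"
      using d by (auto simp: S_def)
    have inU: "P s \<sigma> \<in> U" if "s \<in> S" "\<sigma> \<in> {0..t}" for s \<sigma>
      using that t by (intro mem) (auto simp: S_def)
    have int: "integral (cbox 0 t) (\<lambda>\<sigma>. \<phi> (P s \<sigma>)) = f (P s t) - f (P s 0)" if s: "s \<in> S" for s
    proof -
      have "((\<lambda>\<sigma>. \<phi> (P s \<sigma>)) has_integral f (P s t) - f (P s 0)) {0..t}"
        unfolding \<phi>_def
        by (rule fundamental_theorem_of_calculus)
           (use t inU[OF s] has_vector_derivative_smooth_compose[OF f _ dP(2)] in auto)
      then show ?thesis by (simp add: integral_unique)
    qed
    have 1: "((\<lambda>s. integral (cbox 0 t) (\<lambda>\<sigma>. \<phi> (P s \<sigma>))) has_vector_derivative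
        integral (cbox 0 t) (\<lambda>\<sigma>. \<rho> (P 0 \<sigma>))) (at 0 within S)"
    proof (rule leibniz_rule_vector_derivative[OF _ _ _ S(2,3)])
      show "((\<lambda>s. \<phi> (P s \<sigma>)) has_vector_derivative \<rho> (P s \<sigma>)) (at s within S)"
        if "s \<in> S" "\<sigma> \<in> cbox 0 t" for s \<sigma>
        unfolding \<rho>_def by (rule has_vector_derivative_smooth_compose[OF sm(1) inU dP(1)]) (use that in auto)
      show "(\<lambda>\<sigma>. \<phi> (P s \<sigma>)) integrable_on cbox 0 t" if "s \<in> S" for s
        using integrable_continuous_real[OF cont[OF smooth_on_continuous[OF sm(1)], of s t]] that t
        by (auto simp: S_def)
      show "continuous_on (S \<times> cbox 0 t) (\<lambda>(s, \<sigma>). \<rho> (P s \<sigma>))"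
        unfolding split_beta
        by (rule continuous_on_compose2[OF smooth_on_continuous[OF sm(3)]])
           (use inU in \<open>auto simp: P_def intro!: continuous_intros\<close>)
    qed
    have 2: "((\<lambda>s. f (P s t) - f (P s 0)) has_vector_derivative \<psi> (P 0 t) - \<psi> (P 0 0)) (at 0 within S)"
      unfolding \<psi>_def
      by (intro has_vector_derivative_diff has_vector_derivative_smooth_compose[OF f _ dP(1)])
         (use inU S t in auto)
    have 3: "((\<lambda>s. integral (cbox 0 t) (\<lambda>\<sigma>. \<phi> (P s \<sigma>))) has_vector_derivative \<psi> (P 0 t) - \<psi> (P 0 0)) (at 0 within S)"
      by (rule has_vector_derivative_transform[OF S(2) _ 2]) (use int in auto)
    have "at (0::real) within S \<noteq> bot"
      unfolding at_within_open[OF S(2,1)] by simp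
    from vector_derivative_unique_within[OF this 3 1] show ?thesis
      by simp
  qed
  have A: "((\<lambda>t. \<psi> (P 0 t)) has_vector_derivative frechet_derivative \<psi> (at (P 0 0)) w) (at 0 within {0..d})"
    by (rule has_vector_derivative_smooth_compose[OF sm(2) _ dP(2)]) (simp add: P0 U)
  have B: "((\<lambda>t. integral {0..t} (\<lambda>\<sigma>. \<rho> (P 0 \<sigma>))) has_vector_derivative \<rho> (P 0 0)) (at 0 within {0..d})"
    by (rule integral_has_vector_derivative[OF cont[OF smooth_on_continuous[OF sm(3)]]]) (use d in auto)
  have C: "((\<lambda>t. \<psi> (P 0 t)) has_vector_derivative 0 + \<rho> (P 0 0)) (at 0 within {0..d})"
  proof (rule has_vector_derivative_transform[OF _ _ has_vector_derivative_add[OF has_vector_derivative_const B]])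
    show "\<psi> (P 0 t) = \<psi> (P 0 0) + integral {0..t} (\<lambda>\<sigma>. \<rho> (P 0 \<sigma>))" if "t \<in> {0..d}" for t
      using step[OF that] by (simp add: diff_eq_eq add.commute)
  qed (use d in auto)
  \<comment> \<open>The integral starts at 0, so both derivatives are one-sided; on
    \<open>{0..d}\<close> they are still unique.\<close>
  have "frechet_derivative \<psi> (at (P 0 0)) w = 0 + \<rho> (P 0 0)"
    by (rule vector_derivative_unique_within_closed_interval[of 0 d 0]) (use A C d in auto)
  then show ?thesis
    by (simp add: \<rho>_def \<phi>_def \<psi>_def P0)
qed

section \<open>One-forms on the plane and their primitives\<close>

lemma linear_basis_expansion:
  fixes L :: "'a::euclidean_space \<Rightarrow> 'b::real_vector"
  assumes "linear L"
  shows "L v = (\<Sum>b\<in>Basis. (v \<bullet> b) *\<^sub>R L b)"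
  using linear_sum[OF assms, of "\<lambda>b. (v \<bullet> b) *\<^sub>R b" Basis]
  by (simp add: euclidean_representation linear_cmul[OF assms])

lemma linear_complex_expand:
  fixes L :: "complex \<Rightarrow> 'b::real_vector"
  assumes "linear L"
  shows "L v = Re v *\<^sub>R L 1 + Im v *\<^sub>R L \<i>"
  using linear_basis_expansion[OF assms, of v] by (simp add: Basis_complex_def)

lemma D_form_expand:
  fixes \<eta> :: "complex \<Rightarrow> complex \<Rightarrow> 'b::real_normed_vector"
  assumes U: "open U" "z \<in> U" and lin: "\<And>u. u \<in> U \<Longrightarrow> linear (\<eta> u)" and sm: "\<And>v. smooth_on U (\<lambda>u. \<eta> u v)"
  shows "D (\<lambda>u. \<eta> u x) z v = Re x *\<^sub>R D (\<lambda>u. \<eta> u 1) z v + Im x *\<^sub>R D (\<lambda>u. \<eta> u \<i>) z v"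
proof -
  have "((\<lambda>u. Re x *\<^sub>R \<eta> u 1 + Im x *\<^sub>R \<eta> u \<i>) has_derivative
      (\<lambda>v. Re x *\<^sub>R D (\<lambda>u. \<eta> u 1) z v + Im x *\<^sub>R D (\<lambda>u. \<eta> u \<i>) z v)) (at z)"
    by (intro has_derivative_add has_derivative_scaleR_right smooth_on_has_derivative[OF sm U(2)])
  then have "((\<lambda>u. \<eta> u x) has_derivative
      (\<lambda>v. Re x *\<^sub>R D (\<lambda>u. \<eta> u 1) z v + Im x *\<^sub>R D (\<lambda>u. \<eta> u \<i>) z v)) (at z)"
    by (rule has_derivative_transform_within_open[OF _ U]) (rule linear_complex_expand[OF lin, symmetric])
  then show ?thesis by (simp add: frechet_derivative_eqI)
qed

text \<open>The left side is alternating and bilinear in \<open>v\<close> and \<open>x\<close>,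
  hence a multiple of the area form \<open>Im (cnj v * x)\<close>. Closedness at a point thus
  reduces to one value, the one on \<open>(1, \<i>)\<close>.\<close>

lemma exterior_derivative_plane:
  fixes \<eta> :: "complex \<Rightarrow> complex \<Rightarrow> 'b::real_normed_vector"
  assumes U: "open U" "z \<in> U" and lin: "\<And>u. u \<in> U \<Longrightarrow> linear (\<eta> u)" and sm: "\<And>v. smooth_on U (\<lambda>u. \<eta> u v)"
  shows "D (\<lambda>u. \<eta> u x) z v - D (\<lambda>u. \<eta> u v) z x
    = Im (cnj v * x) *\<^sub>R (D (\<lambda>u. \<eta> u \<i>) z 1 - D (\<lambda>u. \<eta> u 1) z \<i>)"
proof -
  have D: "D (\<lambda>u. \<eta> u y) z w = Re y *\<^sub>R D (\<lambda>u. \<eta> u 1) z w + Im y *\<^sub>R D (\<lambda>u. \<eta> u \<i>) z w" for y w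
    by (rule D_form_expand[OF U lin sm])
  have D': "D (\<lambda>u. \<eta> u c) z y = Re y *\<^sub>R D (\<lambda>u. \<eta> u c) z 1 + Im y *\<^sub>R D (\<lambda>u. \<eta> u c) z \<i>" for c y
    by (rule linear_complex_expand[OF linear_frechet_derivative[OF smooth_on_differentiable[OF sm U(2)]]])
  show ?thesis
    unfolding D[of x v] D[of v x] D'[of 1 v] D'[of 1 x] D'[of \<i> v] D'[of \<i> x]
    by (simp add: algebra_simps)
qed

text \<open>The primitive is the integral of the form along the segment from a base point
  \<open>a\<close> to \<open>z\<close>. It is differentiated under the integral sign, and closedness
  turns the resulting integrand into a total derivative in the segment parameter.\<close>

lemma poincare_convex:
  fixes \<eta> :: "'a::euclidean_space \<Rightarrow> 'a \<Rightarrow> 'b::euclidean_space"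
  assumes S: "open S" "convex S"
    and lin: "\<And>z. z \<in> S \<Longrightarrow> linear (\<eta> z)" and sm: "\<And>v. smooth_on S (\<lambda>z. \<eta> z v)"
    and closed: "\<And>z v w. z \<in> S \<Longrightarrow> frechet_derivative (\<lambda>u. \<eta> u w) (at z) v
                                = frechet_derivative (\<lambda>u. \<eta> u v) (at z) w"
  obtains F where "\<And>z. z \<in> S \<Longrightarrow> (F has_derivative \<eta> z) (at z)"
proof (cases "S = {}")
  case True
  then show ?thesis using that by blast
next
  case False
  then obtain a where a: "a \<in> S" by blast
  define y where "y z t = a + t *\<^sub>R (z - a)" for z :: 'a and t :: real
  define E where "E z v c = frechet_derivative (\<lambda>u. \<eta> u v) (at z) c" for z v c
  \<comment> \<open>The derivative of the integrand in \<open>z\<close>, already rewritten by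
    closedness; equally, it is the derivative in \<open>t\<close> of
    \<open>t *\<^sub>R \<eta> (y z t) v\<close>, which is what gets integrated at the end.\<close>
  define f' where "f' z t v = \<eta> (y z t) v + t *\<^sub>R E (y z t) v (z - a)" for z t v
  have y: "y z t \<in> S" if "z \<in> S" "t \<in> {0..1}" for z t
  proof -
    have "y z t = (1 - t) *\<^sub>R a + t *\<^sub>R z"
      by (simp add: y_def algebra_simps)
    then show ?thesis
      using convexD_alt[OF S(2) a that(1)] that(2) by auto
  qed
  have contE: "continuous_on S (\<lambda>z. E z v c)" for v c
    unfolding E_def by (intro smooth_on_continuous smooth_on_frechet sm)
  have linE: "linear (E z v)" if "z \<in> S" for z v
    unfolding E_def by (intro linear_frechet_derivative smooth_on_differentiable[OF sm that])
  \<comment> \<open>Closedness exchanges the argument of the form with the direction of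
    differentiation, so linearity of the derivative yields linearity in the other slot.\<close>
  have Esum: "E z c v = (\<Sum>b\<in>Basis. (c \<bullet> b) *\<^sub>R E z b v)" if "z \<in> S" for z c v
  proof -
    have "E z c v = E z v c"
      unfolding E_def by (rule closed[OF that])
    also have "\<dots> = (\<Sum>b\<in>Basis. (c \<bullet> b) *\<^sub>R E z v b)"
      by (rule linear_basis_expansion[OF linE[OF that]])
    finally show ?thesis
      unfolding E_def using closed[OF that] by simp
  qed
  have der: "((\<lambda>z. \<eta> (y z t) (z - a)) has_derivative f' z t) (at z)"
    if z: "z \<in> S" and t: "t \<in> {0..1}" for z t
  proof -
    have yz: "((\<lambda>z. y z t) has_derivative (\<lambda>v. t *\<^sub>R v)) (at z)"
      unfolding y_def by (auto intro!: derivative_eq_intros)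
    have b: "((\<lambda>z. \<eta> (y z t) b) has_derivative (\<lambda>v. t *\<^sub>R E (y z t) b v)) (at z)" for b
      using has_derivative_compose[OF yz smooth_on_has_derivative[OF sm y[OF z t]]]
      by (simp add: E_def linear_cmul[OF linE[OF y[OF z t], unfolded E_def]])
    have "((\<lambda>z. \<Sum>b\<in>Basis. ((z - a) \<bullet> b) *\<^sub>R \<eta> (y z t) b) has_derivative
       (\<lambda>v. \<Sum>b\<in>Basis. ((z - a) \<bullet> b) *\<^sub>R (t *\<^sub>R E (y z t) b v) + (v \<bullet> b) *\<^sub>R \<eta> (y z t) b)) (at z)"
      by (intro has_derivative_sum has_derivative_scaleR b) (auto intro!: derivative_eq_intros)
    moreover have "(\<Sum>b\<in>Basis. ((z - a) \<bullet> b) *\<^sub>R (t *\<^sub>R E (y z t) b v) + (v \<bullet> b) *\<^sub>R \<eta> (y z t) b)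
        = f' z t v" for v
    proof -
      have "(\<Sum>b\<in>Basis. ((z - a) \<bullet> b) *\<^sub>R (t *\<^sub>R E (y z t) b v)) = t *\<^sub>R E (y z t) (z - a) v"
        by (simp add: Esum[OF y[OF z t], of "z - a" v] scaleR_sum_right mult.commute)
      moreover have "E (y z t) (z - a) v = E (y z t) v (z - a)"
        unfolding E_def by (rule closed[OF y[OF z t]])
      ultimately show ?thesis
        by (simp add: f'_def sum.distrib linear_basis_expansion[OF lin[OF y[OF z t]], of v])
    qed
    ultimately have *: "((\<lambda>z. \<Sum>b\<in>Basis. ((z - a) \<bullet> b) *\<^sub>R \<eta> (y z t) b) has_derivative f' z t) (at z)"
      by (simp only:)
    show ?thesis
      by (rule has_derivative_transform_within_open[OF * S(1) z])
         (simp add: linear_basis_expansion[OF lin[OF y[OF _ t]], symmetric])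
  qed
  have bl: "blinfun_apply (Blinfun (f' z t)) = f' z t" if "z \<in> S" "t \<in> {0..1}" for z t
    using der[OF that] has_derivative_bounded_linear bounded_linear_Blinfun_apply by blast
  \<comment> \<open>Differentiation under the integral needs joint continuity of the derivative as a
    bounded linear map; in finite dimension it suffices to test it on basis vectors.\<close>
  have cont: "continuous_on (S \<times> {0..1}) (\<lambda>(z, t). Blinfun (f' z t))"
  proof (rule continuous_on_blinfun_componentwise)
    fix i :: 'a
    have cy: "continuous_on (S \<times> {0..1}) (\<lambda>p. y (fst p) (snd p))"
      unfolding y_def by (intro continuous_intros)
    have im: "(\<lambda>p. y (fst p) (snd p)) ` (S \<times> {0..1}) \<subseteq> S"
      using y by auto
    have "continuous_on (S \<times> {0..1}) (\<lambda>p. \<eta> (y (fst p) (snd p)) i + snd p *\<^sub>R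
        (\<Sum>b\<in>Basis. ((fst p - a) \<bullet> b) *\<^sub>R E (y (fst p) (snd p)) b i))"
      by (intro continuous_intros continuous_on_compose2[OF smooth_on_continuous[OF sm] cy im]
            continuous_on_compose2[OF contE cy im])
    moreover have "\<eta> (y (fst p) (snd p)) i + snd p *\<^sub>R
        (\<Sum>b\<in>Basis. ((fst p - a) \<bullet> b) *\<^sub>R E (y (fst p) (snd p)) b i)
      = blinfun_apply (case p of (z, t) \<Rightarrow> Blinfun (f' z t)) i" if pin: "p \<in> S \<times> {0..1}" for p
    proof -
      obtain z t where p: "p = (z, t)" "z \<in> S" "t \<in> {0..1}"
        using pin by auto
      have "E (y z t) (z - a) i = E (y z t) i (z - a)"
        unfolding E_def by (rule closed[OF y[OF p(2,3)]])
      then show ?thesis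
        using p by (simp add: bl f'_def Esum[OF y[OF p(2,3)], symmetric])
    qed
    ultimately show "continuous_on (S \<times> {0..1})
        (\<lambda>p. blinfun_apply (case p of (z, t) \<Rightarrow> Blinfun (f' z t)) i)"
      by (simp cong: continuous_on_cong)
  qed
  define F where "F z = integral (cbox 0 1) (\<lambda>t. \<eta> (y z t) (z - a))" for z
  have "(F has_derivative \<eta> z) (at z)" if z: "z \<in> S" for z
  proof -
    have lr: "((\<lambda>z. integral (cbox 0 1) (\<lambda>t. \<eta> (y z t) (z - a))) has_derivative
        integral (cbox 0 1) (\<lambda>t. Blinfun (f' z t))) (at z within S)"
    proof (rule leibniz_rule[OF _ _ _ z S(2)])
      fix z :: 'a and t :: real assume zt: "z \<in> S" "t \<in> cbox 0 1"
      then show "((\<lambda>z. \<eta> (y z t) (z - a)) has_derivative blinfun_apply (Blinfun (f' z t))) (at z within S)"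
        using der[of z t] bl[of z t] by (simp add: at_within_open[OF _ S(1)])
    next
      fix z :: 'a assume z: "z \<in> S"
      have cy: "continuous_on {0..1} (y z)" and im: "y z ` {0..1} \<subseteq> S"
        unfolding y_def[abs_def] using y[OF z] by (auto intro!: continuous_intros simp: y_def)
      have "continuous_on {0..1} (\<lambda>t. \<Sum>b\<in>Basis. ((z - a) \<bullet> b) *\<^sub>R \<eta> (y z t) b)"
        by (intro continuous_intros continuous_on_compose2[OF smooth_on_continuous[OF sm] cy im])
      moreover have "(\<Sum>b\<in>Basis. ((z - a) \<bullet> b) *\<^sub>R \<eta> (y z t) b) = \<eta> (y z t) (z - a)" if "t \<in> {0..1}" for t
        by (rule linear_basis_expansion[OF lin[OF y[OF z that]], symmetric])
      ultimately have "continuous_on {0..1} (\<lambda>t. \<eta> (y z t) (z - a))"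
        by (rule continuous_on_eq)
      then show "(\<lambda>t. \<eta> (y z t) (z - a)) integrable_on cbox 0 1"
        by (simp add: integrable_continuous_real)
    qed (use cont in simp)
    have "blinfun_apply (integral (cbox 0 1) (\<lambda>t. Blinfun (f' z t))) v = \<eta> z v" for v
    proof -
      have "continuous_on {0..1} (\<lambda>t. case (z, t) of (z, t) \<Rightarrow> Blinfun (f' z t))"
        by (rule continuous_on_compose2[OF cont, of "{0..1}" "\<lambda>t. (z, t)"])
           (use z in \<open>auto intro!: continuous_intros\<close>)
      then have "(\<lambda>t. Blinfun (f' z t)) integrable_on cbox 0 1"
        by (simp add: integrable_continuous_real)
      from integral_linear[OF this blinfun.bounded_linear_left[of v]]
      have "blinfun_apply (integral (cbox 0 1) (\<lambda>t. Blinfun (f' z t))) v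
          = integral {0..1} (\<lambda>t. blinfun_apply (Blinfun (f' z t)) v)"
        by (simp add: o_def)
      also have "\<dots> = integral {0..1} (\<lambda>t. f' z t v)"
        by (rule integral_cong) (simp add: bl[OF z])
      also have "((\<lambda>t. f' z t v) has_integral 1 *\<^sub>R \<eta> (y z 1) v - 0 *\<^sub>R \<eta> (y z 0) v) {0..1}"
      proof (rule fundamental_theorem_of_calculus)
        fix t :: real assume t: "t \<in> {0..1}"
        have "((\<lambda>t. y z t) has_derivative (\<lambda>h. h *\<^sub>R (z - a))) (at t within {0..1})"
          unfolding y_def by (auto intro!: derivative_eq_intros)
        from has_derivative_compose[OF this smooth_on_has_derivative[OF sm y[OF z t], of v]]
        have "((\<lambda>t. \<eta> (y z t) v) has_vector_derivative E (y z t) v (z - a)) (at t within {0..1})"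
          by (simp add: has_vector_derivative_def E_def linear_cmul[OF linE[OF y[OF z t], unfolded E_def]])
        then show "((\<lambda>t. t *\<^sub>R \<eta> (y z t) v) has_vector_derivative f' z t v) (at t within {0..1})"
          unfolding f'_def by (auto intro!: derivative_eq_intros)
      qed simp
      then have "integral {0..1} (\<lambda>t. f' z t v) = \<eta> z v"
        by (simp add: integral_unique y_def)
      finally show ?thesis .
    qed
    then have "blinfun_apply (integral (cbox 0 1) (\<lambda>t. Blinfun (f' z t))) = \<eta> z"
      by (rule ext)
    with lr show ?thesis
      unfolding F_def[abs_def] at_within_open[OF z S(1)] by metis
  qed
  then show ?thesis using that by blast
qed

text \<open>By the Riemann mapping theorem the domain is empty, the whole plane or biholomorphic to
  the disc. In the last case the form is pulled back to the convex disc by \<open>g\<close>, and its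
  primitive there is composed with the inverse map \<open>f\<close>.\<close>

lemma poincare_simply_connected:
  fixes \<eta> :: "complex \<Rightarrow> complex \<Rightarrow> 'b::euclidean_space"
  assumes S: "open S" "simply_connected S"
    and lin: "\<And>z. z \<in> S \<Longrightarrow> linear (\<eta> z)" and sm: "\<And>v. smooth_on S (\<lambda>z. \<eta> z v)"
    and closed: "\<And>z v w. z \<in> S \<Longrightarrow> D (\<lambda>u. \<eta> u w) z v = D (\<lambda>u. \<eta> u v) z w"
  obtains F where "\<And>z. z \<in> S \<Longrightarrow> (F has_derivative \<eta> z) (at z)"
proof -
  consider "S = {}" | "S = UNIV" | f g where "f holomorphic_on S" "g holomorphic_on ball 0 1"
      "\<forall>z\<in>S. f z \<in> ball 0 1 \<and> g (f z) = z" "\<forall>z\<in>ball 0 1. g z \<in> S \<and> f (g z) = z"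
    using S simply_connected_eq_biholomorphic_to_disc by metis
  then show ?thesis
  proof cases
    case 1
    then show ?thesis using that by blast
  next
    case 2
    then have "convex S" by simp
    then show ?thesis
      using poincare_convex[OF S(1) _ lin sm closed] that by blast
  next
    case 3
    define \<eta>' where "\<eta>' z v = \<eta> (g z) (deriv g z * v)" for z v
    have expand: "\<eta> z c = Re c *\<^sub>R \<eta> z 1 + Im c *\<^sub>R \<eta> z \<i>" if "z \<in> S" for z c
      by (rule linear_complex_expand[OF lin[OF that]])
    have Dexpand: "D (\<lambda>u. \<eta> u c) z v = Re c *\<^sub>R D (\<lambda>u. \<eta> u 1) z v + Im c *\<^sub>R D (\<lambda>u. \<eta> u \<i>) z v"
      if "z \<in> S" for z c v
      by (rule D_form_expand[OF S(1) that lin sm])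
    have gS: "g ` ball 0 1 \<subseteq> S" and g: "smooth_on (ball 0 1) g" "smooth_on (ball 0 1) (deriv g)"
      using 3 by (auto intro!: holomorphic_imp_smooth_on holomorphic_deriv)
    have sm': "smooth_on (ball 0 1) (\<lambda>z. \<eta>' z v)" for v
    proof (rule smooth_on_cong)
      show "smooth_on (ball 0 1) (\<lambda>z. Re (deriv g z * v) *\<^sub>R \<eta> (g z) 1 + Im (deriv g z * v) *\<^sub>R \<eta> (g z) \<i>)"
        using g by (intro smooth_on_add smooth_on_scaleR smooth_on_Re smooth_on_Im smooth_on_mult
            smooth_on_const open_ball smooth_on_compose[OF open_ball S(1) gS g(1) sm])
      show "Re (deriv g z * v) *\<^sub>R \<eta> (g z) 1 + Im (deriv g z * v) *\<^sub>R \<eta> (g z) \<i> = \<eta>' z v"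
        if "z \<in> ball 0 1" for z
        unfolding \<eta>'_def by (rule expand[symmetric]) (use gS that in blast)
    qed simp
    have lin': "linear (\<eta>' z)" if "z \<in> ball 0 1" for z
    proof -
      have "g z \<in> S" using gS that by blast
      from linear_compose[OF _ lin[OF this], of "\<lambda>v. deriv g z * v"] show ?thesis
        by (simp add: \<eta>'_def[abs_def] o_def linear_times)
    qed
    \<comment> \<open>The second derivative of \<open>g\<close> enters only through the product
      \<open>v * w\<close>, which is symmetric; this is why the pullback stays closed.\<close>
    have D': "D (\<lambda>u. \<eta>' u w) z v = \<eta> (g z) (deriv (deriv g) z * v * w)
        + D (\<lambda>u. \<eta> u (deriv g z * w)) (g z) (deriv g z * v)"
      if z: "z \<in> ball 0 1" for z v w
    proof -
      have gz: "g z \<in> S" using gS z by blast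
      have d1: "(g has_derivative (\<lambda>v. deriv g z * v)) (at z)"
        using holomorphic_derivI[OF 3(2) open_ball z] by (simp add: has_field_derivative_def)
      have d2: "(deriv g has_derivative (\<lambda>v. deriv (deriv g) z * v)) (at z)"
        using holomorphic_derivI[OF holomorphic_deriv[OF 3(2) open_ball] open_ball z]
        by (simp add: has_field_derivative_def)
      have e: "((\<lambda>u. \<eta> (g u) c) has_derivative (\<lambda>v. D (\<lambda>u. \<eta> u c) (g z) (deriv g z * v))) (at z)" for c
        by (rule has_derivative_compose[OF d1 smooth_on_has_derivative[OF sm gz]])
      have "((\<lambda>u. Re (deriv g u * w) *\<^sub>R \<eta> (g u) 1 + Im (deriv g u * w) *\<^sub>R \<eta> (g u) \<i>) has_derivative
          (\<lambda>v. (Re (deriv g z * w) *\<^sub>R D (\<lambda>u. \<eta> u 1) (g z) (deriv g z * v)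
               + Re (deriv (deriv g) z * v * w) *\<^sub>R \<eta> (g z) 1)
             + (Im (deriv g z * w) *\<^sub>R D (\<lambda>u. \<eta> u \<i>) (g z) (deriv g z * v)
               + Im (deriv (deriv g) z * v * w) *\<^sub>R \<eta> (g z) \<i>))) (at z)"
        by (intro has_derivative_add has_derivative_scaleR e has_derivative_Re has_derivative_Im
              has_derivative_mult_left d2)
      then have "((\<lambda>u. \<eta>' u w) has_derivative
          (\<lambda>v. (Re (deriv g z * w) *\<^sub>R D (\<lambda>u. \<eta> u 1) (g z) (deriv g z * v)
               + Re (deriv (deriv g) z * v * w) *\<^sub>R \<eta> (g z) 1)
             + (Im (deriv g z * w) *\<^sub>R D (\<lambda>u. \<eta> u \<i>) (g z) (deriv g z * v)
               + Im (deriv (deriv g) z * v * w) *\<^sub>R \<eta> (g z) \<i>))) (at z)"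
        by (rule has_derivative_transform_within_open[OF _ open_ball z])
           (simp only: \<eta>'_def, rule expand[symmetric], use gS in blast)
      then show ?thesis
        unfolding Dexpand[OF gz, of "deriv g z * w"] expand[OF gz, of "deriv (deriv g) z * v * w"]
        by (simp only: frechet_derivative_eqI add_ac)
    qed
    have closed': "D (\<lambda>u. \<eta>' u w) z v = D (\<lambda>u. \<eta>' u v) z w" if "z \<in> ball 0 1" for z v w
    proof -
      have "g z \<in> S" using gS that by blast
      then show ?thesis
        by (simp only: D'[OF that] closed[of "g z" "deriv g z * w"] mult.assoc mult.commute[of v w])
    qed
    obtain G where G: "\<And>z. z \<in> ball 0 1 \<Longrightarrow> (G has_derivative \<eta>' z) (at z)"
      using poincare_convex[OF open_ball convex_ball lin' sm' closed'] by blast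
    have "((\<lambda>z. G (f z)) has_derivative \<eta> z) (at z)" if z: "z \<in> S" for z
    proof -
      have fz: "f z \<in> ball 0 1" "g (f z) = z" using 3 z by auto
      have df: "(f has_field_derivative deriv f z) (at z)"
        by (rule holomorphic_derivI[OF 3(1) S(1) z])
      have dg: "(g has_field_derivative deriv g (f z)) (at (f z))"
        by (rule holomorphic_derivI[OF 3(2) open_ball fz(1)])
      have "((\<lambda>z. g (f z)) has_field_derivative deriv g (f z) * deriv f z) (at z)"
        using DERIV_chain2[OF dg df] .
      then have "((\<lambda>z. z) has_field_derivative deriv g (f z) * deriv f z) (at z)"
        by (rule has_field_derivative_transform_within_open[OF _ S(1) z]) (use 3 in auto)
      then have 1: "deriv g (f z) * deriv f z = 1"
        using DERIV_ident DERIV_unique by blast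
      have "((\<lambda>z. G (f z)) has_derivative (\<lambda>v. \<eta>' (f z) (deriv f z * v))) (at z)"
        using has_derivative_compose[of f "\<lambda>v. deriv f z * v" z UNIV G "\<eta>' (f z)"] G[OF fz(1)] df
        by (simp add: has_field_derivative_def)
      moreover have "\<eta>' (f z) (deriv f z * v) = \<eta> z v" for v
        using 1 fz by (simp add: \<eta>'_def mult.assoc[symmetric])
      ultimately show ?thesis by simp
    qed
    then show ?thesis by (rule that)
  qed
qed

text \<open>Cramer's rule, with \<open>Im (cnj (L 1) * L \<i>)\<close> as determinant. The explicit
  inverse shows that it depends smoothly on \<open>L 1\<close> and \<open>L \<i>\<close>.\<close>

lemma linear_complex_inverse:
  fixes L :: "complex \<Rightarrow> complex"
  assumes "linear L" "bij L"
  shows "Im (cnj (L 1) * L \<i>) \<noteq> 0"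
    and "inv L v = Complex (Im (cnj v * L \<i>) / Im (cnj (L 1) * L \<i>)) (Im (cnj (L 1) * v) / Im (cnj (L 1) * L \<i>))"
proof -
  have L: "L c = Re c *\<^sub>R L 1 + Im c *\<^sub>R L \<i>" for c
    by (rule linear_complex_expand[OF assms(1)])
  obtain a b where a: "L a = 1" and b: "L b = \<i>"
    using assms(2) by (metis bij_pointE)
  have "(Re a * Im b - Im a * Re b) * Im (cnj (L 1) * L \<i>) = Im (cnj (L a) * L b)"
    by (simp add: L[of a] L[of b] algebra_simps)
  then show d: "Im (cnj (L 1) * L \<i>) \<noteq> 0"
    using a b by auto
  have "Im (cnj v * L \<i>) *\<^sub>R L 1 + Im (cnj (L 1) * v) *\<^sub>R L \<i> = Im (cnj (L 1) * L \<i>) *\<^sub>R v"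
    by (simp add: complex_eq_iff algebra_simps)
  then have "(1 / Im (cnj (L 1) * L \<i>)) *\<^sub>R
      (Im (cnj v * L \<i>) *\<^sub>R L 1 + Im (cnj (L 1) * v) *\<^sub>R L \<i>) = v"
    using d by (simp only: scaleR_scaleR) simp
  then have "L (Complex (Im (cnj v * L \<i>) / Im (cnj (L 1) * L \<i>)) (Im (cnj (L 1) * v) / Im (cnj (L 1) * L \<i>))) = v"
    by (simp add: L[of "Complex _ _"] scaleR_add_right)
  then show "inv L v = Complex (Im (cnj v * L \<i>) / Im (cnj (L 1) * L \<i>)) (Im (cnj (L 1) * v) / Im (cnj (L 1) * L \<i>))"
    using assms(2) by (metis bij_inv_eq_iff)
qed

text \<open>The derivative of the inverse \<open>h\<close> is \<open>inv (D \<zeta> (h y))\<close>,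
  a smooth function of \<open>h y\<close>, so the regularity of \<open>h\<close> bootstraps. The
  image is cut down to a ball because it serves later as a simply connected coordinate
  domain.\<close>

lemma smooth_local_inverse:
  fixes \<zeta> :: "complex \<Rightarrow> complex"
  assumes U: "open U" "x \<in> U" and sm: "smooth_on U \<zeta>" and inj: "inj (D \<zeta> x)"
  obtains N h r where "open N" "x \<in> N" "N \<subseteq> U" "r > 0" "homeomorphism N (ball (\<zeta> x) r) \<zeta> h"
    "smooth_on (ball (\<zeta> x) r) h"
    "\<And>y. y \<in> ball (\<zeta> x) r \<Longrightarrow> (h has_derivative inv (D \<zeta> (h y))) (at y)"
    "\<And>y. y \<in> N \<Longrightarrow> bij (D \<zeta> y)"
proof -
  define B where "B y = Blinfun (D \<zeta> y)" for y
  have lin: "linear (D \<zeta> y)" if "y \<in> U" for y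
    using smooth_on_has_derivative[OF sm that] by (rule has_derivative_linear)
  have B: "blinfun_apply (B y) = D \<zeta> y" if "y \<in> U" for y
    unfolding B_def using smooth_on_has_derivative[OF sm that]
    by (simp add: bounded_linear_Blinfun_apply has_derivative_bounded_linear)
  have contB: "continuous_on U B"
  proof (rule continuous_on_blinfun_componentwise)
    fix i :: complex
    have "continuous_on U (\<lambda>y. D \<zeta> y i)"
      by (intro smooth_on_continuous smooth_on_frechet sm)
    then show "continuous_on U (\<lambda>y. blinfun_apply (B y) i)"
      by (simp add: B cong: continuous_on_cong)
  qed
  obtain L where L: "linear L" "L \<circ> D \<zeta> x = id"
    using linear_injective_left_inverse[OF lin[OF U(2)] inj] by blast
  have "blinfun_apply (Blinfun L) = L"
    using L(1) by (simp add: bounded_linear_Blinfun_apply linear_conv_bounded_linear)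
  then have "Blinfun L o\<^sub>L B x = id_blinfun"
    using L(2) B[OF U(2)] by (intro blinfun_eqI) (simp add: o_def fun_eq_iff)
  then obtain U' V h h' where U': "open U'" "U' \<subseteq> U" "x \<in> U'" and V: "open V" "\<zeta> x \<in> V"
    and hom: "homeomorphism U' V \<zeta> h"
    and h: "\<And>y. y \<in> V \<Longrightarrow> (h has_derivative (h' y)) (at y)"
      "\<And>y. y \<in> V \<Longrightarrow> h' y = inv (blinfun_apply (B (h y)))"
      "\<And>y. y \<in> V \<Longrightarrow> bij (blinfun_apply (B (h y)))"
    using inverse_function_theorem[OF U(1) _ contB U(2), of \<zeta> "Blinfun L"]
    by (metis B smooth_on_has_derivative[OF sm])
  obtain r where r: "r > 0" "ball (\<zeta> x) r \<subseteq> V"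
    using V open_contains_ball by blast
  define N where "N = h ` ball (\<zeta> x) r"
  have hU: "h y \<in> U'" "\<zeta> (h y) = y" if "y \<in> V" for y
    using hom that by (auto simp: homeomorphism_def)
  have N: "N = U' \<inter> \<zeta> -` ball (\<zeta> x) r"
    unfolding N_def using hU r hom by (force simp: homeomorphism_def)
  have oN: "open N"
    unfolding N using U'(1) hom continuous_open_preimage[of U' \<zeta>] by (simp add: homeomorphism_def)
  have NU: "N \<subseteq> U"
    using N U'(2) by blast
  have homN: "homeomorphism N (ball (\<zeta> x) r) \<zeta> h"
    by (rule homeomorphism_of_subsets[OF hom]) (use r hU N_def N in \<open>auto intro!: image_eqI\<close>)
  have bij: "bij (D \<zeta> y)" if yN: "y \<in> N" for y
  proof -
    obtain w where "w \<in> ball (\<zeta> x) r" "y = h w" using yN N_def by blast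
    then show ?thesis using h(3) B NU r(2) yN by (metis subsetD)
  qed
  have hd: "(h has_derivative inv (D \<zeta> (h y))) (at y)" if "y \<in> ball (\<zeta> x) r" for y
    using that h(1,2)[of y] r hU[of y] U'(2) B[of "h y"] by (auto simp: subset_iff)
  have "smooth_on (ball (\<zeta> x) r) h"
  proof (rule smooth_onI_bootstrap[OF open_ball hd])
    fix k v assume k: "Ck_on k (ball (\<zeta> x) r) h"
    have smN: "smooth_on N (\<lambda>y. D \<zeta> y c)" for c
      using smooth_on_subset[OF smooth_on_frechet[OF sm] NU] .
    have "smooth_on N (\<lambda>y. of_real (Im (cnj v * D \<zeta> y \<i>) / Im (cnj (D \<zeta> y 1) * D \<zeta> y \<i>))
        + \<i> * of_real (Im (cnj (D \<zeta> y 1) * v) / Im (cnj (D \<zeta> y 1) * D \<zeta> y \<i>)))"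
      using linear_complex_inverse(1)[OF lin bij] NU
      by (intro smooth_on_add smooth_on_mult smooth_on_const smooth_on_of_real smooth_on_divide_real
            smooth_on_Im smooth_on_cnj smN oN) auto
    then have "smooth_on N (\<lambda>y. inv (D \<zeta> y) v)"
      by (rule smooth_on_cong[OF oN, rotated])
         (use NU in \<open>auto simp: linear_complex_inverse(2)[OF lin bij] Complex_eq\<close>)
    then have "Ck_on k N (\<lambda>y. inv (D \<zeta> y) v)"
      by (simp add: smooth_on_def)
    from Ck_on_compose[OF open_ball oN _ k this]
    show "Ck_on k (ball (\<zeta> x) r) (\<lambda>y. inv (D \<zeta> (h y)) v)"
      by (simp add: N_def)
  qed
  moreover have "x \<in> N"
    using N U'(3) r by simp
  ultimately show ?thesis
    using that oN NU r(1) homN hd bij by blast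
qed

section \<open>The action of the spin group on Minkowski space\<close>

lemma scaleR_cquat: "c *\<^sub>R (q :: cquat) = of_real c *s q"
  by (simp add: vec_eq_iff scaleR_conv_of_real[where 'a=complex])

lemma bounded_bilinear_qmult: "bounded_bilinear (\<odot>)"
  by (simp add: bilinear_conv_bounded_bilinear[symmetric] bilinear_def linear_iff
        scaleR_cquat qmult_bilinear)

lemma bounded_bilinear_smult: "bounded_bilinear (\<lambda>(c :: complex) (q :: cquat). c *s q)"
  by (auto simp: bilinear_conv_bounded_bilinear[symmetric] bilinear_def linear_iff vec_eq_iff
        scaleR_conv_of_real[where 'a=complex] algebra_simps)

lemma bounded_linear_qhat: "bounded_linear qhat"
  by (simp add: linear_conv_bounded_linear[symmetric] linear_iff vec_eq_iff qhat_def)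

lemma bounded_linear_qconj: "bounded_linear qconj"
  by (simp add: linear_conv_bounded_linear[symmetric] linear_iff vec_eq_iff forall_4 qconj_def vector_4_nth)

lemma bounded_bilinear_qH: "bounded_bilinear qH"
  by (auto simp: bilinear_conv_bounded_bilinear[symmetric] bilinear_def linear_iff qH_def sum_4
        scaleR_conv_of_real[where 'a=complex] algebra_simps)

lemma bounded_bilinear_mink: "bounded_bilinear mink"
  by (auto simp: bilinear_conv_bounded_bilinear[symmetric] bilinear_def linear_iff mink_def qH_def sum_4
        algebra_simps)

lemma qH_commute: "qH p q = qH q p"
  by (simp add: qH_def mult.commute)

lemma qH_qmult_left: "qH (p \<odot> q) (p \<odot> q') = qH p p * qH q q'"
  unfolding qH_def sum_4 qmult_nth by algebra

lemma qH_qmult_right: "qH (p \<odot> q) (p' \<odot> q) = qH p p' * qH q q"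
  unfolding qH_def sum_4 qmult_nth by algebra

lemma qH_qhat: "qH (qhat p) (qhat q) = cnj (qH p q)"
  by (simp add: qH_def sum_4 qhat_def)

lemma qH_qconj: "qH (qconj p) (qconj q) = qH p q"
  by (simp add: qH_def sum_4 qconj_def vector_4_nth)

lemma qconj_qmult: "qconj (p \<odot> q) = qconj q \<odot> qconj p"
  by (simp add: vec_eq_iff forall_4 cquat_nth algebra_simps)

lemma qconj_pure: "(p :: cquat) $ 1 = 0 \<Longrightarrow> qconj p = - p"
  by (simp add: vec_eq_iff forall_4 cquat_nth)

lemma qconj_qconj: "qconj (qconj q) = q"
  by (simp add: vec_eq_iff forall_4 cquat_nth)

lemma qhat_qconj: "qhat (qconj q) = qconj (qhat q)"
  by (simp add: vec_eq_iff forall_4 cquat_nth)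

lemma qhat_qhat: "qhat (qhat q) = q"
  by (simp add: vec_eq_iff qhat_def)

lemma qhat_qone: "qhat qone = qone"
  by (simp add: vec_eq_iff forall_4 cquat_nth)

lemma qinv_Spin31: "q \<in> Spin31 \<Longrightarrow> qinv q = qconj q"
  by (simp add: qinv_def Spin31_def)

lemma Spin31_qconj: "q \<in> Spin31 \<Longrightarrow> q \<odot> qconj q = qone" "q \<in> Spin31 \<Longrightarrow> qconj q \<odot> q = qone"
  by (simp_all add: qmult_qconj Spin31_def)

lemma Spin31_qmult: "p \<in> Spin31 \<Longrightarrow> q \<in> Spin31 \<Longrightarrow> p \<odot> q \<in> Spin31"
  by (simp add: Spin31_def qH_qmult_left)

definition r31 :: "real \<Rightarrow> real \<Rightarrow> real \<Rightarrow> real \<Rightarrow> cquat" where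
  "r31 x1 x2 x3 x4 = vector [\<i> * of_real x1, of_real x2, of_real x3, of_real x4]"

lemma r31_nth:
  "r31 a b c d $ 1 = \<i> * of_real a" "r31 a b c d $ 2 = of_real b"
  "r31 a b c d $ 3 = of_real c" "r31 a b c d $ 4 = of_real d"
  by (simp_all add: r31_def vector_4_nth)

lemma r31_in_R31: "r31 a b c d \<in> R31"
  by (auto simp: R31_def r31_def)

lemma R31_cases:
  assumes "x \<in> R31" obtains a b c d where "x = r31 a b c d"
  using assms that by (auto simp: R31_def r31_def)

lemma mem_R31_iff: "x \<in> R31 \<longleftrightarrow> Re (x $ 1) = 0 \<and> Im (x $ 2) = 0 \<and> Im (x $ 3) = 0 \<and> Im (x $ 4) = 0"
proof
  show "x \<in> R31 \<Longrightarrow> Re (x $ 1) = 0 \<and> Im (x $ 2) = 0 \<and> Im (x $ 3) = 0 \<and> Im (x $ 4) = 0"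
    by (auto elim!: R31_cases simp: r31_nth)
  assume "Re (x $ 1) = 0 \<and> Im (x $ 2) = 0 \<and> Im (x $ 3) = 0 \<and> Im (x $ 4) = 0"
  then have "x = r31 (Im (x $ 1)) (Re (x $ 2)) (Re (x $ 3)) (Re (x $ 4))"
    by (simp add: vec_eq_iff forall_4 r31_nth complex_eq_iff)
  then show "x \<in> R31"
    using r31_in_R31 by metis
qed

text \<open>Characterises Minkowski space by one equation between an automorphism and an
  anti-automorphism of the algebra. Its invariance under \<open>lorentz\<close> then follows by
  manipulating products.\<close>

lemma mem_R31_iff_qhat: "x \<in> R31 \<longleftrightarrow> qhat x = - qconj x"
  by (auto simp: mem_R31_iff vec_eq_iff forall_4 cquat_nth complex_eq_iff)

lemma r31_add: "r31 a b c d + r31 a' b' c' d' = r31 (a + a') (b + b') (c + c') (d + d')"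
  by (simp add: vec_eq_iff forall_4 r31_nth algebra_simps)

lemma r31_diff: "r31 a b c d - r31 a' b' c' d' = r31 (a - a') (b - b') (c - c') (d - d')"
  by (simp add: vec_eq_iff forall_4 r31_nth algebra_simps)

lemma r31_scaleR: "t *\<^sub>R r31 a b c d = r31 (t * a) (t * b) (t * c) (t * d)"
  by (simp add: vec_eq_iff forall_4 r31_nth scaleR_conv_of_real[where 'a=complex] algebra_simps)

lemma r31_inject: "r31 a b c d = r31 a' b' c' d' \<longleftrightarrow> a = a' \<and> b = b' \<and> c = c' \<and> d = d'"
  by (auto simp: vec_eq_iff forall_4 r31_nth)

lemma qH_r31: "qH (r31 a b c d) (r31 a' b' c' d') = of_real (- a * a' + b * b' + c * c' + d * d')"
  unfolding r31_def by (rule mink_R31)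

lemma has_derivative_r31:
  assumes "(a has_derivative a') F" "(b has_derivative b') F" "(c has_derivative c') F" "(d has_derivative d') F"
  shows "((\<lambda>u. r31 (a u) (b u) (c u) (d u)) has_derivative (\<lambda>v. r31 (a' v) (b' v) (c' v) (d' v))) F"
proof -
  have eq: "r31 a b c d = a *\<^sub>R r31 1 0 0 0 + b *\<^sub>R r31 0 1 0 0 + c *\<^sub>R r31 0 0 1 0 + d *\<^sub>R r31 0 0 0 1" for a b c d
    by (simp add: r31_scaleR r31_add)
  show ?thesis
    unfolding eq[of "a _"] eq[of "a' _"]
    by (intro has_derivative_add has_derivative_scaleR_left assms)
qed

text \<open>The conjugate stands for the inverse: both agree on \<open>Spin31\<close>, but the
  conjugate is real linear, hence easy to differentiate, and makes sense for elements not yet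
  normalised. With the inverse on the left, as in \<open>xi\<close>, this is a right action.\<close>

definition lorentz :: "cquat \<Rightarrow> cquat \<Rightarrow> cquat" where
  "lorentz q x = qconj q \<odot> x \<odot> qhat q"

lemma lorentz_linear:
  "lorentz q (x + y) = lorentz q x + lorentz q y" "lorentz q (x - y) = lorentz q x - lorentz q y"
  "lorentz q (c *s x) = c *s lorentz q x" "lorentz q (t *\<^sub>R x) = t *\<^sub>R lorentz q x"
  "lorentz q (- x) = - lorentz q x" "lorentz q 0 = 0"
proof -
  show *: "lorentz q (x + y) = lorentz q x + lorentz q y" for x y
    by (simp add: lorentz_def qmult_bilinear)
  show **: "lorentz q (c *s x) = c *s lorentz q x" for c x
    by (simp add: lorentz_def qmult_bilinear)
  show "lorentz q (t *\<^sub>R x) = t *\<^sub>R lorentz q x" for t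
    by (simp add: scaleR_cquat **)
  show m: "lorentz q (- x) = - lorentz q x" for x
    using **[of "-1" x] by simp
  show "lorentz q (x - y) = lorentz q x - lorentz q y"
    using *[of x "- y"] m[of y] by simp
  show "lorentz q 0 = 0"
    using **[of 0 0] by simp
qed

lemma lorentz_lorentz: "lorentz q (lorentz p x) = lorentz (p \<odot> q) x"
  by (simp add: lorentz_def qconj_qmult qhat_qmult qmult_assoc)

lemma lorentz_qone: "lorentz qone x = x"
proof -
  have "qconj qone = qone" by (simp add: vec_eq_iff forall_4 cquat_nth)
  then show ?thesis by (simp add: lorentz_def qhat_qone quaternion_relations)
qed

lemma lorentz_inverse:
  assumes "q \<in> Spin31"
  shows "lorentz q (lorentz (qconj q) x) = x" "lorentz (qconj q) (lorentz q x) = x"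
  using Spin31_qconj[OF assms] by (simp_all add: lorentz_lorentz lorentz_qone)

lemma lorentz_eq_iff: "q \<in> Spin31 \<Longrightarrow> lorentz q x = lorentz q y \<longleftrightarrow> x = y"
  by (metis lorentz_inverse(2))

lemma qH_lorentz: "q \<in> Spin31 \<Longrightarrow> qH (lorentz q x) (lorentz q y) = qH x y"
  by (simp add: lorentz_def qH_qmult_right qH_qmult_left qH_qhat qH_qconj Spin31_def)

lemma lorentz_in_R31: "x \<in> R31 \<Longrightarrow> lorentz q x \<in> R31"
proof -
  assume "x \<in> R31"
  then have x: "qhat x = - qconj x"
    by (simp add: mem_R31_iff_qhat)
  have neg: "- p = (-1) *s p" for p :: cquat
    by simp
  have "qhat (lorentz q x) = qconj (qhat q) \<odot> (- qconj x) \<odot> q"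
    by (simp add: lorentz_def qhat_qmult qhat_qconj qhat_qhat x)
  also have "\<dots> = - (qconj (qhat q) \<odot> qconj x \<odot> q)"
    unfolding neg[of "qconj x"] qmult_bilinear by simp
  also have "qconj (qhat q) \<odot> qconj x \<odot> q = qconj (lorentz q x)"
    by (simp add: lorentz_def qconj_qmult qconj_qconj qmult_assoc)
  finally show ?thesis
    by (simp add: mem_R31_iff_qhat)
qed

lemma mink_lorentz: 
  "q \<in> Spin31 \<Longrightarrow> mink (lorentz q (r31 a b c d)) (lorentz q (r31 a' b' c' d'))
     = - a * a' + b * b' + c * c' + d * d'"
  by (simp add: mink_def qH_lorentz qH_r31)

lemma lorentz_r31_cases:
  assumes "q \<in> Spin31" "x \<in> R31"
  obtains a b c d where "x = lorentz q (r31 a b c d)"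
  using assms lorentz_inverse(1) lorentz_in_R31 by (metis R31_cases)

text \<open>The differential of the action in the direction of a pure \<open>\<eta>\<close>, a real element of the Lorentz
  algebra.\<close>

lemma infinitesimal_lorentz_r31:
  fixes \<eta> :: cquat
  assumes "\<eta> $ 1 = 0"
  shows "r31 a b c d \<odot> qhat \<eta> - \<eta> \<odot> r31 a b c d
    = r31 (2 * (Im (\<eta> $ 2) * b + Im (\<eta> $ 3) * c + Im (\<eta> $ 4) * d))
        (2 * (Im (\<eta> $ 2) * a + Re (\<eta> $ 4) * c - Re (\<eta> $ 3) * d))
        (2 * (Im (\<eta> $ 3) * a - Re (\<eta> $ 4) * b + Re (\<eta> $ 2) * d))
        (2 * (Im (\<eta> $ 4) * a + Re (\<eta> $ 3) * b - Re (\<eta> $ 2) * c))"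
  using assms by (simp add: vec_eq_iff forall_4 r31_nth cquat_nth complex_eq_iff algebra_simps)

text \<open>The first component of the product is \<open>qH (g' v) (g z)\<close>, half the
  derivative of the constant \<open>qH (g u) (g u)\<close>.\<close>

lemma Spin31_derivative:
  fixes g :: "'a::real_normed_vector \<Rightarrow> cquat"
  assumes "open U" "z \<in> U" "g ` U \<subseteq> Spin31" "(g has_derivative g') (at z)"
  shows "(g' v \<odot> qconj (g z)) $ 1 = 0"
proof -
  have "((\<lambda>u. qH (g u) (g u)) has_derivative (\<lambda>v. qH (g z) (g' v) + qH (g' v) (g z))) (at z)"
    by (rule bounded_bilinear.FDERIV[OF bounded_bilinear_qH assms(4,4)])
  then have "((\<lambda>u. 1) has_derivative (\<lambda>v. qH (g z) (g' v) + qH (g' v) (g z))) (at z)"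
    by (rule has_derivative_transform_within_open[OF _ assms(1,2)]) (use assms(3) in \<open>auto simp: Spin31_def\<close>)
  then have "(\<lambda>v. qH (g z) (g' v) + qH (g' v) (g z)) = (\<lambda>v. 0)"
    using has_derivative_const has_derivative_unique by blast
  then have "2 * qH (g' v) (g z) = 0"
    by (metis qH_commute mult_2)
  then have "qH (g' v) (g z) = 0"
    by simp
  then show ?thesis
    by (simp add: qH_def sum_4 cquat_nth)
qed

text \<open>Write dg = \<eta> g. Since \<eta> is pure, the conjugate of g has derivative
  \<open>- (qconj (g z) \<odot> \<eta> v)\<close>, so every term of the product rule factors through
  \<open>lorentz (g z)\<close>: derivatives can be read in the moving frame.\<close>

lemma has_derivative_lorentz:
  fixes g :: "'a::real_normed_vector \<Rightarrow> cquat"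
  assumes "open U" "z \<in> U" "g ` U \<subseteq> Spin31" "(g has_derivative g') (at z)" "(X has_derivative X') (at z)"
  defines "\<eta> v \<equiv> g' v \<odot> qconj (g z)"
  shows "((\<lambda>u. lorentz (g u) (X u)) has_derivative
     (\<lambda>v. lorentz (g z) (X' v + (X z \<odot> qhat (\<eta> v) - \<eta> v \<odot> X z)))) (at z)"
proof -
  have gz: "g z \<in> Spin31" using assms(2,3) by blast
  have g': "g' v = \<eta> v \<odot> g z" for v
    using Spin31_qconj(2)[OF gz] by (simp add: \<eta>_def qmult_assoc quaternion_relations)
  have \<eta>: "\<eta> v $ 1 = 0" for v
    unfolding \<eta>_def by (rule Spin31_derivative[OF assms(1-4)])
  have c: "qconj (g' v) = - (qconj (g z) \<odot> \<eta> v)" for v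
    by (simp add: g' qconj_qmult qconj_pure[OF \<eta>] bounded_bilinear.minus_right[OF bounded_bilinear_qmult])
  have "((\<lambda>u. lorentz (g u) (X u)) has_derivative
     (\<lambda>v. (qconj (g z) \<odot> X z) \<odot> qhat (g' v) + (qconj (g z) \<odot> X' v + qconj (g' v) \<odot> X z) \<odot> qhat (g z))) (at z)"
    unfolding lorentz_def
    by (intro bounded_bilinear.FDERIV[OF bounded_bilinear_qmult] assms(5)
          bounded_linear.has_derivative[OF bounded_linear_qhat assms(4)]
          bounded_linear.has_derivative[OF bounded_linear_qconj assms(4)])
  moreover have "(qconj (g z) \<odot> X z) \<odot> qhat (g' v) + (qconj (g z) \<odot> X' v + qconj (g' v) \<odot> X z) \<odot> qhat (g z)
      = lorentz (g z) (X' v + (X z \<odot> qhat (\<eta> v) - \<eta> v \<odot> X z))" for v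
    unfolding c unfolding g' lorentz_def qhat_qmult
    using bounded_bilinear.minus_left[OF bounded_bilinear_qmult]
      bounded_bilinear.diff_left[OF bounded_bilinear_qmult] bounded_bilinear.diff_right[OF bounded_bilinear_qmult]
    by (simp add: qmult_bilinear qmult_assoc)
  ultimately show ?thesis by simp
qed

lemma smooth_on_lorentz:
  "open U \<Longrightarrow> smooth_on U g \<Longrightarrow> smooth_on U X \<Longrightarrow> smooth_on U (\<lambda>u. lorentz (g u) (X u))"
  unfolding lorentz_def
  by (intro smooth_on_bilinear[OF bounded_bilinear_qmult] smooth_on_compose_linear[OF bounded_linear_qconj]
        smooth_on_compose_linear[OF bounded_linear_qhat])

lemma smooth_on_r31:
  assumes "open U" "smooth_on U a" "smooth_on U b" "smooth_on U c" "smooth_on U d"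
  shows "smooth_on U (\<lambda>u. r31 (a u) (b u) (c u) (d u))"
proof -
  have eq: "r31 a b c d = a *\<^sub>R r31 1 0 0 0 + b *\<^sub>R r31 0 1 0 0 + c *\<^sub>R r31 0 0 1 0 + d *\<^sub>R r31 0 0 0 1" for a b c d
    by (simp add: r31_scaleR r31_add)
  show ?thesis
    unfolding eq[of "a _"] by (intro smooth_on_add smooth_on_scaleR smooth_on_const assms)
qed

lemma xi_eq_lorentz:
  assumes "g z \<in> Spin31"
  shows "xi g \<omega>1 \<omega>2 z v = lorentz (g z) (r31 (\<omega>1 z v) (\<omega>2 z v) 0 0)"
proof -
  have "of_real (\<omega>1 z v) *s (\<i> *s qone) + of_real (\<omega>2 z v) *s qI = r31 (\<omega>1 z v) (\<omega>2 z v) 0 0"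
    by (simp add: vec_eq_iff forall_4 r31_nth cquat_nth mult.commute)
  then show ?thesis
    using assms by (simp add: xi_def lorentz_def qinv_Spin31)
qed

section \<open>Curvature in an orthonormal coframe\<close>

lemma D_cong:
  assumes "open U" "z \<in> U" "f differentiable (at z)" "\<And>u. u \<in> U \<Longrightarrow> f u = g u"
  shows "D g z v = D f z v"
proof -
  have "D f z = D g z"
    by (rule frechet_derivative_transform_within_open[OF assms(3,1,2)]) (rule assms(4))
  then show ?thesis by simp
qed

lemma matrix_inv_mult_left:
  fixes A :: "'a::semiring_1^'n^'m"
  assumes "invertible A"
  shows "matrix_inv A ** A = mat 1"
  using someI_ex[OF assms[unfolded invertible_def]] by (simp add: matrix_inv_def)

text \<open>The functions \<open>a\<close> and \<open>b\<close> are the components of a timelike and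
  a spacelike unit form, and \<open>p\<close> those of the connection form. The first structure
  equations da = - p \<and> b and db = - p \<and> a are stated as symmetry in \<open>i\<close> and
  \<open>j\<close>, which is how they enter the Christoffel symbols.\<close>

locale orthonormal_coframe =
  fixes U :: "complex set" and \<gamma> :: metric and a b p :: "2 \<Rightarrow> complex \<Rightarrow> real"
  assumes U: "open U"
    and sm_a: "smooth_on U (a i)" and sm_b: "smooth_on U (b i)" and sm_p: "smooth_on U (p i)"
    and gram_eq: "z \<in> U \<Longrightarrow> gram \<gamma> z $ i $ j = - a i z * a j z + b i z * b j z"
    and W: "z \<in> U \<Longrightarrow> a 1 z * b 2 z - a 2 z * b 1 z \<noteq> 0"
    and struct_a: "z \<in> U \<Longrightarrow> pd i (a j) z + p i z * b j z = pd j (a i) z + p j z * b i z"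
    and struct_b: "z \<in> U \<Longrightarrow> pd i (b j) z + p i z * a j z = pd j (b i) z + p j z * a i z"
begin

definition "W z = a 1 z * b 2 z - a 2 z * b 1 z"
definition "dual_a k z = (if k = (1::2) then b 2 z else - b 1 z) / W z"
definition "dual_b k z = (if k = (1::2) then - a 2 z else a 1 z) / W z"

lemma W_nz: "z \<in> U \<Longrightarrow> W z \<noteq> 0"
  using W by (simp add: W_def)

lemma dual:
  assumes "z \<in> U"
  shows "a 1 z * dual_a 1 z + a 2 z * dual_a 2 z = 1" "b 1 z * dual_a 1 z + b 2 z * dual_a 2 z = 0"
    "a 1 z * dual_b 1 z + a 2 z * dual_b 2 z = 0" "b 1 z * dual_b 1 z + b 2 z * dual_b 2 z = 1"
  using W_nz[OF assms]
  by (simp_all add: dual_a_def dual_b_def divide_simps) (simp_all add: W_def algebra_simps)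

lemma det_gram: "z \<in> U \<Longrightarrow> det (gram \<gamma> z) = - (W z)\<^sup>2"
  by (simp add: det_2 gram_eq W_def power2_eq_square algebra_simps)

text \<open>Raises the index of a covector given in the coframe. The matrix inverse is never
  computed: the proposed result is multiplied by \<open>gram\<close> and compared.\<close>

lemma matrix_inv_gram:
  assumes z: "z \<in> U" and S: "\<And>l. S l = - a l z * s + b l z * t"
  shows "(\<Sum>l\<in>UNIV. matrix_inv (gram \<gamma> z) $ k $ l * S l) = dual_a k z * s + dual_b k z * t"
proof -
  define c :: "real^2" where "c = (\<chi> k. dual_a k z * s + dual_b k z * t)"
  have "(gram \<gamma> z *v c) $ l = - a l z * ((a 1 z * dual_a 1 z + a 2 z * dual_a 2 z) * s
       + (a 1 z * dual_b 1 z + a 2 z * dual_b 2 z) * t)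
       + b l z * ((b 1 z * dual_a 1 z + b 2 z * dual_a 2 z) * s
       + (b 1 z * dual_b 1 z + b 2 z * dual_b 2 z) * t)" for l
    by (simp add: matrix_vector_mult_def sum_2 gram_eq[OF z] c_def algebra_simps)
  then have "gram \<gamma> z *v c = (\<chi> l. S l)"
    by (simp add: vec_eq_iff dual[OF z] S)
  moreover have "invertible (gram \<gamma> z)"
    using W_nz[OF z] by (simp add: invertible_det_nz det_gram[OF z])
  ultimately have "c = matrix_inv (gram \<gamma> z) *v (\<chi> l. S l)"
    by (metis matrix_inv_mult_left matrix_vector_mul_assoc matrix_vector_mul_lid)
  then show ?thesis
    by (simp add: vec_eq_iff matrix_vector_mult_def c_def)
qed

lemma pd_gram:
  assumes "z \<in> U"
  shows "pd i (\<lambda>u. gram \<gamma> u $ j $ l) z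
    = - (pd i (a j) z * a l z + a j z * pd i (a l) z) + (pd i (b j) z * b l z + b j z * pd i (b l) z)"
proof -
  note sd = smooth_on_has_derivative[OF sm_a assms] smooth_on_has_derivative[OF sm_b assms]
  have "((\<lambda>u. - a j u * a l u + b j u * b l u) has_derivative
     (\<lambda>v. (- a j z * D (a l) z v + - D (a j) z v * a l z) + (b j z * D (b l) z v + D (b j) z v * b l z))) (at z)"
    by (intro has_derivative_add has_derivative_mult has_derivative_minus sd)
  then have "((\<lambda>u. gram \<gamma> u $ j $ l) has_derivative
     (\<lambda>v. (- a j z * D (a l) z v + - D (a j) z v * a l z) + (b j z * D (b l) z v + D (b j) z v * b l z))) (at z)"
    by (rule has_derivative_transform_within_open[OF _ U assms]) (simp add: gram_eq)
  then show ?thesis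
    by (simp add: frechet_derivative_eqI)
qed

text \<open>Together with \<open>ub\<close>, the components in the coframe of the covariant
  derivative of the j-th coordinate field along the i-th one, as \<open>coframe_christoffel\<close>
  confirms.\<close>

definition "ua i j z = pd i (a j) z + p i z * b j z"
definition "ub i j z = pd i (b j) z + p i z * a j z"

text \<open>The structure equations let the indices of each derivative of \<open>a\<close> and
  \<open>b\<close> be exchanged at the cost of terms in \<open>p\<close>. The Koszul combination
  then collapses to twice the covector with coordinates \<open>ua\<close> and \<open>ub\<close>,
  whose index is raised by \<open>matrix_inv_gram\<close>.\<close>

lemma christoffel_eq:
  assumes z: "z \<in> U"
  shows "christoffel \<gamma> k i j z = dual_a k z * ua i j z + dual_b k z * ub i j z"
proof -
  have "pd i (\<lambda>u. gram \<gamma> u $ j $ l) z + pd j (\<lambda>u. gram \<gamma> u $ i $ l) z - pd l (\<lambda>u. gram \<gamma> u $ i $ j) z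
     = - a l z * (2 * ua i j z) + b l z * (2 * ub i j z)" for l
  proof -
    have a: "pd j (a i) z = pd i (a j) z + p i z * b j z - p j z * b i z"
        "pd l (a i) z = pd i (a l) z + p i z * b l z - p l z * b i z"
        "pd l (a j) z = pd j (a l) z + p j z * b l z - p l z * b j z"
      using struct_a[OF z, of j i] struct_a[OF z, of l i] struct_a[OF z, of l j] by linarith+
    have b: "pd j (b i) z = pd i (b j) z + p i z * a j z - p j z * a i z"
        "pd l (b i) z = pd i (b l) z + p i z * a l z - p l z * a i z"
        "pd l (b j) z = pd j (b l) z + p j z * a l z - p l z * a j z"
      using struct_b[OF z, of j i] struct_b[OF z, of l i] struct_b[OF z, of l j] by linarith+
    show ?thesis
      unfolding pd_gram[OF z] ua_def ub_def a b by (simp add: algebra_simps)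
  qed
  then have "(\<Sum>l\<in>UNIV. matrix_inv (gram \<gamma> z) $ k $ l *
      (pd i (\<lambda>u. gram \<gamma> u $ j $ l) z + pd j (\<lambda>u. gram \<gamma> u $ i $ l) z - pd l (\<lambda>u. gram \<gamma> u $ i $ j) z))
    = dual_a k z * (2 * ua i j z) + dual_b k z * (2 * ub i j z)"
    by (rule matrix_inv_gram[OF z])
  then show ?thesis
    unfolding christoffel_def by simp
qed

lemma coframe_christoffel:
  assumes "z \<in> U"
  shows "a 1 z * christoffel \<gamma> 1 i j z + a 2 z * christoffel \<gamma> 2 i j z = ua i j z"
    "b 1 z * christoffel \<gamma> 1 i j z + b 2 z * christoffel \<gamma> 2 i j z = ub i j z"
proof -
  have "a 1 z * christoffel \<gamma> 1 i j z + a 2 z * christoffel \<gamma> 2 i j z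
    = (a 1 z * dual_a 1 z + a 2 z * dual_a 2 z) * ua i j z
      + (a 1 z * dual_b 1 z + a 2 z * dual_b 2 z) * ub i j z"
    by (simp add: christoffel_eq[OF assms] algebra_simps)
  then show "a 1 z * christoffel \<gamma> 1 i j z + a 2 z * christoffel \<gamma> 2 i j z = ua i j z"
    by (simp add: dual[OF assms])
  have "b 1 z * christoffel \<gamma> 1 i j z + b 2 z * christoffel \<gamma> 2 i j z
    = (b 1 z * dual_a 1 z + b 2 z * dual_a 2 z) * ua i j z
      + (b 1 z * dual_b 1 z + b 2 z * dual_b 2 z) * ub i j z"
    by (simp add: christoffel_eq[OF assms] algebra_simps)
  then show "b 1 z * christoffel \<gamma> 1 i j z + b 2 z * christoffel \<gamma> 2 i j z = ub i j z"
    by (simp add: dual[OF assms])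
qed

lemma smooth_christoffel: "smooth_on U (christoffel \<gamma> k i j)"
proof (rule smooth_on_cong[OF U])
  have W: "smooth_on U W"
    unfolding W_def[abs_def] by (intro smooth_on_diff smooth_on_mult sm_a sm_b U)
  have "smooth_on U (dual_a k)"
    unfolding dual_a_def[abs_def]
    by (cases "k = 1") (auto intro!: smooth_on_divide_real W W_nz sm_b smooth_on_minus U)
  moreover have "smooth_on U (dual_b k)"
    unfolding dual_b_def[abs_def]
    by (cases "k = 1") (auto intro!: smooth_on_divide_real W W_nz sm_a smooth_on_minus U)
  ultimately show "smooth_on U (\<lambda>z. dual_a k z * ua i j z + dual_b k z * ub i j z)"
    unfolding ua_def ub_def
    by (intro smooth_on_add smooth_on_mult smooth_on_frechet sm_a sm_b sm_p U)
qed (simp add: christoffel_eq)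

text \<open>The pair \<open>(c, d)\<close> stands for \<open>(a, b)\<close> and for \<open>(b, a)\<close>.\<close>

lemma coframe_riemann:
  assumes z: "z \<in> U"
    and sm: "\<And>i. smooth_on U (c i)" "\<And>i. smooth_on U (d i)"
    and c: "\<And>u i j. u \<in> U \<Longrightarrow> c 1 u * christoffel \<gamma> 1 i j u + c 2 u * christoffel \<gamma> 2 i j u
        = pd i (c j) u + p i u * d j u"
    and d: "\<And>u i j. u \<in> U \<Longrightarrow> d 1 u * christoffel \<gamma> 1 i j u + d 2 u * christoffel \<gamma> 2 i j u
        = pd i (d j) u + p i u * c j u"
  shows "c 1 z * riemann \<gamma> 1 2 1 2 z + c 2 z * riemann \<gamma> 2 2 1 2 z = (pd 1 (p 2) z - pd 2 (p 1) z) * d 2 z"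
proof -
  let ?\<Gamma> = "christoffel \<gamma>"
  note sd = smooth_on_has_derivative[OF _ z]
  \<comment> \<open>Both sides of the assumption on \<open>c\<close> are differentiated in the m-th
    direction, so that derivatives of Christoffel symbols never have to be computed from their
    formula.\<close>
  have der: "c 1 z * pd m (?\<Gamma> 1 i j) z + pd m (c 1) z * ?\<Gamma> 1 i j z
      + (c 2 z * pd m (?\<Gamma> 2 i j) z + pd m (c 2) z * ?\<Gamma> 2 i j z)
      = pd m (\<lambda>u. pd i (c j) u) z + (p i z * pd m (d j) z + pd m (p i) z * d j z)" for i j m
  proof -
    have "((\<lambda>u. c 1 u * ?\<Gamma> 1 i j u + c 2 u * ?\<Gamma> 2 i j u) has_derivative
       (\<lambda>v. (c 1 z * D (?\<Gamma> 1 i j) z v + D (c 1) z v * ?\<Gamma> 1 i j z)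
         + (c 2 z * D (?\<Gamma> 2 i j) z v + D (c 2) z v * ?\<Gamma> 2 i j z))) (at z)"
      by (intro has_derivative_add has_derivative_mult sd smooth_christoffel sm)
    then have 1: "((\<lambda>u. pd i (c j) u + p i u * d j u) has_derivative
       (\<lambda>v. (c 1 z * D (?\<Gamma> 1 i j) z v + D (c 1) z v * ?\<Gamma> 1 i j z)
         + (c 2 z * D (?\<Gamma> 2 i j) z v + D (c 2) z v * ?\<Gamma> 2 i j z))) (at z)"
      by (rule has_derivative_transform_within_open[OF _ U z]) (simp add: c)
    have 2: "((\<lambda>u. pd i (c j) u + p i u * d j u) has_derivative
       (\<lambda>v. D (\<lambda>u. pd i (c j) u) z v + (p i z * D (d j) z v + D (p i) z v * d j z))) (at z)"
      by (intro has_derivative_add has_derivative_mult sd smooth_on_frechet sm sm_p)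
    show ?thesis
      using fun_cong[OF has_derivative_unique[OF 1 2], of "coord m"] by simp
  qed
  have mixed: "pd 1 (\<lambda>u. pd 2 (c 2) u) z = pd 2 (\<lambda>u. pd 1 (c 2) u) z"
    by (rule mixed_derivatives_commute[OF U z sm(1)])
  define X1 X2 where "X1 = c 1 z * pd 1 (?\<Gamma> 1 2 2) z + c 2 z * pd 1 (?\<Gamma> 2 2 2) z"
    and "X2 = c 1 z * pd 2 (?\<Gamma> 1 1 2) z + c 2 z * pd 2 (?\<Gamma> 2 1 2) z"
  define P where "P = pd 1 (\<lambda>u. pd 2 (c 2) u) z"
  have X1: "X1 = P + (p 2 z * pd 1 (d 2) z + pd 1 (p 2) z * d 2 z)
      - pd 1 (c 1) z * ?\<Gamma> 1 2 2 z - pd 1 (c 2) z * ?\<Gamma> 2 2 2 z"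
    using der[of 2 2 1] unfolding X1_def P_def by linarith
  have X2: "X2 = P + (p 1 z * pd 2 (d 2) z + pd 2 (p 1) z * d 2 z)
      - pd 2 (c 1) z * ?\<Gamma> 1 1 2 z - pd 2 (c 2) z * ?\<Gamma> 2 1 2 z"
    using der[of 1 2 2] unfolding X2_def P_def mixed by linarith
  have "c 1 z * riemann \<gamma> 1 2 1 2 z + c 2 z * riemann \<gamma> 2 2 1 2 z = X1 - X2
      + (c 1 z * ?\<Gamma> 1 1 1 z + c 2 z * ?\<Gamma> 2 1 1 z) * ?\<Gamma> 1 2 2 z
      + (c 1 z * ?\<Gamma> 1 1 2 z + c 2 z * ?\<Gamma> 2 1 2 z) * ?\<Gamma> 2 2 2 z
      - (c 1 z * ?\<Gamma> 1 2 1 z + c 2 z * ?\<Gamma> 2 2 1 z) * ?\<Gamma> 1 1 2 z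
      - (c 1 z * ?\<Gamma> 1 2 2 z + c 2 z * ?\<Gamma> 2 2 2 z) * ?\<Gamma> 2 1 2 z"
    unfolding riemann_def sum_2 X1_def X2_def by (simp add: algebra_simps)
  \<comment> \<open>Contracting the quadratic terms with \<open>c\<close> produces derivatives of
    \<open>c\<close> that cancel those from the product rule in \<open>X1\<close> and
    \<open>X2\<close>; the remaining terms carry the factors \<open>d\<close> and are evaluated by
    the second assumption.\<close>
  also have "\<dots> = (pd 1 (p 2) z - pd 2 (p 1) z) * d 2 z + p 2 z * pd 1 (d 2) z - p 1 z * pd 2 (d 2) z
      + p 1 z * (d 1 z * ?\<Gamma> 1 2 2 z + d 2 z * ?\<Gamma> 2 2 2 z)
      - p 2 z * (d 1 z * ?\<Gamma> 1 1 2 z + d 2 z * ?\<Gamma> 2 1 2 z)"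
    unfolding c[OF z] X1 X2 by (simp add: algebra_simps)
  also have "\<dots> = (pd 1 (p 2) z - pd 2 (p 1) z) * d 2 z"
    unfolding d[OF z] by (simp add: algebra_simps)
  finally show ?thesis .
qed

text \<open>In dimension two the connection has one component and its curvature is dp. Contraction
  with \<open>gram\<close> contributes \<open>- W z\<close>, which against the determinant
  \<open>- (W z)\<^sup>2\<close> leaves dp divided by the area density.\<close>

lemma gauss_curvature_eq:
  assumes z: "z \<in> U"
  shows "gauss_curvature \<gamma> z = (pd 1 (p 2) z - pd 2 (p 1) z) / W z"
proof -
  have A: "a 1 z * riemann \<gamma> 1 2 1 2 z + a 2 z * riemann \<gamma> 2 2 1 2 z = (pd 1 (p 2) z - pd 2 (p 1) z) * b 2 z"
    by (rule coframe_riemann[OF z sm_a sm_b]) (use coframe_christoffel in \<open>simp_all add: ua_def ub_def\<close>)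
  have B: "b 1 z * riemann \<gamma> 1 2 1 2 z + b 2 z * riemann \<gamma> 2 2 1 2 z = (pd 1 (p 2) z - pd 2 (p 1) z) * a 2 z"
    by (rule coframe_riemann[OF z sm_b sm_a]) (use coframe_christoffel in \<open>simp_all add: ua_def ub_def\<close>)
  have "(\<Sum>l\<in>UNIV. riemann \<gamma> l 2 1 2 z * gram \<gamma> z $ l $ 1)
     = - a 1 z * (a 1 z * riemann \<gamma> 1 2 1 2 z + a 2 z * riemann \<gamma> 2 2 1 2 z)
       + b 1 z * (b 1 z * riemann \<gamma> 1 2 1 2 z + b 2 z * riemann \<gamma> 2 2 1 2 z)"
    by (simp add: sum_2 gram_eq[OF z] algebra_simps)
  also have "\<dots> = - (pd 1 (p 2) z - pd 2 (p 1) z) * W z"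
    unfolding A B W_def by (simp add: algebra_simps)
  finally show ?thesis
    unfolding gauss_curvature_def det_gram[OF z] using W_nz[OF z] by (simp add: power2_eq_square divide_simps)
qed

end

section \<open>Moving frames from spin-valued maps\<close>

lemma linear_area:
  fixes l1 l2 :: "complex \<Rightarrow> real"
  assumes "linear l1" "linear l2"
  shows "l1 u * l2 v - l1 v * l2 u = (l1 1 * l2 \<i> - l1 \<i> * l2 1) * Im (cnj u * v)"
proof -
  have e: "l x = Re x * l 1 + Im x * l \<i>" if "linear l" for l :: "complex \<Rightarrow> real" and x
    using linear_complex_expand[OF that, of x] by simp
  show ?thesis
    unfolding e[OF assms(1), of u] e[OF assms(1), of v] e[OF assms(2), of u] e[OF assms(2), of v]
    by (simp add: algebra_simps)
qed

text \<open>For spin-valued maps this is dg g^{-1}, the conjugate being the inverse.\<close>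

definition maurer_cartan :: "(complex \<Rightarrow> cquat) \<Rightarrow> complex \<Rightarrow> complex \<Rightarrow> cquat" where
  "maurer_cartan g z v = D g z v \<odot> qconj (g z)"

locale spin_lift =
  fixes U :: "complex set" and g :: "complex \<Rightarrow> cquat"
  assumes U: "open U" and g: "g ` U \<subseteq> Spin31" and sm_g: "smooth_on U g"
begin

abbreviation "\<eta> \<equiv> maurer_cartan g"

lemma gS: "z \<in> U \<Longrightarrow> g z \<in> Spin31"
  using g by blast

lemma eta_1: "z \<in> U \<Longrightarrow> \<eta> z v $ 1 = 0"
  unfolding maurer_cartan_def by (rule Spin31_derivative[OF U _ g smooth_on_has_derivative[OF sm_g]])

lemma D_g: "z \<in> U \<Longrightarrow> D g z v = \<eta> z v \<odot> g z"
  using Spin31_qconj(2)[OF gS] by (simp add: maurer_cartan_def qmult_assoc quaternion_relations)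

lemma qconj_D_g: "z \<in> U \<Longrightarrow> qconj (D g z v) = - (qconj (g z) \<odot> \<eta> z v)"
  by (simp add: D_g qconj_qmult qconj_pure[OF eta_1] bounded_bilinear.minus_right[OF bounded_bilinear_qmult])

lemma linear_eta: "z \<in> U \<Longrightarrow> linear (\<eta> z)"
  using has_derivative_linear[OF smooth_on_has_derivative[OF sm_g]]
  by (auto simp: maurer_cartan_def linear_iff qmult_bilinear scaleR_cquat)

lemma smooth_eta: "smooth_on U (\<lambda>z. \<eta> z v)"
  unfolding maurer_cartan_def
  by (intro smooth_on_bilinear[OF bounded_bilinear_qmult] smooth_on_compose_linear[OF bounded_linear_qconj]
        smooth_on_frechet sm_g U)

lemma smooth_eta_nth: "smooth_on U (\<lambda>z. \<eta> z v $ k)"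
  by (rule smooth_on_compose_linear[OF bounded_linear_vec_nth U smooth_eta])

lemma linear_eta_nth: "z \<in> U \<Longrightarrow> linear (\<lambda>v. \<eta> z v $ k)"
  using linear_compose[OF linear_eta bounded_linear.linear[OF bounded_linear_vec_nth]]
  by (simp add: o_def)

lemma D_eta_nth: "z \<in> U \<Longrightarrow> D (\<lambda>u. \<eta> u w $ k) z v = D (\<lambda>u. \<eta> u w) z v $ k"
  by (rule fun_cong[OF frechet_derivative_eqI])
     (rule bounded_linear.has_derivative[OF bounded_linear_vec_nth smooth_on_has_derivative[OF smooth_eta]])

text \<open>Differentiating dg g^{-1} gives a second derivative of \<open>g\<close>, symmetric in
  the two directions, and the term \<open>- (\<eta> z w \<odot> \<eta> z v)\<close> from the
  derivative of the inverse. Antisymmetrising leaves the commutator.\<close>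

lemma maurer_cartan_equation:
  assumes z: "z \<in> U"
  shows "D (\<lambda>u. \<eta> u w) z v - D (\<lambda>u. \<eta> u v) z w = \<eta> z v \<odot> \<eta> z w - \<eta> z w \<odot> \<eta> z v"
proof -
  have gg: "g z \<odot> qconj (g z) = qone"
    using Spin31_qconj gS z by blast
  have D: "D (\<lambda>u. \<eta> u w) z v = D (\<lambda>u. D g u w) z v \<odot> qconj (g z) - \<eta> z w \<odot> \<eta> z v" for v w
  proof -
    have "((\<lambda>u. \<eta> u w) has_derivative
        (\<lambda>v. D g z w \<odot> qconj (D g z v) + D (\<lambda>u. D g u w) z v \<odot> qconj (g z))) (at z)"
      unfolding maurer_cartan_def
      by (intro bounded_bilinear.FDERIV[OF bounded_bilinear_qmult]
            bounded_linear.has_derivative[OF bounded_linear_qconj]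
            smooth_on_has_derivative[OF _ z] smooth_on_frechet sm_g)
    moreover have "D g z w \<odot> qconj (D g z v) = - (\<eta> z w \<odot> \<eta> z v)" for v
    proof -
      have "D g z w \<odot> qconj (D g z v) = - (\<eta> z w \<odot> ((g z \<odot> qconj (g z)) \<odot> \<eta> z v))"
        by (simp add: D_g[OF z, of w] qconj_D_g[OF z] bounded_bilinear.minus_right[OF bounded_bilinear_qmult] qmult_assoc)
      then show ?thesis
        by (simp add: gg quaternion_relations)
    qed
    ultimately show ?thesis
      by (simp add: frechet_derivative_eqI)
  qed
  show ?thesis
    unfolding D[of w v] D[of v w] mixed_derivatives_commute[OF U z sm_g, of w v] by simp
qed

lemma has_derivative_frame:
  assumes z: "z \<in> U" and d: "(a has_derivative a') (at z)" "(b has_derivative b') (at z)"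
    "(c has_derivative c') (at z)" "(d has_derivative d') (at z)"
  shows "((\<lambda>u. lorentz (g u) (r31 (a u) (b u) (c u) (d u))) has_derivative
    (\<lambda>v. lorentz (g z) (r31
       (a' v + 2 * (Im (\<eta> z v $ 2) * b z + Im (\<eta> z v $ 3) * c z + Im (\<eta> z v $ 4) * d z))
       (b' v + 2 * (Im (\<eta> z v $ 2) * a z + Re (\<eta> z v $ 4) * c z - Re (\<eta> z v $ 3) * d z))
       (c' v + 2 * (Im (\<eta> z v $ 3) * a z - Re (\<eta> z v $ 4) * b z + Re (\<eta> z v $ 2) * d z))
       (d' v + 2 * (Im (\<eta> z v $ 4) * a z + Re (\<eta> z v $ 3) * b z - Re (\<eta> z v $ 2) * c z))))) (at z)"
  using has_derivative_lorentz[OF U z g smooth_on_has_derivative[OF sm_g z] has_derivative_r31[OF d]]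
  by (simp add: maurer_cartan_def[symmetric] infinitesimal_lorentz_r31[OF eta_1[OF z]] r31_add)

end

text \<open>No immersion is assumed yet: for representation data the form \<open>\<xi>\<close> must
  first be shown closed, and only then acquires a primitive.\<close>

locale spin_coframe = spin_lift +
  fixes \<omega>1 \<omega>2 :: "complex \<Rightarrow> complex \<Rightarrow> real"
  assumes lin: "z \<in> U \<Longrightarrow> linear (\<omega>1 z)" "z \<in> U \<Longrightarrow> linear (\<omega>2 z)"
    and sm: "smooth_on U (\<lambda>z. \<omega>1 z v)" "smooth_on U (\<lambda>z. \<omega>2 z v)"
    and area: "z \<in> U \<Longrightarrow> \<omega>1 z 1 * \<omega>2 z \<i> - \<omega>1 z \<i> * \<omega>2 z 1 \<noteq> 0"
begin

definition "\<xi> z v = lorentz (g z) (r31 (\<omega>1 z v) (\<omega>2 z v) 0 0)"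

definition "w z = \<omega>1 z 1 * \<omega>2 z \<i> - \<omega>1 z \<i> * \<omega>2 z 1"
text \<open>With \<open>e2\<close>, the frame dual to \<open>\<omega>1\<close>,
  \<open>\<omega>2\<close> by Cramer's rule, \<open>w\<close> being the signed area density. In the
  converse direction these fields are identified with \<open>alpha1\<close> and
  \<open>alpha2\<close>.\<close>

definition "e1 z = Complex (\<omega>2 z \<i> / w z) (- \<omega>2 z 1 / w z)"
definition "e2 z = Complex (- \<omega>1 z \<i> / w z) (\<omega>1 z 1 / w z)"

lemma w_nz: "z \<in> U \<Longrightarrow> w z \<noteq> 0"
  using area by (simp add: w_def)

lemma omega_expand:
  assumes "z \<in> U"
  shows "\<omega>1 z v = Re v * \<omega>1 z 1 + Im v * \<omega>1 z \<i>" "\<omega>2 z v = Re v * \<omega>2 z 1 + Im v * \<omega>2 z \<i>"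
  using linear_complex_expand[OF lin(1)[OF assms], of v] linear_complex_expand[OF lin(2)[OF assms], of v]
  by simp_all

lemma dual_frame:
  assumes "z \<in> U"
  shows "\<omega>1 z (e1 z) = 1" "\<omega>1 z (e2 z) = 0" "\<omega>2 z (e1 z) = 0" "\<omega>2 z (e2 z) = 1"
  unfolding omega_expand[OF assms, of "e1 z"] omega_expand[OF assms, of "e2 z"]
  unfolding e1_def e2_def complex.sel using w_nz[OF assms]
  by (simp_all add: divide_simps) (simp_all add: w_def algebra_simps)

lemma frame_expand:
  assumes "z \<in> U"
  shows "v = \<omega>1 z v *\<^sub>R e1 z + \<omega>2 z v *\<^sub>R e2 z"
proof -
  have "w z *\<^sub>R v = \<omega>1 z v *\<^sub>R (w z *\<^sub>R e1 z) + \<omega>2 z v *\<^sub>R (w z *\<^sub>R e2 z)"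
    using w_nz[OF assms]
    by (simp add: omega_expand[OF assms, of v] complex_eq_iff e1_def e2_def) (simp add: w_def algebra_simps)
  then have "w z *\<^sub>R v = w z *\<^sub>R (\<omega>1 z v *\<^sub>R e1 z + \<omega>2 z v *\<^sub>R e2 z)"
    by (simp add: scaleR_add_right mult.commute)
  then show ?thesis
    using w_nz[OF assms] by (metis scaleR_left_imp_eq)
qed

lemma area_form:
  assumes "z \<in> U"
  shows "\<omega>1 z u * \<omega>2 z v - \<omega>1 z v * \<omega>2 z u = w z * Im (cnj u * v)"
  unfolding w_def by (rule linear_area[OF lin[OF assms]])

lemma linear_xi: "z \<in> U \<Longrightarrow> linear (\<xi> z)"
  using lin[of z]
  by (auto simp: \<xi>_def linear_iff lorentz_linear(1,4)[symmetric] r31_add r31_scaleR)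

lemma smooth_xi: "smooth_on U (\<lambda>z. \<xi> z v)"
  unfolding \<xi>_def by (intro smooth_on_lorentz smooth_on_r31 smooth_on_const sm sm_g U)

lemma D_xi:
  assumes z: "z \<in> U"
  shows "D (\<lambda>u. \<xi> u x) z v = lorentz (g z) (r31
      (D (\<lambda>u. \<omega>1 u x) z v + 2 * Im (\<eta> z v $ 2) * \<omega>2 z x)
      (D (\<lambda>u. \<omega>2 u x) z v + 2 * Im (\<eta> z v $ 2) * \<omega>1 z x)
      (2 * (Im (\<eta> z v $ 3) * \<omega>1 z x - Re (\<eta> z v $ 4) * \<omega>2 z x))
      (2 * (Im (\<eta> z v $ 4) * \<omega>1 z x + Re (\<eta> z v $ 3) * \<omega>2 z x)))"
  using frechet_derivative_eqI[OF has_derivative_frame[OF z smooth_on_has_derivative[OF sm(1) z]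
      smooth_on_has_derivative[OF sm(2) z] has_derivative_const has_derivative_const]]
  by (simp add: \<xi>_def mult.assoc)

lemma xi_in_R31: "\<xi> z v \<in> R31"
  by (simp add: \<xi>_def lorentz_in_R31 r31_in_R31)

lemma mink_xi: "z \<in> U \<Longrightarrow> mink (\<xi> z u) (\<xi> z v) = - \<omega>1 z u * \<omega>1 z v + \<omega>2 z u * \<omega>2 z v"
  by (simp add: \<xi>_def mink_lorentz gS)

text \<open>The symmetry of \<open>(v, x) \<mapsto> D (\<lambda>u. \<xi> u x) z v\<close> is the closedness of \<open>\<xi>\<close>.\<close>

lemma D_xi_symmetric_iff:
  assumes z: "z \<in> U"
  shows "D (\<lambda>u. \<xi> u x) z v = D (\<lambda>u. \<xi> u v) z x \<longleftrightarrow>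
     D (\<lambda>u. \<omega>1 u x) z v + 2 * Im (\<eta> z v $ 2) * \<omega>2 z x
       = D (\<lambda>u. \<omega>1 u v) z x + 2 * Im (\<eta> z x $ 2) * \<omega>2 z v \<and>
     D (\<lambda>u. \<omega>2 u x) z v + 2 * Im (\<eta> z v $ 2) * \<omega>1 z x
       = D (\<lambda>u. \<omega>2 u v) z x + 2 * Im (\<eta> z x $ 2) * \<omega>1 z v \<and>
     Im (\<eta> z v $ 3) * \<omega>1 z x - Re (\<eta> z v $ 4) * \<omega>2 z x
       = Im (\<eta> z x $ 3) * \<omega>1 z v - Re (\<eta> z x $ 4) * \<omega>2 z v \<and>
     Im (\<eta> z v $ 4) * \<omega>1 z x + Re (\<eta> z v $ 3) * \<omega>2 z x
       = Im (\<eta> z x $ 4) * \<omega>1 z v + Re (\<eta> z x $ 3) * \<omega>2 z v"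
  unfolding D_xi[OF z] lorentz_eq_iff[OF gS[OF z]] r31_inject by auto

end

section \<open>Curvatures and Gauss map of a surface with an adapted spin lift\<close>

locale adapted_frame = spin_coframe +
  fixes F :: "complex \<Rightarrow> cquat"
  assumes F: "F ` U \<subseteq> R31" and dF: "z \<in> U \<Longrightarrow> (F has_derivative \<xi> z) (at z)"
begin

lemma D_F: "z \<in> U \<Longrightarrow> D F z = \<xi> z"
  by (rule frechet_derivative_eqI[OF dF])

lemma smooth_F: "smooth_on U F"
  by (rule smooth_onI_derivative[OF U dF smooth_xi])

lemma induced_metric_eq:
  "z \<in> U \<Longrightarrow> induced_metric F z u v = - \<omega>1 z u * \<omega>1 z v + \<omega>2 z u * \<omega>2 z v"
  by (simp add: induced_metric_def D_F mink_xi)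

lemma D_xi_symmetric:
  assumes z: "z \<in> U"
  shows "D (\<lambda>u. \<xi> u x) z v = D (\<lambda>u. \<xi> u v) z x"
proof -
  have "D (\<lambda>u. \<xi> u x) z v = D (\<lambda>u. D F u x) z v" for x v
    by (rule D_cong[OF U z]) (simp_all add: D_F smooth_on_differentiable[OF smooth_on_frechet[OF smooth_F] z])
  then show ?thesis
    using mixed_derivatives_commute[OF U z smooth_F] by metis
qed

text \<open>As \<open>\<xi>\<close> is the differential of \<open>F\<close>, its closedness holds
  componentwise in the frame: the tangential components are the first structure equations, the
  normal ones the symmetry of the second fundamental form.\<close>

lemmas structure_equations = D_xi_symmetric_iff[THEN iffD1, OF _ D_xi_symmetric]

lemma timelike_immersion: "timelike_immersion_on U F"
  unfolding timelike_immersion_on_def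
proof (intro conjI ballI)
  fix z assume z: "z \<in> U"
  have "v = 0" if "\<xi> z v = 0" for v
  proof -
    have "r31 (\<omega>1 z v) (\<omega>2 z v) 0 0 = 0"
      using that lorentz_eq_iff[OF gS[OF z], of _ 0] by (simp add: \<xi>_def lorentz_linear)
    then have "\<omega>1 z v = 0" "\<omega>2 z v = 0"
      by (simp_all add: vec_eq_iff forall_4 r31_nth)
    then show ?thesis
      using frame_expand[OF z, of v] by simp
  qed
  then show "inj (D F z)"
    using linear_xi[OF z] by (simp add: D_F[OF z] linear_injective_0)
  show "\<exists>v w. induced_metric F z v v = - 1 \<and> induced_metric F z w w = 1 \<and> induced_metric F z v w = 0"
    by (rule exI[of _ "e1 z"], rule exI[of _ "e2 z"]) (simp add: induced_metric_eq[OF z] dual_frame[OF z])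
qed (use F smooth_F in auto)

definition "aa i z = \<omega>1 z (coord i)"
definition "bb i z = \<omega>2 z (coord i)"
definition "pp i z = 2 * Im (\<eta> z (coord i) $ 2)"

sublocale coframe: orthonormal_coframe U "induced_metric F" aa bb pp
proof
  show "smooth_on U (aa i)" "smooth_on U (bb i)" for i
    unfolding aa_def[abs_def] bb_def[abs_def] by (rule sm)+
  show "smooth_on U (pp i)" for i
    unfolding pp_def[abs_def] by (intro smooth_on_mult smooth_on_const smooth_on_Im smooth_eta_nth U)
  show "gram (induced_metric F) z $ i $ j = - aa i z * aa j z + bb i z * bb j z" if "z \<in> U" for z i j
    by (simp add: gram_def induced_metric_eq[OF that] aa_def bb_def)
  show "aa 1 z * bb 2 z - aa 2 z * bb 1 z \<noteq> 0" if "z \<in> U" for z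
    using area[OF that] by (simp add: aa_def bb_def coord_def)
  show "pd i (aa j) z + pp i z * bb j z = pd j (aa i) z + pp j z * bb i z"
    "pd i (bb j) z + pp i z * aa j z = pd j (bb i) z + pp j z * aa i z" if "z \<in> U" for z i j
    unfolding aa_def[abs_def] bb_def[abs_def] pp_def
    using structure_equations[OF that that, of "coord j" "coord i"] by blast+
qed (rule U)

lemma coframe_W: "coframe.W z = w z"
  by (simp add: coframe.W_def w_def aa_def bb_def coord_def)

lemma gauss_curvature_eq:
  assumes z: "z \<in> U"
  shows "gauss_curvature (induced_metric F) z
    = 2 * Im (D (\<lambda>u. \<eta> u \<i> $ 2) z 1 - D (\<lambda>u. \<eta> u 1 $ 2) z \<i>) / w z"
proof -
  have D: "D (pp i) z v = 2 * Im (D (\<lambda>u. \<eta> u (coord i) $ 2) z v)" for i v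
    unfolding pp_def[abs_def]
    by (rule fun_cong[OF frechet_derivative_eqI])
       (intro has_derivative_mult_right has_derivative_Im smooth_on_has_derivative[OF smooth_eta_nth z])
  show ?thesis
    unfolding coframe.gauss_curvature_eq[OF z] coframe_W D by (simp add: coord_def)
qed

text \<open>The inner products of the vector with the coordinate fields form the covector
  \<open>- a\<close> times the first form plus \<open>b\<close> times the second. Raising its index
  by \<open>matrix_inv_gram\<close> recovers the two tangential coordinates.\<close>

lemma tangential_part_lorentz:
  assumes z: "z \<in> U"
  shows "tangential_part F z (lorentz (g z) (r31 a b c d)) = lorentz (g z) (r31 a b 0 0)"
proof -
  have "(\<Sum>l\<in>UNIV. matrix_inv (gram (induced_metric F) z) $ k $ l * mink (lorentz (g z) (r31 a b c d)) (pd l F z))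
      = coframe.dual_a k z * a + coframe.dual_b k z * b" for k
    by (rule coframe.matrix_inv_gram[OF z])
       (simp add: D_F[OF z] \<xi>_def mink_lorentz[OF gS[OF z]] aa_def bb_def)
  then have "tangential_part F z (lorentz (g z) (r31 a b c d))
      = (\<Sum>k\<in>UNIV. (coframe.dual_a k z * a + coframe.dual_b k z * b) *\<^sub>R pd k F z)"
    unfolding tangential_part_def by (simp only: scaleR_sum_left[symmetric])
  also have "\<dots> = lorentz (g z) (r31
      ((aa 1 z * coframe.dual_a 1 z + aa 2 z * coframe.dual_a 2 z) * a
        + (aa 1 z * coframe.dual_b 1 z + aa 2 z * coframe.dual_b 2 z) * b)
      ((bb 1 z * coframe.dual_a 1 z + bb 2 z * coframe.dual_a 2 z) * a
        + (bb 1 z * coframe.dual_b 1 z + bb 2 z * coframe.dual_b 2 z) * b) 0 0)"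
    by (simp add: sum_2 D_F[OF z] \<xi>_def lorentz_linear(1,4)[symmetric] r31_add r31_scaleR aa_def bb_def algebra_simps)
  also have "\<dots> = lorentz (g z) (r31 a b 0 0)"
    unfolding coframe.dual[OF z] by simp
  finally show ?thesis .
qed

definition "rho i z = 2 * Re (\<eta> z (coord i) $ 2)"

lemma D_rho: "z \<in> U \<Longrightarrow> D (rho i) z v = 2 * Re (D (\<lambda>u. \<eta> u (coord i) $ 2) z v)"
  unfolding rho_def[abs_def]
  by (rule fun_cong[OF frechet_derivative_eqI])
     (intro has_derivative_mult_right has_derivative_Re smooth_on_has_derivative[OF smooth_eta_nth])

lemma smooth_rho: "smooth_on U (rho i)"
  unfolding rho_def[abs_def] by (intro smooth_on_mult smooth_on_const smooth_on_Re smooth_eta_nth U)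

text \<open>The terms of the derivative containing the second fundamental form are tangential and
  are projected away; what remains is a rotation of the normal plane at rate \<open>rho\<close>. The
  open subset \<open>V\<close> accommodates normal frames defined only locally.\<close>

lemma normal_connection_eq:
  assumes V: "open V" "V \<subseteq> U" "z \<in> V" and n: "\<And>u. u \<in> V \<Longrightarrow> n u = lorentz (g u) (r31 0 0 (c u) (s u))"
    and sm: "smooth_on V c" "smooth_on V s"
  shows "normal_connection F i n z
    = lorentz (g z) (r31 0 0 (pd i c z + rho i z * s z) (pd i s z - rho i z * c z))"
proof -
  have z: "z \<in> U" using V by blast
  have "(n has_derivative (\<lambda>v. lorentz (g z) (r31
       (0 + 2 * (Im (\<eta> z v $ 2) * 0 + Im (\<eta> z v $ 3) * c z + Im (\<eta> z v $ 4) * s z))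
       (0 + 2 * (Im (\<eta> z v $ 2) * 0 + Re (\<eta> z v $ 4) * c z - Re (\<eta> z v $ 3) * s z))
       (D c z v + 2 * (Im (\<eta> z v $ 3) * 0 - Re (\<eta> z v $ 4) * 0 + Re (\<eta> z v $ 2) * s z))
       (D s z v + 2 * (Im (\<eta> z v $ 4) * 0 + Re (\<eta> z v $ 3) * 0 - Re (\<eta> z v $ 2) * c z))))) (at z)"
    by (rule has_derivative_transform_within_open[OF has_derivative_frame[OF z has_derivative_const
          has_derivative_const smooth_on_has_derivative[OF sm(1) V(3)] smooth_on_has_derivative[OF sm(2) V(3)]]
          V(1,3)])
       (simp add: n)
  from frechet_derivative_eqI[OF this] show ?thesis
    by (simp add: normal_connection_def tangential_part_lorentz[OF z] lorentz_linear(2)[symmetric] r31_diff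
          rho_def mult.assoc)
qed

text \<open>Plane rotations commute, so the quadratic terms cancel and the commutator of the two
  covariant derivatives is the exterior derivative of \<open>rho\<close> times a quarter turn of
  \<open>n2\<close>. The factor \<open>s z * c1 - c z * s1\<close> pairs that quarter turn with
  \<open>n1\<close>.\<close>

lemma normal_curvature_eq:
  assumes V: "open V" "V \<subseteq> U" "z \<in> V"
    and n: "\<And>u. u \<in> V \<Longrightarrow> n2 u = lorentz (g u) (r31 0 0 (c u) (s u))"
    and n1: "n1 z = lorentz (g z) (r31 0 0 c1 s1)"
    and sm: "smooth_on V c" "smooth_on V s"
  shows "normal_curvature F n1 n2 z
     = 2 * Re (D (\<lambda>u. \<eta> u \<i> $ 2) z 1 - D (\<lambda>u. \<eta> u 1 $ 2) z \<i>) * (s z * c1 - c z * s1) / \<bar>w z\<bar>"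
proof -
  have z: "z \<in> U" using V by blast
  have smr: "smooth_on V (rho i)" for i
    using smooth_on_subset[OF smooth_rho V(2)] .
  define C S where "C i u = pd i c u + rho i u * s u" and "S i u = pd i s u - rho i u * c u" for i u
  have smC: "smooth_on V (C i)" and smS: "smooth_on V (S i)" for i
    unfolding C_def[abs_def] S_def[abs_def]
    by (intro smooth_on_add smooth_on_diff smooth_on_mult smooth_on_frechet sm smr V(1))+
  have nc: "normal_connection F i n2 u = lorentz (g u) (r31 0 0 (C i u) (S i u))" if "u \<in> V" for i u
    unfolding C_def S_def by (rule normal_connection_eq[OF V(1,2) that n sm])
  have ncc: "normal_connection F j (normal_connection F i n2) z
      = lorentz (g z) (r31 0 0 (pd j (C i) z + rho j z * S i z) (pd j (S i) z - rho j z * C i z))" for i j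
    by (rule normal_connection_eq[OF V nc smC smS])
  have DC: "pd j (C i) z = pd j (\<lambda>u. pd i c u) z + (rho i z * pd j s z + pd j (rho i) z * s z)" for i j
  proof -
    have "(C i has_derivative (\<lambda>v. D (\<lambda>u. pd i c u) z v + (rho i z * D s z v + D (rho i) z v * s z))) (at z)"
      unfolding C_def[abs_def]
      by (intro has_derivative_add has_derivative_mult smooth_on_has_derivative[OF _ V(3)] smooth_on_frechet sm smr)
    then show ?thesis by (simp add: frechet_derivative_eqI)
  qed
  have DS: "pd j (S i) z = pd j (\<lambda>u. pd i s u) z - (rho i z * pd j c z + pd j (rho i) z * c z)" for i j
  proof -
    have "(S i has_derivative (\<lambda>v. D (\<lambda>u. pd i s u) z v - (rho i z * D c z v + D (rho i) z v * c z))) (at z)"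
      unfolding S_def[abs_def]
      by (intro has_derivative_diff has_derivative_mult smooth_on_has_derivative[OF _ V(3)] smooth_on_frechet sm smr)
    then show ?thesis by (simp add: frechet_derivative_eqI)
  qed
  have "normal_connection F 1 (normal_connection F 2 n2) z - normal_connection F 2 (normal_connection F 1 n2) z
     = lorentz (g z) (r31 0 0 ((pd 1 (rho 2) z - pd 2 (rho 1) z) * s z) (- (pd 1 (rho 2) z - pd 2 (rho 1) z) * c z))"
    unfolding ncc lorentz_linear(2)[symmetric] r31_diff DC DS
      mixed_derivatives_commute[OF V(1,3) sm(1), of "coord 2" "coord 1"]
      mixed_derivatives_commute[OF V(1,3) sm(2), of "coord 2" "coord 1"]
    by (simp add: C_def S_def algebra_simps)
  then have "normal_curvature F n1 n2 z = ((pd 1 (rho 2) z - pd 2 (rho 1) z) * (s z * c1 - c z * s1)) / \<bar>w z\<bar>"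
    unfolding normal_curvature_def n1 coframe.det_gram[OF z] coframe_W
    by (simp add: mink_lorentz[OF gS[OF z]] algebra_simps)
  then show ?thesis
    by (simp add: D_rho[OF z] coord_def algebra_simps)
qed

text \<open>In the product of one tangent vector with the hat of another, the inner factors cancel
  and only a product in the plane of \<open>\<i>\<close> and \<open>qI\<close> is conjugated by
  \<open>g\<close>. For orthogonal vectors it is their area times \<open>\<i> *s qI\<close>; for
  unit vectors that area is a sign, fixed by the orientation.\<close>

lemma gauss_map_eq:
  assumes z: "z \<in> U"
  shows "gauss_map F z = of_real (sgn (w z)) *s (qconj (g z) \<odot> (\<i> *s qI) \<odot> g z)"
proof -
  have prod: "D F z v \<odot> qhat (D F z x) = of_real (\<omega>1 z v * \<omega>2 z x - \<omega>1 z x * \<omega>2 z v) *s (qconj (g z) \<odot> (\<i> *s qI) \<odot> g z)"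
    if "induced_metric F z v x = 0" for v x
  proof -
    have h: "qhat (g z) \<odot> qconj (qhat (g z)) = qone"
      using Spin31_qconj(1)[OF gS[OF z]] by (metis qhat_qconj qhat_qmult qhat_qone)
    have "r31 (\<omega>1 z v) (\<omega>2 z v) 0 0 \<odot> qhat (r31 (\<omega>1 z x) (\<omega>2 z x) 0 0)
       = of_real (\<omega>1 z v * \<omega>2 z x - \<omega>1 z x * \<omega>2 z v) *s (\<i> *s qI)"
      using that unfolding induced_metric_eq[OF z]
      by (simp add: vec_eq_iff forall_4 r31_nth cquat_nth algebra_simps flip: of_real_mult)
    then have "qconj (g z) \<odot> (r31 (\<omega>1 z v) (\<omega>2 z v) 0 0 \<odot> qhat (r31 (\<omega>1 z x) (\<omega>2 z x) 0 0)) \<odot> g z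
       = of_real (\<omega>1 z v * \<omega>2 z x - \<omega>1 z x * \<omega>2 z v) *s (qconj (g z) \<odot> (\<i> *s qI) \<odot> g z)"
      by (simp only: qmult_bilinear)
    moreover have "D F z v \<odot> qhat (D F z x)
       = qconj (g z) \<odot> r31 (\<omega>1 z v) (\<omega>2 z v) 0 0 \<odot> (qhat (g z) \<odot> qconj (qhat (g z)))
         \<odot> qhat (r31 (\<omega>1 z x) (\<omega>2 z x) 0 0) \<odot> g z"
      by (simp add: D_F[OF z] \<xi>_def lorentz_def qhat_qmult qhat_qhat qhat_qconj qmult_assoc)
    ultimately show ?thesis
      by (simp add: h quaternion_relations qmult_assoc)
  qed
  show ?thesis
    unfolding gauss_map_def
  proof (rule the_equality)
    \<comment> \<open>The frame may be negatively oriented for the coordinates; the sign makes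
      \<open>(e1 z, x)\<close> a positive pair.\<close>
    define x where "x = sgn (w z) *\<^sub>R e2 z"
    have s: "sgn (w z) * sgn (w z) = 1"
      using w_nz[OF z] by (simp add: sgn_if)
    have x: "\<omega>1 z x = 0" "\<omega>2 z x = sgn (w z)"
      using dual_frame[OF z] linear_cmul[OF lin(1)[OF z]] linear_cmul[OF lin(2)[OF z]] by (simp_all add: x_def)
    have "w z * Im (cnj (e1 z) * x) = sgn (w z)"
      using area_form[OF z, of "e1 z" x] by (simp add: x dual_frame[OF z])
    then have "w z > 0 \<Longrightarrow> 0 < w z * Im (cnj (e1 z) * x)" "w z < 0 \<Longrightarrow> w z * Im (cnj (e1 z) * x) < 0"
      by simp_all
    then have "Im (cnj (e1 z) * x) > 0"
      using w_nz[OF z] unfolding zero_less_mult_iff mult_less_0_iff by linarith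
    moreover have m: "induced_metric F z (e1 z) (e1 z) = -1" "induced_metric F z x x = 1" "induced_metric F z (e1 z) x = 0"
      by (simp_all add: induced_metric_eq[OF z] dual_frame[OF z] x s w_nz[OF z])
    moreover have "of_real (sgn (w z)) *s (qconj (g z) \<odot> (\<i> *s qI) \<odot> g z) = D F z (e1 z) \<odot> qhat (D F z x)"
      by (simp add: prod[OF m(3)] x dual_frame[OF z])
    ultimately show "\<exists>v x. 0 < Im (cnj v * x) \<and> induced_metric F z v v = - 1 \<and> induced_metric F z x x = 1 \<and>
       induced_metric F z v x = 0 \<and>
       of_real (sgn (w z)) *s (qconj (g z) \<odot> (\<i> *s qI) \<odot> g z) = D F z v \<odot> qhat (D F z x)"
      by blast
  next
    fix q assume "\<exists>v x. 0 < Im (cnj v * x) \<and> induced_metric F z v v = - 1 \<and> induced_metric F z x x = 1 \<and>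
       induced_metric F z v x = 0 \<and> q = D F z v \<odot> qhat (D F z x)"
    then obtain v x where pos: "0 < Im (cnj v * x)" and m: "induced_metric F z v v = - 1"
      "induced_metric F z x x = 1" "induced_metric F z v x = 0" and q: "q = D F z v \<odot> qhat (D F z x)"
      by blast
    \<comment> \<open>By the Lagrange identity in signature (-,+), the square of \<open>d\<close> is
      the mixed product squared minus the product of the two squared lengths, here 1. Positivity of
      the pair gives \<open>d\<close> the sign of \<open>w z\<close>.\<close>
    define d where "d = \<omega>1 z v * \<omega>2 z x - \<omega>1 z x * \<omega>2 z v"
    have "d\<^sup>2 = (- \<omega>1 z v * \<omega>1 z x + \<omega>2 z v * \<omega>2 z x)\<^sup>2
        - (- \<omega>1 z v * \<omega>1 z v + \<omega>2 z v * \<omega>2 z v) * (- \<omega>1 z x * \<omega>1 z x + \<omega>2 z x * \<omega>2 z x)"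
      unfolding d_def by (simp add: power2_eq_square algebra_simps)
    then have "d\<^sup>2 = 1"
      using m by (simp add: induced_metric_eq[OF z])
    moreover have "sgn d = sgn (w z)"
      using area_form[OF z, of v x] pos by (simp add: d_def sgn_mult)
    ultimately have "d = sgn (w z)"
      by (auto simp: power2_eq_1_iff)
    then show "q = of_real (sgn (w z)) *s (qconj (g z) \<odot> (\<i> *s qI) \<odot> g z)"
      unfolding q prod[OF m(3)] d_def[symmetric] by simp
  qed
qed

end

section \<open>From the representation data to the surface\<close>

lemma independent_imp_area:
  fixes a b :: complex
  assumes "\<And>s t :: real. s *\<^sub>R a + t *\<^sub>R b = 0 \<Longrightarrow> s = 0 \<and> t = 0"
  shows "Im (cnj a * b) \<noteq> 0"
proof
  assume im: "Im (cnj a * b) = 0"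
  have "a \<noteq> 0" using assms[of 1 0] by auto
  \<comment> \<open>For parallel vectors, |a|^2 b minus the scalar product times a vanishes: a
    nontrivial linear relation.\<close>
  have "(- Re (cnj a * b)) *\<^sub>R a + (Re (cnj a * a)) *\<^sub>R b = 0"
    using im by (simp add: complex_eq_iff algebra_simps; algebra)
  from assms[OF this] \<open>a \<noteq> 0\<close> show False
    by (simp add: complex_eq_iff sum_squares_eq_zero_iff)
qed

lemma area_imp_independent:
  fixes a b :: complex and s t :: real
  assumes "Im (cnj a * b) \<noteq> 0" "s *\<^sub>R a + t *\<^sub>R b = 0"
  shows "s = 0 \<and> t = 0"
proof -
  have "t * Im (cnj a * b) = Im (cnj a * (s *\<^sub>R a + t *\<^sub>R b))"
    "s * Im (cnj a * b) = Im (cnj (s *\<^sub>R a + t *\<^sub>R b) * b)"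
    by (simp_all add: algebra_simps)
  then show ?thesis using assms by simp
qed

lemma cramer_complex:
  fixes a b v :: complex
  assumes "Im (cnj a * b) \<noteq> 0"
  shows "v = (Im (cnj v * b) / Im (cnj a * b)) *\<^sub>R a + (Im (cnj a * v) / Im (cnj a * b)) *\<^sub>R b"
proof -
  have "Im (cnj a * b) *\<^sub>R v = Im (cnj v * b) *\<^sub>R a + Im (cnj a * v) *\<^sub>R b"
    by (simp add: complex_eq_iff algebra_simps)
  then have "(1 / Im (cnj a * b)) *\<^sub>R (Im (cnj a * b) *\<^sub>R v)
      = (1 / Im (cnj a * b)) *\<^sub>R (Im (cnj v * b) *\<^sub>R a + Im (cnj a * v) *\<^sub>R b)"
    by simp
  then show ?thesis
    using assms by (simp only: scaleR_scaleR scaleR_add_right) simp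
qed

text \<open>Cartan's formula for \<open>d\<omega>(X, Y)\<close> when \<open>\<omega>(X)\<close> and \<open>\<omega>(Y)\<close> are constant.\<close>

lemma form_lie_bracket:
  fixes \<omega> :: "complex \<Rightarrow> complex \<Rightarrow> real" and X Y :: "complex \<Rightarrow> complex"
  assumes U: "open U" "z \<in> U" and lin: "\<And>u. u \<in> U \<Longrightarrow> linear (\<omega> u)"
    and sm: "\<And>v. smooth_on U (\<lambda>u. \<omega> u v)" and XY: "X differentiable (at z)" "Y differentiable (at z)"
    and const: "\<And>u. u \<in> U \<Longrightarrow> \<omega> u (X u) = x" "\<And>u. u \<in> U \<Longrightarrow> \<omega> u (Y u) = y"
  shows "\<omega> z (lie_bracket X Y z) = D (\<lambda>u. \<omega> u (X z)) z (Y z) - D (\<lambda>u. \<omega> u (Y z)) z (X z)"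
proof -
  have expand: "\<omega> u v = Re v * \<omega> u 1 + Im v * \<omega> u \<i>" if "u \<in> U" for u v
    using linear_complex_expand[OF lin[OF that], of v] by simp
  note sd = smooth_on_has_derivative[OF sm U(2)]
  have D: "D (\<lambda>u. \<omega> u c) z v = Re c * D (\<lambda>u. \<omega> u 1) z v + Im c * D (\<lambda>u. \<omega> u \<i>) z v" for c v
    using D_form_expand[OF U lin sm, of c v] by simp
  \<comment> \<open>Differentiating the constant \<omega>(Z) moves the derivative from the field to
    the form; applied to both fields, this removes all derivatives of fields from the
    bracket.\<close>
  have deriv: "\<omega> z (D Z z v) = - D (\<lambda>u. \<omega> u (Z z)) z v"
    if Z: "Z differentiable (at z)" "\<And>u. u \<in> U \<Longrightarrow> \<omega> u (Z u) = k" for Z k v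
  proof -
    have "((\<lambda>u. Re (Z u) * \<omega> u 1 + Im (Z u) * \<omega> u \<i>) has_derivative
       (\<lambda>v. (Re (Z z) * D (\<lambda>u. \<omega> u 1) z v + Re (D Z z v) * \<omega> z 1)
          + (Im (Z z) * D (\<lambda>u. \<omega> u \<i>) z v + Im (D Z z v) * \<omega> z \<i>))) (at z)"
      by (intro has_derivative_add has_derivative_mult sd has_derivative_Re has_derivative_Im
            has_derivative_frechet Z(1))
    then have "((\<lambda>u. k) has_derivative
       (\<lambda>v. (Re (Z z) * D (\<lambda>u. \<omega> u 1) z v + Re (D Z z v) * \<omega> z 1)
          + (Im (Z z) * D (\<lambda>u. \<omega> u \<i>) z v + Im (D Z z v) * \<omega> z \<i>))) (at z)"
      by (rule has_derivative_transform_within_open[OF _ U]) (simp only: expand[symmetric] Z(2))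
    from fun_cong[OF has_derivative_unique[OF this has_derivative_const], of v]
    show ?thesis
      unfolding D[of "Z z" v] expand[OF U(2), of "D Z z v"] by linarith
  qed
  have "\<omega> z (lie_bracket X Y z) = \<omega> z (D Y z (X z)) - \<omega> z (D X z (Y z))"
    using lin[OF U(2)] by (simp add: lie_bracket_def linear_diff)
  then show ?thesis
    by (simp add: deriv[OF XY(1) const(1)] deriv[OF XY(2) const(2)])
qed

lemma alpha_relations:
  assumes "(f1 z)\<^sup>2 - (f2 z)\<^sup>2 \<noteq> 0"
  shows "f1 z * alpha1 f1 f2 h1 h2 z - f2 z * alpha2 f1 f2 h1 h2 z = - \<i> * of_real (h1 z)"
    "f1 z * alpha2 f1 f2 h1 h2 z - f2 z * alpha1 f1 f2 h1 h2 z = of_real (h2 z)"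
proof -
  define \<Delta> where "\<Delta> = (f1 z)\<^sup>2 - (f2 z)\<^sup>2"
  have a: "alpha1 f1 f2 h1 h2 z = (of_real (h2 z) * f2 z - \<i> * of_real (h1 z) * f1 z) / \<Delta>"
    "alpha2 f1 f2 h1 h2 z = (of_real (h2 z) * f1 z - \<i> * of_real (h1 z) * f2 z) / \<Delta>"
    by (simp_all add: alpha1_def alpha2_def \<Delta>_def algebra_simps)
  have "\<Delta> \<noteq> 0" using assms by (simp add: \<Delta>_def)
  then show "f1 z * alpha1 f1 f2 h1 h2 z - f2 z * alpha2 f1 f2 h1 h2 z = - \<i> * of_real (h1 z)"
    "f1 z * alpha2 f1 f2 h1 h2 z - f2 z * alpha1 f1 f2 h1 h2 z = of_real (h2 z)"
    unfolding a by (simp_all add: divide_simps) (simp_all add: \<Delta>_def power2_eq_square algebra_simps)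
qed

text \<open>Serves the converse: fields satisfying the two relations with real \<open>h1\<close>,
  \<open>h2\<close> are recognised as \<open>alpha1\<close> and \<open>alpha2\<close>.\<close>

lemma alpha_unique:
  assumes "(f1 z)\<^sup>2 - (f2 z)\<^sup>2 \<noteq> 0"
    and "f1 z * a - f2 z * b = - \<i> * of_real (h1 z)" "f1 z * b - f2 z * a = of_real (h2 z)"
  shows "alpha1 f1 f2 h1 h2 z = a" "alpha2 f1 f2 h1 h2 z = b"
proof -
  have "- \<i> * (of_real (h1 z) * f1 z + \<i> * of_real (h2 z) * f2 z)
      = f1 z * (- \<i> * of_real (h1 z)) + of_real (h2 z) * f2 z"
    by (simp add: algebra_simps)
  also have "\<dots> = a * ((f1 z)\<^sup>2 - (f2 z)\<^sup>2)"
    unfolding assms(2,3)[symmetric] by (simp add: power2_eq_square algebra_simps)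
  finally show "alpha1 f1 f2 h1 h2 z = a"
    using assms(1) by (simp add: alpha1_def)
  have "of_real (h2 z) * f1 z - \<i> * of_real (h1 z) * f2 z
      = of_real (h2 z) * f1 z + f2 z * (- \<i> * of_real (h1 z))"
    by (simp add: algebra_simps)
  also have "\<dots> = b * ((f1 z)\<^sup>2 - (f2 z)\<^sup>2)"
    unfolding assms(2,3)[symmetric] by (simp add: power2_eq_square algebra_simps)
  finally show "alpha2 f1 f2 h1 h2 z = b"
    using assms(1) by (simp add: alpha2_def)
qed

text \<open>A real linear projection onto Minkowski space. Applied to a primitive it leaves the
  differential \<open>\<xi>\<close> unchanged, since that already takes values in
  \<open>R31\<close>, and corrects the constant of integration.\<close>

definition R31_proj :: "cquat \<Rightarrow> cquat" where
  "R31_proj q = r31 (Im (q $ 1)) (Re (q $ 2)) (Re (q $ 3)) (Re (q $ 4))"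

lemma bounded_linear_R31_proj: "bounded_linear R31_proj"
  by (simp add: linear_conv_bounded_linear[symmetric] linear_iff R31_proj_def vec_eq_iff forall_4
        r31_nth complex_eq_iff)

lemma R31_proj: "R31_proj q \<in> R31" "q \<in> R31 \<Longrightarrow> R31_proj q = q"
  by (auto simp: R31_proj_def r31_in_R31 r31_nth elim!: R31_cases)

locale representation =
  fixes U f1 f2 h1 h2 g \<omega>1 \<omega>2
  assumes data: "representation_data U f1 f2 h1 h2 g \<omega>1 \<omega>2"
begin

abbreviation "\<alpha>1 \<equiv> alpha1 f1 f2 h1 h2"
abbreviation "\<alpha>2 \<equiv> alpha2 f1 f2 h1 h2"

lemma U: "open U" and hol: "f1 holomorphic_on U" "f2 holomorphic_on U"
  and nz: "z \<in> U \<Longrightarrow> (f1 z)\<^sup>2 - (f2 z)\<^sup>2 \<noteq> 0" and gU: "g ` U \<subseteq> Spin31"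
  and sm_h: "smooth_on U h1" "smooth_on U h2"
  and bracket: "z \<in> U \<Longrightarrow> lie_bracket \<alpha>1 \<alpha>2 z = 0"
  and dg: "z \<in> U \<Longrightarrow> g differentiable (at z)"
    "z \<in> U \<Longrightarrow> D g z v \<odot> qinv (g z) = (f1 z * v) *s qJ + (f2 z * v) *s (\<i> *s qK)"
  and lin: "z \<in> U \<Longrightarrow> linear (\<omega>1 z)" "z \<in> U \<Longrightarrow> linear (\<omega>2 z)"
  and dual: "z \<in> U \<Longrightarrow> \<omega>1 z (\<alpha>1 z) = 1" "z \<in> U \<Longrightarrow> \<omega>1 z (\<alpha>2 z) = 0"
    "z \<in> U \<Longrightarrow> \<omega>2 z (\<alpha>1 z) = 0" "z \<in> U \<Longrightarrow> \<omega>2 z (\<alpha>2 z) = 1"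
  using data by (simp_all add: representation_data_def dual_coframe_on_def)

lemma area_alpha: "z \<in> U \<Longrightarrow> Im (cnj (\<alpha>1 z) * \<alpha>2 z) \<noteq> 0"
  using data by (intro independent_imp_area) (simp add: representation_data_def)

lemma smooth_f: "smooth_on U f1" "smooth_on U f2"
  using hol U by (simp_all add: holomorphic_imp_smooth_on)

lemma smooth_alpha: "smooth_on U \<alpha>1" "smooth_on U \<alpha>2"
proof -
  have p: "smooth_on U (\<lambda>z. (f1 z)\<^sup>2 - (f2 z)\<^sup>2)"
    unfolding power2_eq_square by (intro smooth_on_diff smooth_on_mult smooth_f U)
  show "smooth_on U \<alpha>1" "smooth_on U \<alpha>2"
    unfolding alpha1_def[abs_def] alpha2_def[abs_def]
    by (intro smooth_on_mult smooth_on_const smooth_on_divide smooth_on_add smooth_on_diff smooth_on_of_real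
          smooth_f sm_h p nz U; assumption)+
qed

text \<open>The data require the forms only to be linear and dual to the fields. Solving for them
  shows that they are smooth in the base point.\<close>

lemma omega_eq:
  assumes z: "z \<in> U"
  shows "\<omega>1 z v = Im (cnj v * \<alpha>2 z) / Im (cnj (\<alpha>1 z) * \<alpha>2 z)"
    "\<omega>2 z v = Im (cnj (\<alpha>1 z) * v) / Im (cnj (\<alpha>1 z) * \<alpha>2 z)"
proof -
  define s t where "s = Im (cnj v * \<alpha>2 z) / Im (cnj (\<alpha>1 z) * \<alpha>2 z)"
    and "t = Im (cnj (\<alpha>1 z) * v) / Im (cnj (\<alpha>1 z) * \<alpha>2 z)"
  have v: "v = s *\<^sub>R \<alpha>1 z + t *\<^sub>R \<alpha>2 z"
    unfolding s_def t_def by (rule cramer_complex[OF area_alpha[OF z]])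
  show "\<omega>1 z v = s" "\<omega>2 z v = t"
    using lin[OF z] dual[OF z] by (simp_all add: v linear_add linear_cmul)
qed

lemma smooth_omega: "smooth_on U (\<lambda>z. \<omega>1 z v)" "smooth_on U (\<lambda>z. \<omega>2 z v)"
proof -
  have area: "smooth_on U (\<lambda>z. Im (cnj (\<alpha>1 z) * \<alpha>2 z))"
    by (intro smooth_on_Im smooth_on_mult smooth_on_cnj smooth_alpha U)
  have "smooth_on U (\<lambda>z. Im (cnj v * \<alpha>2 z) / Im (cnj (\<alpha>1 z) * \<alpha>2 z))"
    "smooth_on U (\<lambda>z. Im (cnj (\<alpha>1 z) * v) / Im (cnj (\<alpha>1 z) * \<alpha>2 z))"
    by (intro smooth_on_divide_real area area_alpha smooth_on_Im smooth_on_mult smooth_on_cnj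
          smooth_on_const smooth_alpha U; assumption)+
  then show "smooth_on U (\<lambda>z. \<omega>1 z v)" "smooth_on U (\<lambda>z. \<omega>2 z v)"
    by (auto intro: smooth_on_cong[OF U] simp: omega_eq)
qed

lemma D_g_eq: "z \<in> U \<Longrightarrow> D g z v = ((f1 z * v) *s qJ + (f2 z * v) *s (\<i> *s qK)) \<odot> g z"
proof -
  assume z: "z \<in> U"
  have gz: "g z \<in> Spin31" using gU z by blast
  have "D g z v = (D g z v \<odot> qinv (g z)) \<odot> g z"
    using gz by (simp add: qmult_assoc qinv_Spin31 Spin31_qconj quaternion_relations)
  then show ?thesis
    by (simp add: dg(2)[OF z])
qed

text \<open>The data give only differentiability of \<open>g\<close>; the equation dg = \<theta> g,
  with smooth coefficients, bootstraps it.\<close>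

lemma smooth_g: "smooth_on U g"
proof (rule smooth_onI_bootstrap[OF U])
  show "(g has_derivative (\<lambda>v. ((f1 z * v) *s qJ + (f2 z * v) *s (\<i> *s qK)) \<odot> g z)) (at z)" if "z \<in> U" for z
    using has_derivative_frechet[OF dg(1)[OF that]] by (simp add: D_g_eq[OF that, abs_def])
  have "smooth_on U (\<lambda>z. (f1 z * v) *s qJ + (f2 z * v) *s (\<i> *s qK))" for v
    by (intro smooth_on_add smooth_on_bilinear[OF bounded_bilinear_smult] smooth_on_mult smooth_f smooth_on_const U)
  then show "Ck_on k U (\<lambda>z. ((f1 z * v) *s qJ + (f2 z * v) *s (\<i> *s qK)) \<odot> g z)" if "Ck_on k U g" for k v
    using that by (intro Ck_on_bilinear[OF bounded_bilinear_qmult U]) (auto simp: smooth_on_def)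
qed

sublocale spin_coframe U g \<omega>1 \<omega>2
proof (intro spin_coframe.intro spin_lift.intro spin_coframe_axioms.intro)
  show "\<omega>1 z 1 * \<omega>2 z \<i> - \<omega>1 z \<i> * \<omega>2 z 1 \<noteq> 0" if z: "z \<in> U" for z
  proof -
    \<comment> \<open>The area of the dual coframe is the reciprocal of the area \<open>d\<close> of
      the frame, hence nonzero.\<close>
    define d where "d = Im (cnj (\<alpha>1 z) * \<alpha>2 z)"
    have "Im (cnj 1 * \<alpha>2 z) * Im (cnj (\<alpha>1 z) * \<i>) - Im (cnj \<i> * \<alpha>2 z) * Im (cnj (\<alpha>1 z) * 1) = d"
      by (simp add: d_def algebra_simps)
    then have "\<omega>1 z 1 * \<omega>2 z \<i> - \<omega>1 z \<i> * \<omega>2 z 1 = d / (d * d)"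
      unfolding omega_eq[OF z] d_def[symmetric] times_divide_times_eq diff_divide_distrib[symmetric] by simp
    then show ?thesis
      using area_alpha[OF z] by (simp add: d_def)
  qed
qed ((rule U gU smooth_g smooth_omega | (rule lin, assumption))+)

lemma eta_eq:
  assumes "z \<in> U"
  shows "\<eta> z v $ 2 = 0" "\<eta> z v $ 3 = f1 z * v" "\<eta> z v $ 4 = \<i> * (f2 z * v)"
  using dg(2)[OF assms, of v] gS[OF assms]
  by (simp_all add: maurer_cartan_def qinv_Spin31 cquat_nth)

text \<open>The value of d\<omega> on the pair \<open>\<alpha>1\<close>, \<open>\<alpha>2\<close>
  is, up to sign, \<omega> of their bracket, hence zero; a two-form on the plane vanishing on an
  independent pair is zero.\<close>

lemma omega_closed:
  assumes z: "z \<in> U"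
  shows "D (\<lambda>u. \<omega>1 u x) z v = D (\<lambda>u. \<omega>1 u v) z x" "D (\<lambda>u. \<omega>2 u x) z v = D (\<lambda>u. \<omega>2 u v) z x"
proof -
  have closed: "D (\<lambda>u. \<omega> u x) z v = D (\<lambda>u. \<omega> u v) z x"
    if lin: "\<And>u. u \<in> U \<Longrightarrow> linear (\<omega> u)" and sm: "\<And>v. smooth_on U (\<lambda>u. \<omega> u v)"
      and c: "\<And>u. u \<in> U \<Longrightarrow> \<omega> u (\<alpha>1 u) = c1" "\<And>u. u \<in> U \<Longrightarrow> \<omega> u (\<alpha>2 u) = c2"
    for \<omega> :: "complex \<Rightarrow> complex \<Rightarrow> real" and c1 c2
  proof -
    define A where "A = D (\<lambda>u. \<omega> u \<i>) z 1 - D (\<lambda>u. \<omega> u 1) z \<i>"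
    have *: "D (\<lambda>u. \<omega> u x) z v - D (\<lambda>u. \<omega> u v) z x = Im (cnj v * x) * A" for x v
      using exterior_derivative_plane[OF U z lin sm, of x v] by (simp add: A_def)
    have "\<omega> z (lie_bracket \<alpha>1 \<alpha>2 z) = Im (cnj (\<alpha>2 z) * \<alpha>1 z) * A"
      unfolding *[symmetric]
      by (rule form_lie_bracket[OF U z lin sm smooth_on_differentiable[OF smooth_alpha(1) z]
            smooth_on_differentiable[OF smooth_alpha(2) z] c])
    moreover have "Im (cnj (\<alpha>2 z) * \<alpha>1 z) = - Im (cnj (\<alpha>1 z) * \<alpha>2 z)"
      by (simp add: algebra_simps)
    ultimately have "0 = - Im (cnj (\<alpha>1 z) * \<alpha>2 z) * A"
      by (simp only: bracket[OF z] linear_0[OF lin[OF z]])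
    then have "A = 0"
      using area_alpha[OF z] by (metis mult_eq_0_iff neg_equal_0_iff_equal)
    then show ?thesis using * by simp
  qed
  show "D (\<lambda>u. \<omega>1 u x) z v = D (\<lambda>u. \<omega>1 u v) z x"
    by (rule closed[OF lin(1) smooth_omega(1) dual(1,2)])
  show "D (\<lambda>u. \<omega>2 u x) z v = D (\<lambda>u. \<omega>2 u v) z x"
    by (rule closed[OF lin(2) smooth_omega(2) dual(3,4)])
qed

text \<open>The I-component of dg g^{-1} vanishes, so tangentially only the closedness of the
  coframe is asked. Expanding \<open>v\<close> and \<open>x\<close> in \<open>\<alpha>1\<close>,
  \<open>\<alpha>2\<close>, the normal equations reduce to one equality each: Im(f1 \<alpha>2) =
  Im(f2 \<alpha>1) and Re(f1 \<alpha>1) = Re(f2 \<alpha>2). These hold because \<open>h1\<close> and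
  \<open>h2\<close> are real.\<close>

lemma xi_closed:
  assumes z: "z \<in> U"
  shows "D (\<lambda>u. \<xi> u x) z v = D (\<lambda>u. \<xi> u v) z x"
proof -
  note rel = alpha_relations[of f1 z f2 h1 h2, OF nz[OF z]]
  have expand: "c * v = \<omega>1 z v *\<^sub>R (c * \<alpha>1 z) + \<omega>2 z v *\<^sub>R (c * \<alpha>2 z)" for c v
  proof -
    have "v = \<omega>1 z v *\<^sub>R \<alpha>1 z + \<omega>2 z v *\<^sub>R \<alpha>2 z"
      unfolding omega_eq[OF z] by (rule cramer_complex[OF area_alpha[OF z]])
    then have "c * v = c * (\<omega>1 z v *\<^sub>R \<alpha>1 z + \<omega>2 z v *\<^sub>R \<alpha>2 z)"
      by simp
    then show ?thesis by (simp only: distrib_left mult_scaleR_right)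
  qed
  have re: "Re (f1 z * \<alpha>1 z) = Re (f2 z * \<alpha>2 z)"
    using arg_cong[OF rel(1), of Re] by simp
  have im: "Im (f1 z * \<alpha>2 z) = Im (f2 z * \<alpha>1 z)"
    using arg_cong[OF rel(2), of Im] by simp
  have "Im (f1 z * v) * \<omega>1 z x + Im (f2 z * v) * \<omega>2 z x = Im (f1 z * x) * \<omega>1 z v + Im (f2 z * x) * \<omega>2 z v"
    unfolding expand[of _ v] expand[of _ x] plus_complex.sel scaleR_complex.sel im
    by (simp only: algebra_simps)
  moreover have "Re (f2 z * v) * \<omega>1 z x + Re (f1 z * v) * \<omega>2 z x = Re (f2 z * x) * \<omega>1 z v + Re (f1 z * x) * \<omega>2 z v"
    unfolding expand[of _ v] expand[of _ x] plus_complex.sel scaleR_complex.sel re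
    by (simp only: algebra_simps)
  ultimately show ?thesis
    unfolding D_xi_symmetric_iff[OF z]
    by (simp add: eta_eq[OF z] omega_closed[OF z, of x v] del: times_complex.sel)
qed

lemma xi_eq: "z \<in> U \<Longrightarrow> xi g \<omega>1 \<omega>2 z v = \<xi> z v"
  by (simp add: xi_eq_lorentz gS \<xi>_def)

lemma xi_eq': "z \<in> U \<Longrightarrow> xi g \<omega>1 \<omega>2 z = \<xi> z"
  by (rule ext) (rule xi_eq)

lemma closed_form: "closed_form_on U (xi g \<omega>1 \<omega>2)"
  unfolding closed_form_on_def
proof (intro ballI conjI allI)
  fix z assume z: "z \<in> U"
  have "xi g \<omega>1 \<omega>2 z = \<xi> z"
    using xi_eq[OF z] by blast
  then show "linear (xi g \<omega>1 \<omega>2 z)"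
    using linear_xi[OF z] by simp
  have d: "((\<lambda>u. xi g \<omega>1 \<omega>2 u x) has_derivative D (\<lambda>u. \<xi> u x) z) (at z)" for x
    by (rule has_derivative_transform_within_open[OF smooth_on_has_derivative[OF smooth_xi z] U z])
       (simp add: xi_eq)
  then show "(\<lambda>u. xi g \<omega>1 \<omega>2 u v) differentiable at z" for v
    using differentiableI by blast
  show "D (\<lambda>u. xi g \<omega>1 \<omega>2 u x) z v - D (\<lambda>u. xi g \<omega>1 \<omega>2 u v) z x = 0" for x v
    using xi_closed[OF z, of x v] by (simp add: frechet_derivative_eqI[OF d])
qed

lemma primitive_exists: "\<exists>F. primitive_on U (xi g \<omega>1 \<omega>2) F"
proof -
  have "simply_connected U"
    using data by (simp add: representation_data_def)
  from poincare_simply_connected[OF U this linear_xi smooth_xi xi_closed]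
  obtain F where F: "\<And>z. z \<in> U \<Longrightarrow> (F has_derivative \<xi> z) (at z)"
    by blast
  have "((\<lambda>z. R31_proj (F z)) has_derivative xi g \<omega>1 \<omega>2 z) (at z)" if "z \<in> U" for z
    using bounded_linear.has_derivative[OF bounded_linear_R31_proj F[OF that]]
    by (simp add: R31_proj(2)[OF xi_in_R31] xi_eq'[OF that])
  then show ?thesis
    by (intro exI[of _ "\<lambda>z. R31_proj (F z)"]) (auto simp: primitive_on_def R31_proj)
qed

lemma primitive_surface:
  assumes F: "primitive_on U (xi g \<omega>1 \<omega>2) F"
  shows "timelike_immersion_on U F"
    and "z \<in> U \<Longrightarrow> induced_metric F z u v = - \<omega>1 z u * \<omega>1 z v + \<omega>2 z u * \<omega>2 z v"
    and "z \<in> U \<Longrightarrow> gauss_curvature (induced_metric F) z = 0"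
    and "normal_curvature_vanishes_on U F"
proof -
  interpret adapted_frame U g \<omega>1 \<omega>2 F
    using F by unfold_locales (auto simp: primitive_on_def xi_eq')
  have D0: "D (\<lambda>u. \<eta> u x $ 2) z v = 0" if "z \<in> U" for x z v
  proof -
    have "((\<lambda>u. \<eta> u x $ 2) has_derivative (\<lambda>v. 0)) (at z)"
      by (rule has_derivative_transform_within_open[OF has_derivative_const U that]) (simp add: eta_eq)
    then show ?thesis by (simp add: frechet_derivative_eqI)
  qed
  show "timelike_immersion_on U F"
    by (rule timelike_immersion)
  show "z \<in> U \<Longrightarrow> induced_metric F z u v = - \<omega>1 z u * \<omega>1 z v + \<omega>2 z u * \<omega>2 z v"
    by (rule induced_metric_eq)
  show "z \<in> U \<Longrightarrow> gauss_curvature (induced_metric F) z = 0"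
    by (simp add: gauss_curvature_eq D0)
  show "normal_curvature_vanishes_on U F"
    unfolding normal_curvature_vanishes_on_def
  proof (intro allI impI ballI, elim conjE)
    fix V n1 n2 z
    assume V: "open V" "V \<subseteq> U" and n: "orthonormal_normal_frame_on V F n1 n2" and z: "z \<in> V"
    have smV: "smooth_on V g" by (rule smooth_on_subset[OF sm_g V(2)])
    \<comment> \<open>The normal coordinates of an arbitrary frame vector relative to the images of
      J and K under \<open>g\<close>; orthogonality to the images of \<open>e1\<close>,
      \<open>e2\<close> rules out tangential coordinates.\<close>
    define c s where "c n u = mink (n u) (lorentz (g u) (r31 0 0 1 0))"
      and "s n u = mink (n u) (lorentz (g u) (r31 0 0 0 1))" for n u
    have sm: "smooth_on V (c n2)" "smooth_on V (s n2)"
      unfolding c_def[abs_def] s_def[abs_def] using n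
      by (auto intro!: smooth_on_bilinear[OF bounded_bilinear_mink] smooth_on_lorentz smooth_on_const smV V(1)
            simp: orthonormal_normal_frame_on_def)
    have eq: "n u = lorentz (g u) (r31 0 0 (c n u) (s n u))" if u: "u \<in> V" and "n = n1 \<or> n = n2" for n u
    proof -
      have uU: "u \<in> U" using u V by blast
      have nu: "n u \<in> R31" "\<And>v. mink (n u) (D F u v) = 0"
        using n that by (auto simp: orthonormal_normal_frame_on_def)
      obtain p q x y where p: "n u = lorentz (g u) (r31 p q x y)"
        using lorentz_r31_cases[OF gS[OF uU] nu(1)] .
      have "p = 0" "q = 0"
        using nu(2)[of "e1 u"] nu(2)[of "e2 u"]
        by (simp_all add: p D_F[OF uU] \<xi>_def mink_lorentz[OF gS[OF uU]] dual_frame[OF uU])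
      then show ?thesis
        by (simp add: p c_def s_def mink_lorentz[OF gS[OF uU]])
    qed
    have e1: "n1 z = lorentz (g z) (r31 0 0 (c n1 z) (s n1 z))"
      using eq[OF z, of n1] by simp
    have e2: "n2 u = lorentz (g u) (r31 0 0 (c n2 u) (s n2 u))" if "u \<in> V" for u
      using eq[OF that, of n2] by simp
    show "normal_curvature F n1 n2 z = 0"
      using normal_curvature_eq[where ?n1.0=n1 and ?n2.0=n2 and c="c n2" and s="s n2", OF V z e2 e1 sm] by (simp add: D0 subsetD[OF V(2) z])
  qed
qed

end

section \<open>Adapted frames on a timelike surface\<close>

lemma qH_smult: "qH (c *s p) (d *s q) = c * d * qH p q"
  by (simp add: qH_def sum_4 algebra_simps)

text \<open>The boost taking the time axis to \<open>E\<close> and the rotation taking the first space axis to \<open>Y\<close> are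
  inverse to the square roots of the unit elements \<open>q = - \<i> E\<close> and \<open>q = - Y I\<close>, namely \<open>(1 + q) / |1 + q|\<close>.\<close>

definition half_way :: "cquat \<Rightarrow> cquat" where
  "half_way p = of_real (1 / sqrt (2 * Re (p $ 1))) *s qconj p"

definition boost_lift :: "cquat \<Rightarrow> cquat" where
  "boost_lift E = half_way (qone - \<i> *s E)"

definition rotation_lift :: "cquat \<Rightarrow> cquat" where
  "rotation_lift Y = half_way (qone - Y \<odot> qI)"

text \<open>For \<open>p = 1 + q\<close> with \<open>q\<close> of unit norm, \<open>qH p p\<close>
  is twice the first component of \<open>p\<close>; this is where \<open>2 * t\<close> comes from.
  Both factors of the action scale by the same real number, so the image of \<open>x\<close> may be
  computed with the unnormalised \<open>p\<close>, as a polynomial identity.\<close>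

lemma half_way:
  assumes t: "Re (p $ 1) = t" "t > 0" and p: "qH p p = of_real (2 * t)"
  shows "half_way p \<in> Spin31"
    "lorentz (qconj p) x = (2 * t) *\<^sub>R y \<Longrightarrow> lorentz (half_way p) x = y"
proof -
  define k where "k = 1 / sqrt (2 * t)"
  have k: "k * k * (2 * t) = 1" and h: "half_way p = of_real k *s qconj p"
    using t by (simp_all add: half_way_def k_def)
  have "qH (half_way p) (half_way p) = of_real (k * k * (2 * t))"
    by (simp only: h qH_smult qH_qconj p of_real_mult)
  then show "half_way p \<in> Spin31"
    unfolding k by (simp add: Spin31_def)
  have "lorentz (of_real k *s q) x = (k * k) *\<^sub>R lorentz q x" for q
    by (simp add: scaleR_cquat vec_eq_iff forall_4 lorentz_def cquat_nth algebra_simps)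
  then show "lorentz (half_way p) x = y" if "lorentz (qconj p) x = (2 * t) *\<^sub>R y"
    unfolding h by (simp only: that scaleR_scaleR k scaleR_one)
qed

text \<open>On the hyperboloid, \<open>a > -1\<close> selects the future sheet, where the
  normalising root is of a positive number.\<close>

lemma boost_lift:
  assumes "- a\<^sup>2 + b\<^sup>2 + c\<^sup>2 + d\<^sup>2 = -1" "a > -1"
  shows "boost_lift (r31 a b c d) \<in> Spin31"
    "lorentz (boost_lift (r31 a b c d)) (r31 1 0 0 0) = r31 a b c d"
proof -
  define p where "p = qone - \<i> *s r31 a b c d"
  have t: "Re (p $ 1) = 1 + a" "1 + a > 0"
    using assms(2) by (simp_all add: p_def r31_nth cquat_nth)
  have bcd: "b\<^sup>2 + c\<^sup>2 + d\<^sup>2 = a\<^sup>2 - 1"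
    using assms(1) by simp
  have "qH p p = of_real ((1 + a)\<^sup>2 - (b\<^sup>2 + c\<^sup>2 + d\<^sup>2))"
    by (simp add: p_def qH_def sum_4 cquat_nth r31_nth complex_eq_iff power2_eq_square algebra_simps)
  also have "\<dots> = of_real (2 * (1 + a))"
    unfolding bcd by (simp add: power2_eq_square algebra_simps)
  finally have q: "qH p p = of_real (2 * (1 + a))" .
  have "lorentz (qconj p) (r31 1 0 0 0)
      = r31 ((1 + a)\<^sup>2 + (b\<^sup>2 + c\<^sup>2 + d\<^sup>2)) (2 * (1 + a) * b) (2 * (1 + a) * c) (2 * (1 + a) * d)"
    by (simp add: p_def lorentz_def vec_eq_iff forall_4 cquat_nth r31_nth complex_eq_iff power2_eq_square algebra_simps)
  also have "\<dots> = (2 * (1 + a)) *\<^sub>R r31 a b c d"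
    unfolding bcd r31_scaleR by (simp add: r31_inject power2_eq_square algebra_simps)
  finally show "lorentz (boost_lift (r31 a b c d)) (r31 1 0 0 0) = r31 a b c d"
    unfolding boost_lift_def p_def[symmetric] by (rule half_way(2)[OF t q])
  show "boost_lift (r31 a b c d) \<in> Spin31"
    unfolding boost_lift_def p_def[symmetric] by (rule half_way(1)[OF t q])
qed

text \<open>On the sphere, \<open>b > -1\<close> excludes only the antipode of the first axis, to
  which no shortest rotation is distinguished. The time axis is fixed, so the boost fitted before is
  not disturbed.\<close>

lemma rotation_lift:
  assumes "b\<^sup>2 + c\<^sup>2 + d\<^sup>2 = 1" "b > -1"
  shows "rotation_lift (r31 0 b c d) \<in> Spin31"
    "lorentz (rotation_lift (r31 0 b c d)) (r31 1 0 0 0) = r31 1 0 0 0"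
    "lorentz (rotation_lift (r31 0 b c d)) (r31 0 1 0 0) = r31 0 b c d"
proof -
  define p where "p = qone - r31 0 b c d \<odot> qI"
  have t: "Re (p $ 1) = 1 + b" "1 + b > 0"
    using assms(2) by (simp_all add: p_def r31_nth cquat_nth)
  have cd: "c\<^sup>2 + d\<^sup>2 = 1 - b\<^sup>2"
    using assms(1) by simp
  have "qH p p = of_real ((1 + b)\<^sup>2 + (c\<^sup>2 + d\<^sup>2))"
    by (simp add: p_def qH_def sum_4 cquat_nth r31_nth complex_eq_iff power2_eq_square algebra_simps)
  also have "\<dots> = of_real (2 * (1 + b))"
    unfolding cd by (simp add: power2_eq_square algebra_simps)
  finally have q: "qH p p = of_real (2 * (1 + b))" .
  show "rotation_lift (r31 0 b c d) \<in> Spin31"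
    unfolding rotation_lift_def p_def[symmetric] by (rule half_way(1)[OF t q])
  have "lorentz (qconj p) (r31 1 0 0 0) = r31 ((1 + b)\<^sup>2 + (c\<^sup>2 + d\<^sup>2)) 0 0 0"
    by (simp add: p_def lorentz_def vec_eq_iff forall_4 cquat_nth r31_nth complex_eq_iff power2_eq_square algebra_simps)
  also have "\<dots> = (2 * (1 + b)) *\<^sub>R r31 1 0 0 0"
    unfolding cd r31_scaleR by (simp add: r31_inject power2_eq_square algebra_simps)
  finally show "lorentz (rotation_lift (r31 0 b c d)) (r31 1 0 0 0) = r31 1 0 0 0"
    unfolding rotation_lift_def p_def[symmetric] by (rule half_way(2)[OF t q])
  have "lorentz (qconj p) (r31 0 1 0 0)
      = r31 0 ((1 + b)\<^sup>2 - (c\<^sup>2 + d\<^sup>2)) (2 * (1 + b) * c) (2 * (1 + b) * d)"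
    by (simp add: p_def lorentz_def vec_eq_iff forall_4 cquat_nth r31_nth complex_eq_iff power2_eq_square algebra_simps)
  also have "\<dots> = (2 * (1 + b)) *\<^sub>R r31 0 b c d"
    unfolding cd r31_scaleR by (simp add: r31_inject power2_eq_square algebra_simps)
  finally show "lorentz (rotation_lift (r31 0 b c d)) (r31 0 1 0 0) = r31 0 b c d"
    unfolding rotation_lift_def p_def[symmetric] by (rule half_way(2)[OF t q])
qed

lemma smooth_on_nth: "open U \<Longrightarrow> smooth_on U f \<Longrightarrow> smooth_on U (\<lambda>u. f u $ k)"
  by (rule smooth_on_compose_linear[OF bounded_linear_vec_nth])

lemma smooth_half_way:
  assumes "open U" "smooth_on U p" "\<And>u. u \<in> U \<Longrightarrow> Re (p u $ 1) > 0"
  shows "smooth_on U (\<lambda>u. half_way (p u))"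
proof -
  have pos: "2 * Re (p u $ 1) > 0" if "u \<in> U" for u
    using assms(3)[OF that] by simp
  have "smooth_on U (\<lambda>u. 2 * Re (p u $ 1))"
    by (intro smooth_on_mult smooth_on_const smooth_on_Re smooth_on_nth assms)
  then have "smooth_on U (\<lambda>u. 1 / sqrt (2 * Re (p u $ 1)))"
    by (intro smooth_on_divide_real[OF assms(1) _ smooth_on_const smooth_on_sqrt[OF assms(1) pos]])
       (use pos in fastforce)+
  then show ?thesis
    unfolding half_way_def
    by (intro smooth_on_bilinear[OF bounded_bilinear_smult] smooth_on_of_real
          smooth_on_compose_linear[OF bounded_linear_qconj] assms)
qed

lemma smooth_boost_lift:
  assumes "open U" "smooth_on U E" "\<And>u. u \<in> U \<Longrightarrow> Im (E u $ 1) > -1"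
  shows "smooth_on U (\<lambda>u. boost_lift (E u))"
  unfolding boost_lift_def
proof (rule smooth_half_way[OF assms(1)])
  show "smooth_on U (\<lambda>u. qone - \<i> *s E u)"
    by (intro smooth_on_diff smooth_on_const smooth_on_bilinear[OF bounded_bilinear_smult] assms)
  show "Re ((qone - \<i> *s E u) $ 1) > 0" if "u \<in> U" for u
    using assms(3)[OF that] by (simp add: cquat_nth)
qed

lemma smooth_rotation_lift:
  assumes "open U" "smooth_on U E" "\<And>u. u \<in> U \<Longrightarrow> Re (E u $ 2) > -1"
  shows "smooth_on U (\<lambda>u. rotation_lift (E u))"
  unfolding rotation_lift_def
proof (rule smooth_half_way[OF assms(1)])
  show "smooth_on U (\<lambda>u. qone - E u \<odot> qI)"
    by (intro smooth_on_diff smooth_on_const smooth_on_bilinear[OF bounded_bilinear_qmult] assms)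
  show "Re ((qone - E u \<odot> qI) $ 1) > 0" if "u \<in> U" for u
    using assms(3)[OF that] by (simp add: cquat_nth)
qed

lemma smooth_on_open_superlevel:
  fixes f :: "'a::real_normed_vector \<Rightarrow> real"
  assumes "open U" "smooth_on U f"
  shows "open {u \<in> U. f u > c}"
proof -
  have "open (U \<inter> f -` {c<..})"
    using continuous_open_preimage[OF smooth_on_continuous[OF assms(2)] assms(1)] by simp
  moreover have "U \<inter> f -` {c<..} = {u \<in> U. f u > c}" by auto
  ultimately show ?thesis by simp
qed

text \<open>The inverse of the boost for \<open>E1\<close> carries \<open>E2\<close> to a unit
  vector \<open>Y\<close> orthogonal to the time axis, hence on the unit sphere of space. A rotation
  lift of \<open>Y\<close> followed by the boost matches both vectors; as the action is a right
  action, the rotation is the left factor. The sign conditions at \<open>x0\<close> persist nearby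
  in the form the two lifts require.\<close>

lemma lift_orthonormal_pair:
  assumes U: "open U" "x0 \<in> U"
    and E: "E1 ` U \<subseteq> R31" "E2 ` U \<subseteq> R31" "smooth_on U E1" "smooth_on U E2"
    and on: "\<And>u. u \<in> U \<Longrightarrow> mink (E1 u) (E1 u) = -1" "\<And>u. u \<in> U \<Longrightarrow> mink (E2 u) (E2 u) = 1"
      "\<And>u. u \<in> U \<Longrightarrow> mink (E1 u) (E2 u) = 0"
    and pos: "Im (E1 x0 $ 1) > 0" "Re (lorentz (qconj (boost_lift (E1 x0))) (E2 x0) $ 2) \<ge> 0"
  obtains N g where "open N" "x0 \<in> N" "N \<subseteq> U" "g ` N \<subseteq> Spin31" "smooth_on N g"
    "\<And>u. u \<in> N \<Longrightarrow> lorentz (g u) (r31 1 0 0 0) = E1 u" "\<And>u. u \<in> N \<Longrightarrow> lorentz (g u) (r31 0 1 0 0) = E2 u"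
proof -
  define U1 where "U1 = {u \<in> U. Im (E1 u $ 1) > 0}"
  have U1: "open U1" "x0 \<in> U1" "U1 \<subseteq> U"
  proof -
    show "open U1"
      unfolding U1_def by (intro smooth_on_open_superlevel smooth_on_Im smooth_on_nth E U(1))
  qed (use U pos in \<open>auto simp: U1_def\<close>)
  define Y where "Y u = lorentz (qconj (boost_lift (E1 u))) (E2 u)" for u
  have b: "boost_lift (E1 u) \<in> Spin31" "lorentz (boost_lift (E1 u)) (r31 1 0 0 0) = E1 u" if "u \<in> U1" for u
  proof -
    have "E1 u \<in> R31" using that E(1) U1(3) by blast
    then obtain a b c d where r: "E1 u = r31 a b c d" by (rule R31_cases)
    have "- a\<^sup>2 + b\<^sup>2 + c\<^sup>2 + d\<^sup>2 = -1"
      using on(1)[of u] that U1(3) by (auto simp: r mink_def qH_r31 power2_eq_square)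
    moreover have "a > -1" using that by (simp add: U1_def r r31_nth)
    ultimately show "boost_lift (E1 u) \<in> Spin31" "lorentz (boost_lift (E1 u)) (r31 1 0 0 0) = E1 u"
      unfolding r by (rule boost_lift)+
  qed
  have smb: "smooth_on U1 (\<lambda>u. boost_lift (E1 u))"
    by (rule smooth_boost_lift[OF U1(1) smooth_on_subset[OF E(3) U1(3)]]) (simp add: U1_def)
  have smY: "smooth_on U1 Y"
    unfolding Y_def[abs_def]
    by (intro smooth_on_lorentz smooth_on_compose_linear[OF bounded_linear_qconj] smb U1(1)
          smooth_on_subset[OF E(4) U1(3)])
  have lY: "lorentz (boost_lift (E1 u)) (Y u) = E2 u" if "u \<in> U1" for u
    unfolding Y_def by (rule lorentz_inverse(1)[OF b(1)[OF that]])
  have Y: "\<exists>b c d. Y u = r31 0 b c d \<and> b\<^sup>2 + c\<^sup>2 + d\<^sup>2 = 1" if u: "u \<in> U1" for u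
  proof -
    have "Y u \<in> R31"
      unfolding Y_def by (rule lorentz_in_R31) (use E(2) U1(3) u in auto)
    then obtain a b c d where r: "Y u = r31 a b c d" by (rule R31_cases)
    have uU: "u \<in> U" using u U1(3) by blast
    have "mink (lorentz (boost_lift (E1 u)) (r31 1 0 0 0)) (lorentz (boost_lift (E1 u)) (Y u)) = - a"
      unfolding r mink_lorentz[OF b(1)[OF u]] by simp
    moreover have "mink (lorentz (boost_lift (E1 u)) (Y u)) (lorentz (boost_lift (E1 u)) (Y u))
        = - a\<^sup>2 + b\<^sup>2 + c\<^sup>2 + d\<^sup>2"
      unfolding r mink_lorentz[OF b(1)[OF u]] by (simp add: power2_eq_square)
    ultimately have "a = 0" "b\<^sup>2 + c\<^sup>2 + d\<^sup>2 = 1"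
      unfolding lY[OF u] b(2)[OF u] on(2)[OF uU] on(3)[OF uU] by simp_all
    then show ?thesis
      using r by auto
  qed
  define N where "N = {u \<in> U1. Re (Y u $ 2) > -1}"
  have N: "open N" "x0 \<in> N" "N \<subseteq> U1"
  proof -
    show "open N"
      unfolding N_def by (intro smooth_on_open_superlevel smooth_on_Re smooth_on_nth smY U1(1))
  qed (use U1 pos(2) in \<open>auto simp: N_def Y_def\<close>)
  define g where "g u = rotation_lift (Y u) \<odot> boost_lift (E1 u)" for u
  have r: "rotation_lift (Y u) \<in> Spin31" "lorentz (rotation_lift (Y u)) (r31 1 0 0 0) = r31 1 0 0 0"
    "lorentz (rotation_lift (Y u)) (r31 0 1 0 0) = Y u" if u: "u \<in> N" for u
  proof -
    obtain b c d where Y': "Y u = r31 0 b c d" "b\<^sup>2 + c\<^sup>2 + d\<^sup>2 = 1"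
      using Y u N(3) by blast
    have "b > -1" using u by (simp add: N_def Y' r31_nth)
    then show "rotation_lift (Y u) \<in> Spin31" "lorentz (rotation_lift (Y u)) (r31 1 0 0 0) = r31 1 0 0 0"
      "lorentz (rotation_lift (Y u)) (r31 0 1 0 0) = Y u"
      unfolding Y'(1) by (rule rotation_lift[OF Y'(2)])+
  qed
  show ?thesis
  proof (rule that[OF N(1,2), of g])
    show "N \<subseteq> U" using N(3) U1(3) by blast
    show "g ` N \<subseteq> Spin31"
      using r(1) b(1) N(3) by (auto simp: g_def intro!: Spin31_qmult)
    show "smooth_on N g"
      unfolding g_def[abs_def]
      by (intro smooth_on_bilinear[OF bounded_bilinear_qmult] N(1) smooth_on_subset[OF smb N(3)]
            smooth_rotation_lift smooth_on_subset[OF smY N(3)]) (simp add: N_def)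
    show "lorentz (g u) (r31 1 0 0 0) = E1 u" "lorentz (g u) (r31 0 1 0 0) = E2 u" if "u \<in> N" for u
      using r[OF that] b(2)[of u] lY[of u] that N(3) by (auto simp: g_def lorentz_lorentz[symmetric])
  qed
qed

section \<open>Existence of adapted frames near a point\<close>

lemma R31_derivative:
  assumes "open U" "z \<in> U" "F ` U \<subseteq> R31" "F differentiable (at z)"
  shows "D F z v \<in> R31"
proof -
  have "((\<lambda>u. R31_proj (F u)) has_derivative (\<lambda>v. R31_proj (D F z v))) (at z)"
    by (rule bounded_linear.has_derivative[OF bounded_linear_R31_proj has_derivative_frechet[OF assms(4)]])
  then have "(F has_derivative (\<lambda>v. R31_proj (D F z v))) (at z)"
    by (rule has_derivative_transform_within_open[OF _ assms(1,2)]) (use assms(3) R31_proj(2) in blast)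
  then have "D F z v = R31_proj (D F z v)"
    using frechet_derivative_eqI by metis
  then show ?thesis
    using R31_proj(1) by metis
qed

text \<open>Lorentzian Gram-Schmidt applied to two constant coordinate directions that are
  orthonormal at \<open>x0\<close>; the inequalities it needs are open and hold at
  \<open>x0\<close>. The resulting pair is lifted, and inner products with it give the
  coframe.\<close>

lemma local_adapted_frame:
  assumes U: "open U" "x0 \<in> U" and F: "timelike_immersion_on U F"
  obtains N g \<omega>1 \<omega>2 where "x0 \<in> N" "N \<subseteq> U" "adapted_frame N g \<omega>1 \<omega>2 F"
proof -
  have FR: "F ` U \<subseteq> R31" and smF: "smooth_on U F"
    using F by (auto simp: timelike_immersion_on_def)
  define \<gamma> where "\<gamma> z v w = mink (D F z v) (D F z w)" for z v w
  have lin: "linear (D F z)" if "z \<in> U" for z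
    by (rule linear_frechet_derivative[OF smooth_on_differentiable[OF smF that]])
  have DR: "D F z v \<in> R31" if "z \<in> U" for z v
    by (rule R31_derivative[OF U(1) that FR smooth_on_differentiable[OF smF that]])
  interpret m: bounded_bilinear mink by (rule bounded_bilinear_mink)
  have neg: "D F x0 (- v) = - D F x0 v" for v
    using linear_neg[OF lin[OF U(2)]] .
  \<comment> \<open>A unit timelike vector has nonzero time coordinate, so one of \<open>v'\<close>
    and \<open>- v'\<close> is future-pointing, as the boost lift demands. The sign of the second
    vector is then chosen for the rotation lift.\<close>
  obtain v where v: "\<gamma> x0 v v = -1" "Im (D F x0 v $ 1) > 0" and ex: "\<exists>w. \<gamma> x0 w w = 1 \<and> \<gamma> x0 v w = 0"
  proof -
    obtain v' w' where vw: "\<gamma> x0 v' v' = -1" "\<gamma> x0 w' w' = 1" "\<gamma> x0 v' w' = 0"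
      using F U(2) by (auto simp: timelike_immersion_on_def induced_metric_def \<gamma>_def)
    obtain a b c d where r: "D F x0 v' = r31 a b c d"
      using DR[OF U(2)] by (rule R31_cases)
    have "a * a = 1 + b * b + c * c + d * d"
      using vw(1) by (simp add: \<gamma>_def r mink_def qH_r31)
    moreover have "b * b \<ge> 0" "c * c \<ge> 0" "d * d \<ge> 0" by simp_all
    ultimately have "a \<noteq> 0" by (metis add_nonneg_nonneg add_pos_nonneg less_irrefl mult_zero_left zero_less_one)
    then consider "a > 0" | "- a > 0" by linarith
    then show ?thesis
    proof cases
      case 1
      then show ?thesis using that[of v'] vw by (auto simp: r r31_nth)
    next
      case 2
      then show ?thesis
        using that[of "- v'"] vw by (auto simp: \<gamma>_def neg m.minus_left m.minus_right r r31_nth)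
    qed
  qed
  obtain w where w: "\<gamma> x0 w w = 1" "\<gamma> x0 v w = 0"
    "Re (lorentz (qconj (boost_lift (D F x0 v))) (D F x0 w) $ 2) \<ge> 0"
  proof -
    obtain w' where w': "\<gamma> x0 w' w' = 1" "\<gamma> x0 v w' = 0" using ex by blast
    consider "Re (lorentz (qconj (boost_lift (D F x0 v))) (D F x0 w') $ 2) \<ge> 0"
      | "- Re (lorentz (qconj (boost_lift (D F x0 v))) (D F x0 w') $ 2) \<ge> 0" by linarith
    then show ?thesis
    proof cases
      case 1
      then show ?thesis using that[of w'] w' by blast
    next
      case 2
      then show ?thesis
        using that[of "- w'"] w' by (auto simp: \<gamma>_def neg m.minus_left m.minus_right lorentz_linear)
    qed
  qed
  have sm\<gamma>: "smooth_on U (\<lambda>z. \<gamma> z a b)" for a b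
    unfolding \<gamma>_def by (intro smooth_on_bilinear[OF bounded_bilinear_mink] smooth_on_frechet smF U(1))
  define U1 where "U1 = {z \<in> U. - \<gamma> z v v > 0}"
  have U1: "open U1" "x0 \<in> U1" "U1 \<subseteq> U"
  proof -
    show "open U1"
      unfolding U1_def by (intro smooth_on_open_superlevel smooth_on_minus sm\<gamma> U(1))
  qed (use U v in \<open>auto simp: U1_def\<close>)
  note sm\<gamma>1 = smooth_on_subset[OF sm\<gamma> U1(3)]
  have nz1: "- \<gamma> z v v \<noteq> 0" if "z \<in> U1" for z using that by (simp add: U1_def)
  \<comment> \<open>The coefficient that makes \<open>w + t v\<close> orthogonal to
    \<open>v\<close>; the squared length of that combination is \<open>n\<close> below.\<close>
  define t where "t z = \<gamma> z v w / (- \<gamma> z v v)" for z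
  have smt: "smooth_on U1 t"
    unfolding t_def[abs_def] by (intro smooth_on_divide_real smooth_on_minus sm\<gamma>1 nz1 U1(1); assumption)
  define n where "n z = \<gamma> z w w + t z * \<gamma> z v w" for z
  have smn: "smooth_on U1 n"
    unfolding n_def[abs_def] by (intro smooth_on_add smooth_on_mult smt sm\<gamma>1 U1(1))
  define U2 where "U2 = {z \<in> U1. n z > 0}"
  have t0: "t x0 = 0" and n0: "n x0 = 1"
    using w by (simp_all add: t_def n_def)
  have U2: "open U2" "x0 \<in> U2" "U2 \<subseteq> U1"
  proof -
    show "open U2"
      unfolding U2_def by (intro smooth_on_open_superlevel smn U1(1))
  qed (use U1 n0 in \<open>auto simp: U2_def\<close>)
  have U2U: "U2 \<subseteq> U" using U2(3) U1(3) by blast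
  have pos1: "- \<gamma> z v v > 0" and pos2: "n z > 0" if "z \<in> U2" for z
    using that by (auto simp: U2_def U1_def)
  note sm2 = smooth_on_subset[OF smt U2(3)] smooth_on_subset[OF smn U2(3)] smooth_on_subset[OF sm\<gamma> U2U]
    smooth_on_subset[OF smooth_on_frechet[OF smF] U2U]
  define a c where "a z = 1 / sqrt (- \<gamma> z v v)" and "c z = 1 / sqrt (n z)" for z
  have smac: "smooth_on U2 a" "smooth_on U2 c"
    unfolding a_def[abs_def] c_def[abs_def]
    by (rule smooth_on_divide_real[OF U2(1) _ smooth_on_const smooth_on_sqrt[OF U2(1) pos1 smooth_on_minus[OF U2(1) sm2(3)]]]
          smooth_on_divide_real[OF U2(1) _ smooth_on_const smooth_on_sqrt[OF U2(1) pos2 sm2(2)]];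
        use pos1 pos2 in \<open>force simp: less_le\<close>)+
  have a2: "a z * a z * (- \<gamma> z v v) = 1" and c2: "c z * c z * n z = 1" and ac: "a z \<noteq> 0" "c z \<noteq> 0"
    if "z \<in> U2" for z
    using pos1[OF that] pos2[OF that] by (simp_all add: a_def c_def)
  define E1 E2 where "E1 z = D F z (a z *\<^sub>R v)" and "E2 z = D F z (c z *\<^sub>R (w + t z *\<^sub>R v))" for z
  have E1: "E1 z = a z *\<^sub>R D F z v" and E2: "E2 z = c z *\<^sub>R (D F z w + t z *\<^sub>R D F z v)" if "z \<in> U2" for z
    using lin[of z] U2U that by (auto simp: E1_def E2_def linear_add linear_cmul)
  have E1': "smooth_on U2 E1" and E2': "smooth_on U2 E2"
  proof -
    have "smooth_on U2 (\<lambda>z. a z *\<^sub>R D F z v)" "smooth_on U2 (\<lambda>z. c z *\<^sub>R (D F z w + t z *\<^sub>R D F z v))"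
      by (intro smooth_on_scaleR smooth_on_add smac sm2 U2(1))+
    then show "smooth_on U2 E1" "smooth_on U2 E2"
      by (auto intro: smooth_on_cong[OF U2(1)] simp: E1 E2)
  qed
  have on: "mink (E1 z) (E1 z) = -1" "mink (E2 z) (E2 z) = 1" "mink (E1 z) (E2 z) = 0" if z: "z \<in> U2" for z
  proof -
    have t: "t z * (- \<gamma> z v v) = \<gamma> z v w" using pos1[OF z] by (simp add: t_def)
    have sym: "mink (D F z w) (D F z v) = \<gamma> z v w" by (simp add: \<gamma>_def mink_def qH_commute)
    have "mink (E1 z) (E1 z) = - (a z * a z * (- \<gamma> z v v))"
      by (simp add: E1[OF z] m.scaleR_left m.scaleR_right \<gamma>_def)
    then show "mink (E1 z) (E1 z) = -1" using a2[OF z] by simp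
    have "mink (E1 z) (E2 z) = a z * c z * (\<gamma> z v w - t z * (- \<gamma> z v v))"
      by (simp add: E1[OF z] E2[OF z] m.scaleR_left m.scaleR_right m.add_right \<gamma>_def algebra_simps)
    then show "mink (E1 z) (E2 z) = 0" using t by simp
    have "mink (E2 z) (E2 z) = c z * c z * (\<gamma> z w w + t z * \<gamma> z v w + t z * (\<gamma> z v w - t z * (- \<gamma> z v v)))"
      by (simp add: E2[OF z] m.scaleR_left m.scaleR_right m.add_right m.add_left sym)
         (simp add: \<gamma>_def algebra_simps)
    then have "mink (E2 z) (E2 z) = c z * c z * n z"
      unfolding t by (simp add: n_def)
    then show "mink (E2 z) (E2 z) = 1" using c2[OF z] by simp
  qed
  have x0: "E1 x0 = D F x0 v" "E2 x0 = D F x0 w"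
    using v w t0 n0 U2(2) by (simp_all add: E1 E2 a_def c_def)
  obtain N g where N: "open N" "x0 \<in> N" "N \<subseteq> U2" "g ` N \<subseteq> Spin31" "smooth_on N g"
    and lg: "\<And>u. u \<in> N \<Longrightarrow> lorentz (g u) (r31 1 0 0 0) = E1 u"
      "\<And>u. u \<in> N \<Longrightarrow> lorentz (g u) (r31 0 1 0 0) = E2 u"
    using lift_orthonormal_pair[OF U2(1,2) _ _ E1' E2' on] v(2) w(3) DR U2U
    by (smt (verit, best) x0 E1_def E2_def image_subset_iff subsetD)
  \<comment> \<open>The minus sign in \<open>\<omega>1\<close> compensates the squared length -1 of
    \<open>E1\<close>, so that both forms extract coordinates.\<close>
  define \<omega>1 \<omega>2 where "\<omega>1 z x = - mink (D F z x) (E1 z)" and "\<omega>2 z x = mink (D F z x) (E2 z)" for z x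
  have NU: "N \<subseteq> U" using N(3) U2U by blast
  have linw: "linear (\<omega>1 z)" "linear (\<omega>2 z)" if "z \<in> N" for z
    using lin[of z] NU that by (auto simp: \<omega>1_def \<omega>2_def linear_iff m.add_left m.scaleR_left)
  have smw: "smooth_on N (\<lambda>z. \<omega>1 z x)" "smooth_on N (\<lambda>z. \<omega>2 z x)" for x
    unfolding \<omega>1_def \<omega>2_def
    by (intro smooth_on_minus smooth_on_bilinear[OF bounded_bilinear_mink] smooth_on_subset[OF smooth_on_frechet[OF smF] NU]
          smooth_on_subset[OF E1' N(3)] smooth_on_subset[OF E2' N(3)] N(1))+
  have dual: "\<omega>1 z (a z *\<^sub>R v) = 1" "\<omega>1 z (c z *\<^sub>R (w + t z *\<^sub>R v)) = 0"
    "\<omega>2 z (a z *\<^sub>R v) = 0" "\<omega>2 z (c z *\<^sub>R (w + t z *\<^sub>R v)) = 1" if "z \<in> N" for z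
    using on[of z] that N(3) by (auto simp: \<omega>1_def \<omega>2_def E1_def[symmetric] E2_def[symmetric] mink_def qH_commute)
  have area: "(\<omega>1 z 1 * \<omega>2 z \<i> - \<omega>1 z \<i> * \<omega>2 z 1) * Im (cnj (a z *\<^sub>R v) * (c z *\<^sub>R (w + t z *\<^sub>R v))) = 1"
    if "z \<in> N" for z
    using linear_area[OF linw[OF that], of "a z *\<^sub>R v" "c z *\<^sub>R (w + t z *\<^sub>R v)"] dual[OF that] by simp
  have area': "\<omega>1 z 1 * \<omega>2 z \<i> - \<omega>1 z \<i> * \<omega>2 z 1 \<noteq> 0" if "z \<in> N" for z
    using area[OF that] by (metis mult_zero_left zero_neq_one)
  have indep: "Im (cnj (a z *\<^sub>R v) * (c z *\<^sub>R (w + t z *\<^sub>R v))) \<noteq> 0" if "z \<in> N" for z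
    using area[OF that] by (metis mult_zero_right zero_neq_one)
  have "adapted_frame N g \<omega>1 \<omega>2 F"
  proof (intro adapted_frame.intro spin_coframe.intro spin_lift.intro spin_coframe_axioms.intro adapted_frame_axioms.intro)
    show "\<omega>1 z 1 * \<omega>2 z \<i> - \<omega>1 z \<i> * \<omega>2 z 1 \<noteq> 0" if "z \<in> N" for z
      by (rule area'[OF that])
    show "F ` N \<subseteq> R31" using FR NU by blast
    show "(F has_derivative spin_coframe.\<xi> g \<omega>1 \<omega>2 z) (at z)" if z: "z \<in> N" for z
    proof -
      interpret sc: spin_coframe N g \<omega>1 \<omega>2
        by (intro spin_coframe.intro spin_lift.intro spin_coframe_axioms.intro N linw smw area')
      have "D F z x = sc.\<xi> z x" for x
      proof -
        define e1 e2 where "e1 = a z *\<^sub>R v" and "e2 = c z *\<^sub>R (w + t z *\<^sub>R v)"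
        have "Im (cnj e1 * e2) \<noteq> 0"
          unfolding e1_def e2_def by (rule indep[OF z])
        from cramer_complex[OF this, of x] obtain p q where x: "x = p *\<^sub>R e1 + q *\<^sub>R e2" by blast
        have w: "\<omega>1 z x = p" "\<omega>2 z x = q"
          unfolding x using dual[OF z] linw[OF z] by (simp_all add: linear_add linear_cmul e1_def[symmetric] e2_def[symmetric])
        have zU: "z \<in> U" using z NU by blast
        have "D F z x = p *\<^sub>R E1 z + q *\<^sub>R E2 z"
          unfolding x using lin[OF zU] by (simp add: linear_add linear_cmul E1_def E2_def e1_def e2_def)
        also have "\<dots> = lorentz (g z) (p *\<^sub>R r31 1 0 0 0 + q *\<^sub>R r31 0 1 0 0)"
          unfolding lg(1)[OF z, symmetric] lg(2)[OF z, symmetric] by (simp add: lorentz_linear)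
        finally show ?thesis
          by (simp add: sc.\<xi>_def w r31_scaleR r31_add)
      qed
      then have "D F z = sc.\<xi> z"
        by (rule ext)
      moreover have "(F has_derivative D F z) (at z)"
        using z NU by (intro smooth_on_has_derivative[OF smF]) auto
      ultimately show ?thesis
        by simp
    qed
  qed (use N linw smw in \<open>(assumption | simp)+\<close>)
  with N NU show ?thesis using that by blast
qed

lemma adapted_frameI:
  assumes "open U" "g ` U \<subseteq> Spin31" "smooth_on U g"
    and "\<And>z. z \<in> U \<Longrightarrow> linear (\<omega>1 z)" "\<And>z. z \<in> U \<Longrightarrow> linear (\<omega>2 z)"
    and "\<And>v. smooth_on U (\<lambda>z. \<omega>1 z v)" "\<And>v. smooth_on U (\<lambda>z. \<omega>2 z v)"
    and "\<And>z. z \<in> U \<Longrightarrow> \<omega>1 z 1 * \<omega>2 z \<i> - \<omega>1 z \<i> * \<omega>2 z 1 \<noteq> 0"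
    and "F ` U \<subseteq> R31"
    and "\<And>z. z \<in> U \<Longrightarrow> (F has_derivative (\<lambda>v. lorentz (g z) (r31 (\<omega>1 z v) (\<omega>2 z v) 0 0))) (at z)"
  shows "adapted_frame U g \<omega>1 \<omega>2 F"
proof -
  interpret spin_coframe U g \<omega>1 \<omega>2
    by (intro spin_coframe.intro spin_lift.intro spin_coframe_axioms.intro assms)
  show ?thesis
    using assms(10)
    by (intro adapted_frame.intro adapted_frame_axioms.intro spin_coframe_axioms assms(9))
       (simp add: \<xi>_def[abs_def])
qed

section \<open>Changes of coordinates and of the frame\<close>

context adapted_frame
begin

lemma has_derivative_F: "z \<in> U \<Longrightarrow> (F has_derivative (\<lambda>v. lorentz (g z) (r31 (\<omega>1 z v) (\<omega>2 z v) 0 0))) (at z)"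
  using dF by (simp add: \<xi>_def[abs_def])

text \<open>All data are functions and one-forms, hence pull back along \<open>h\<close>;
  bijectivity of \<open>D h y\<close> keeps the coframe independent. The direction
  \<open>D h y v\<close> varies with the point, so smoothness is checked after expansion on 1 and
  \<open>\<i>\<close>.\<close>

lemma change_coordinates:
  assumes V: "open V" "h ` V \<subseteq> U" "smooth_on V h" "\<And>y. y \<in> V \<Longrightarrow> bij (D h y)"
  shows "adapted_frame V (\<lambda>y. g (h y)) (\<lambda>y v. \<omega>1 (h y) (D h y v)) (\<lambda>y v. \<omega>2 (h y) (D h y v)) (\<lambda>y. F (h y))"
    and "y \<in> V \<Longrightarrow> maurer_cartan (\<lambda>y. g (h y)) y v = \<eta> (h y) (D h y v)"
proof -
  have hU: "h y \<in> U" if "y \<in> V" for y using V(2) that by blast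
  have dh: "(h has_derivative D h y) (at y)" if "y \<in> V" for y
    by (rule smooth_on_has_derivative[OF V(3) that])
  have lin_h: "linear (D h y)" if "y \<in> V" for y
    using dh[OF that] by (rule has_derivative_linear)
  have lin': "linear (\<lambda>v. \<omega>1 (h y) (D h y v))" "linear (\<lambda>v. \<omega>2 (h y) (D h y v))" if "y \<in> V" for y
    using linear_compose[OF lin_h[OF that]] lin[OF hU[OF that]] by (auto simp: o_def)
  show "adapted_frame V (\<lambda>y. g (h y)) (\<lambda>y v. \<omega>1 (h y) (D h y v)) (\<lambda>y v. \<omega>2 (h y) (D h y v)) (\<lambda>y. F (h y))"
  proof (rule adapted_frameI)
    show "(\<lambda>y. g (h y)) ` V \<subseteq> Spin31" using g hU by blast
    show "smooth_on V (\<lambda>y. g (h y))" by (rule smooth_on_compose[OF V(1) U V(2,3) sm_g])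
    have c: "smooth_on V (\<lambda>y. \<omega>1 (h y) v)" "smooth_on V (\<lambda>y. \<omega>2 (h y) v)" for v
      by (rule smooth_on_compose[OF V(1) U V(2,3) sm(1)], rule smooth_on_compose[OF V(1) U V(2,3) sm(2)])
    have s: "smooth_on V (\<lambda>y. Re (D h y v) * \<omega>1 (h y) 1 + Im (D h y v) * \<omega>1 (h y) \<i>)"
      "smooth_on V (\<lambda>y. Re (D h y v) * \<omega>2 (h y) 1 + Im (D h y v) * \<omega>2 (h y) \<i>)" for v
      by (intro smooth_on_add smooth_on_mult smooth_on_Re smooth_on_Im smooth_on_frechet V c)+
    show "smooth_on V (\<lambda>y. \<omega>1 (h y) (D h y v))" for v
      by (rule smooth_on_cong[OF V(1) _ s(1)]) (rule omega_expand(1)[OF hU, symmetric])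
    show "smooth_on V (\<lambda>y. \<omega>2 (h y) (D h y v))" for v
      by (rule smooth_on_cong[OF V(1) _ s(2)]) (rule omega_expand(2)[OF hU, symmetric])
    show "\<omega>1 (h y) (D h y 1) * \<omega>2 (h y) (D h y \<i>) - \<omega>1 (h y) (D h y \<i>) * \<omega>2 (h y) (D h y 1) \<noteq> 0" if y: "y \<in> V" for y
    proof -
      obtain u v where uv: "D h y u = e1 (h y)" "D h y v = e2 (h y)"
        using V(4)[OF y] by (metis bij_pointE)
      from linear_area[OF lin'[OF y], of u v] show ?thesis
        by (auto simp: uv dual_frame[OF hU[OF y]])
    qed
    show "(\<lambda>y. F (h y)) ` V \<subseteq> R31" using F hU by blast
    show "((\<lambda>y. F (h y)) has_derivative
        (\<lambda>v. lorentz (g (h y)) (r31 (\<omega>1 (h y) (D h y v)) (\<omega>2 (h y) (D h y v)) 0 0))) (at y)" if "y \<in> V" for y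
      by (rule has_derivative_compose[OF dh[OF that] has_derivative_F[OF hU[OF that]]])
  qed (use V lin' in auto)
  show "maurer_cartan (\<lambda>y. g (h y)) y v = \<eta> (h y) (D h y v)" if "y \<in> V"
    using frechet_derivative_eqI[OF has_derivative_compose[OF dh[OF that] smooth_on_has_derivative[OF sm_g hU[OF that]]]]
    by (simp add: maurer_cartan_def)
qed

lemma restrict:
  assumes "open V" "V \<subseteq> U"
  shows "adapted_frame V g \<omega>1 \<omega>2 F"
  using change_coordinates(1)[OF assms(1), of "\<lambda>x. x"] assms(2)
  by (simp add: smooth_on_linear bounded_linear_ident bij_def)

text \<open>Left multiplication by \<open>cos \<tau> + sin \<tau> I\<close>, \<open>\<tau>\<close> complex, boosts the tangent plane and rotates
  the normal plane.\<close>

lemma rotate: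
  fixes \<tau> :: "complex \<Rightarrow> complex"
  assumes \<tau>: "\<And>z. z \<in> U \<Longrightarrow> (\<tau> has_derivative (\<lambda>v. - (\<eta> z v $ 2))) (at z)"
  obtains g' \<omega>1' \<omega>2' where "adapted_frame U g' \<omega>1' \<omega>2' F"
    "\<And>z v. z \<in> U \<Longrightarrow> maurer_cartan g' z v $ 2 = 0"
proof -
  have sm\<tau>: "smooth_on U \<tau>"
  proof (rule smooth_onI_derivative[OF U \<tau>])
    show "smooth_on U (\<lambda>z. - (\<eta> z v $ 2))" for v
      by (intro smooth_on_minus smooth_eta_nth U)
  qed
  define c s where "c z = cos (\<tau> z)" and "s z = sin (\<tau> z)" for z
  have smc: "smooth_on U c" "smooth_on U s"
    unfolding c_def[abs_def] s_def[abs_def] by (intro smooth_on_cos smooth_on_sin sm\<tau> U)+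
  have cs: "c z * c z + s z * s z = 1" for z
    using sin_cos_squared_add3[of "\<tau> z"] by (simp add: c_def s_def)
  define r where "r z = c z *s qone + s z *s qI" for z
  have r_nth: "r z $ 1 = c z" "r z $ 2 = s z" "r z $ 3 = 0" "r z $ 4 = 0" for z
    by (simp_all add: r_def cquat_nth)
  have rS: "r z \<in> Spin31" for z
    using cs[of z] by (simp add: Spin31_def qH_def sum_4 r_nth)
  have smr: "smooth_on U r"
    unfolding r_def[abs_def]
    by (intro smooth_on_add smooth_on_bilinear[OF bounded_bilinear_smult] smc smooth_on_const U)
  \<comment> \<open>These are the hyperbolic cosine and sine of twice the imaginary part of \<tau>.
    The polynomial form lets \<open>chsh\<close> follow from
    \<open>c\<^sup>2 + s\<^sup>2 = 1\<close> alone.\<close>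
  define ch sh where "ch z = Re (c z * cnj (c z) + s z * cnj (s z))" and "sh z = - 2 * Im (c z * cnj (s z))" for z
  have smch: "smooth_on U ch" "smooth_on U sh"
    unfolding ch_def[abs_def] sh_def[abs_def]
    by (intro smooth_on_Re smooth_on_Im smooth_on_mult smooth_on_add smooth_on_cnj smc smooth_on_const U)+
  have chsh: "ch z * ch z - sh z * sh z = 1" for z
  proof -
    define p q where "p = c z" and "q = s z"
    have "Re (p * p + q * q) = 1" "Im (p * p + q * q) = 0"
      using cs[of z] by (simp_all add: p_def q_def del: times_complex.sel plus_complex.sel)
    then have 1: "Re p * Re p - Im p * Im p + (Re q * Re q - Im q * Im q) = 1"
      and "2 * (Im p * Re p) + 2 * (Im q * Re q) = 0"
      by simp_all
    then have 2: "Im p * Re p + Im q * Re q = 0"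
      by linarith
    have "ch z * ch z - sh z * sh z = (Re p * Re p - Im p * Im p + (Re q * Re q - Im q * Im q))\<^sup>2
        + 4 * (Im p * Re p + Im q * Re q)\<^sup>2"
      by (simp add: ch_def sh_def p_def[symmetric] q_def[symmetric] power2_eq_square algebra_simps)
    then show ?thesis by (simp add: 1 2)
  qed
  \<comment> \<open>The coframe undergoes the boost inverse to that of the frame, so the tangent
    vectors, and with them the differential of \<open>F\<close>, are unchanged.\<close>
  define g' \<omega>1' \<omega>2' where "g' z = r z \<odot> g z"
    and "\<omega>1' z v = ch z * \<omega>1 z v - sh z * \<omega>2 z v" and "\<omega>2' z v = ch z * \<omega>2 z v - sh z * \<omega>1 z v" for z v
  have lr: "lorentz (r z) (r31 a b 0 0) = r31 (a * ch z + b * sh z) (b * ch z + a * sh z) 0 0" for a b z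
    by (simp add: lorentz_def vec_eq_iff forall_4 cquat_nth r_nth r31_nth complex_eq_iff ch_def sh_def algebra_simps)
  have "adapted_frame U g' \<omega>1' \<omega>2' F"
  proof (rule adapted_frameI)
    show "g' ` U \<subseteq> Spin31" using rS gS by (auto simp: g'_def intro!: Spin31_qmult)
    show "smooth_on U g'"
      unfolding g'_def[abs_def] by (intro smooth_on_bilinear[OF bounded_bilinear_qmult] smr sm_g U)
    show "linear (\<omega>1' z)" "linear (\<omega>2' z)" if "z \<in> U" for z
      using lin[OF that] by (simp_all add: \<omega>1'_def \<omega>2'_def linear_iff algebra_simps)
    show "smooth_on U (\<lambda>z. \<omega>1' z v)" "smooth_on U (\<lambda>z. \<omega>2' z v)" for v
      unfolding \<omega>1'_def \<omega>2'_def by (intro smooth_on_diff smooth_on_mult smch sm U)+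
    show "\<omega>1' z 1 * \<omega>2' z \<i> - \<omega>1' z \<i> * \<omega>2' z 1 \<noteq> 0" if "z \<in> U" for z
    proof -
      have "\<omega>1' z 1 * \<omega>2' z \<i> - \<omega>1' z \<i> * \<omega>2' z 1
          = (ch z * ch z - sh z * sh z) * (\<omega>1 z 1 * \<omega>2 z \<i> - \<omega>1 z \<i> * \<omega>2 z 1)"
        unfolding \<omega>1'_def \<omega>2'_def by (simp add: algebra_simps)
      then show ?thesis using area[OF that] by (simp add: chsh)
    qed
    show "(F has_derivative (\<lambda>v. lorentz (g' z) (r31 (\<omega>1' z v) (\<omega>2' z v) 0 0))) (at z)" if z: "z \<in> U" for z
    proof -
      have "\<omega>1' z v * ch z + \<omega>2' z v * sh z = (ch z * ch z - sh z * sh z) * \<omega>1 z v"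
        "\<omega>2' z v * ch z + \<omega>1' z v * sh z = (ch z * ch z - sh z * sh z) * \<omega>2 z v" for v
        unfolding \<omega>1'_def \<omega>2'_def by (simp_all add: algebra_simps)
      then have "lorentz (g' z) (r31 (\<omega>1' z v) (\<omega>2' z v) 0 0) = lorentz (g z) (r31 (\<omega>1 z v) (\<omega>2 z v) 0 0)" for v
        unfolding g'_def lorentz_lorentz[symmetric] lr by (simp add: chsh)
      then show ?thesis using has_derivative_F[OF z] by simp
    qed
  qed (rule U F)+
  moreover have "maurer_cartan g' z v $ 2 = 0" if z: "z \<in> U" for z v
  proof -
    define k where "k v = - (\<eta> z v $ 2)" for v
    have "(\<tau> has_derivative k) (at z)"
      using \<tau>[OF z] by (simp add: k_def[abs_def])
    then have dcs: "(c has_derivative (\<lambda>v. - s z * k v)) (at z)" "(s has_derivative (\<lambda>v. c z * k v)) (at z)"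
      using has_derivative_compose[of \<tau> k z UNIV cos "(*) (- sin (\<tau> z))"]
        has_derivative_compose[of \<tau> k z UNIV sin "(*) (cos (\<tau> z))"]
        DERIV_cos[of "\<tau> z"] DERIV_sin[of "\<tau> z"]
      by (simp_all add: has_field_derivative_def c_def[abs_def] s_def[abs_def])
    have dr: "(r has_derivative (\<lambda>v. (- s z * k v) *s qone + (c z * k v) *s qI)) (at z)"
      unfolding r_def[abs_def]
      by (intro has_derivative_add bounded_linear.has_derivative[OF bounded_bilinear.bounded_linear_left[OF bounded_bilinear_smult]] dcs)
    have "D g' z v = r z \<odot> D g z v + ((- s z * k v) *s qone + (c z * k v) *s qI) \<odot> g z"
      unfolding g'_def[abs_def]
      by (rule fun_cong[OF frechet_derivative_eqI, OF bounded_bilinear.FDERIV[OF bounded_bilinear_qmult dr smooth_on_has_derivative[OF sm_g z]]])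
    also have "\<dots> = (r z \<odot> \<eta> z v + ((- s z * k v) *s qone + (c z * k v) *s qI)) \<odot> g z"
      by (simp add: D_g[OF z] qmult_assoc qmult_bilinear)
    finally have "maurer_cartan g' z v
        = (r z \<odot> \<eta> z v + ((- s z * k v) *s qone + (c z * k v) *s qI)) \<odot> (g z \<odot> qconj (g z)) \<odot> qconj (r z)"
      by (simp add: maurer_cartan_def g'_def qconj_qmult qmult_assoc)
    then have "maurer_cartan g' z v = (r z \<odot> \<eta> z v + ((- s z * k v) *s qone + (c z * k v) *s qI)) \<odot> qconj (r z)"
      using Spin31_qconj(1)[OF gS[OF z]] by (simp add: quaternion_relations)
    \<comment> \<open>The rotation adds \<open>k\<close>, the differential of \<tau>, to the
      I-component; by the choice of \<tau> the sum is zero.\<close>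
    then have "maurer_cartan g' z v $ 2 = (c z * c z + s z * s z) * (\<eta> z v $ 2 + k v)"
      by (simp add: cquat_nth r_nth eta_1[OF z] algebra_simps)
    then show ?thesis by (simp add: k_def)
  qed
  ultimately show ?thesis using that by blast
qed

text \<open>Vanishing of both curvatures is the closedness of the complex form \<open>\<eta> $ 2\<close>.\<close>

lemma flat_imp_closed:
  assumes K: "\<And>z. z \<in> U \<Longrightarrow> gauss_curvature (induced_metric F) z = 0" and KN: "normal_curvature_vanishes_on U F"
    and z: "z \<in> U"
  shows "D (\<lambda>u. \<eta> u x $ 2) z v = D (\<lambda>u. \<eta> u v $ 2) z x"
proof -
  define A where "A = D (\<lambda>u. \<eta> u \<i> $ 2) z 1 - D (\<lambda>u. \<eta> u 1 $ 2) z \<i>"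
  have "Im A = 0"
    using K[OF z] w_nz[OF z] unfolding gauss_curvature_eq[OF z] A_def[symmetric] by simp
  moreover have "Re A = 0"
  proof -
    \<comment> \<open>One test frame suffices: for the images of J and K the pairing factor in the
      curvature formula is 1, so vanishing of the curvature says that the real part of
      \<open>A\<close> is zero.\<close>
    define n1 n2 where "n1 u = lorentz (g u) (r31 0 0 1 0)" and "n2 u = lorentz (g u) (r31 0 0 0 1)" for u
    have "orthonormal_normal_frame_on U F n1 n2"
      unfolding orthonormal_normal_frame_on_def
      by (auto simp: n1_def[abs_def] n2_def[abs_def] mink_lorentz gS D_F \<xi>_def
           intro!: smooth_on_lorentz smooth_on_const sm_g U lorentz_in_R31 r31_in_R31)
    then have "normal_curvature F n1 n2 z = 0"
      using KN U z by (auto simp: normal_curvature_vanishes_on_def)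
    moreover have "normal_curvature F n1 n2 z = 2 * Re A * (1 * 1 - 0 * 0) / \<bar>w z\<bar>"
      unfolding A_def
      by (rule normal_curvature_eq[OF U order_refl z]) (auto simp: n1_def n2_def smooth_on_const)
    ultimately show ?thesis using w_nz[OF z] by simp
  qed
  ultimately have A: "A = 0" by (simp add: complex_eq_iff)
  have "D (\<lambda>u. \<eta> u x $ 2) z v - D (\<lambda>u. \<eta> u v $ 2) z x = Im (cnj v * x) *\<^sub>R A"
    unfolding A_def by (rule exterior_derivative_plane[OF U z linear_eta_nth smooth_eta_nth])
  then show ?thesis by (simp add: A)
qed

text \<open>The sign of \<open>w\<close> is locally constant, so only the conjugation of
  \<open>\<i> *s qI\<close> by \<open>g\<close> is differentiated, giving a commutator with the
  Maurer-Cartan form. A form with components only along J and K anticommutes with I, which doubles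
  the product.\<close>

lemma D_gauss_map:
  assumes z: "z \<in> U" and eta2: "\<And>v. \<eta> z v $ 2 = 0"
  shows "D (gauss_map F) z v = (of_real (sgn (w z)) * (2 * \<i>)) *s (qconj (g z) \<odot> (qI \<odot> \<eta> z v) \<odot> g z)"
proof -
  define P where "P = \<i> *s qI"
  have smw: "smooth_on U w"
    unfolding w_def[abs_def] by (intro smooth_on_diff smooth_on_mult sm U)
  have "open {u \<in> U. w u > 0}" "open {u \<in> U. - w u > 0}"
    by (intro smooth_on_open_superlevel smooth_on_minus smw U)+
  moreover have "{u \<in> U. sgn (w u) = sgn (w z)} = (if w z > 0 then {u \<in> U. w u > 0} else {u \<in> U. - w u > 0})"
    using w_nz[OF z] by (auto simp: sgn_if w_nz split: if_splits) (metis w_nz linorder_neqE_linordered_idom)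
  ultimately have V: "open {u \<in> U. sgn (w u) = sgn (w z)}"
    by simp
  have "((\<lambda>u. of_real (sgn (w z)) *s (qconj (g u) \<odot> P \<odot> g u)) has_derivative
     (\<lambda>v. of_real (sgn (w z)) *s (qconj (g z) \<odot> P \<odot> D g z v + qconj (D g z v) \<odot> P \<odot> g z))) (at z)"
    by (intro bounded_linear.has_derivative[OF bounded_bilinear.bounded_linear_right[OF bounded_bilinear_smult]]
         bounded_bilinear.FDERIV[OF bounded_bilinear_qmult]
         bounded_linear.has_derivative[OF bounded_bilinear.bounded_linear_left[OF bounded_bilinear_qmult]]
         bounded_linear.has_derivative[OF bounded_linear_qconj] smooth_on_has_derivative[OF sm_g z])
  then have dG: "(gauss_map F has_derivative
     (\<lambda>v. of_real (sgn (w z)) *s (qconj (g z) \<odot> P \<odot> D g z v + qconj (D g z v) \<odot> P \<odot> g z))) (at z)"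
    by (rule has_derivative_transform_within_open[OF _ V]) (use z in \<open>auto simp: gauss_map_eq P_def\<close>)
  have 1: "qconj (g z) \<odot> P \<odot> D g z v + qconj (D g z v) \<odot> P \<odot> g z
      = qconj (g z) \<odot> (P \<odot> \<eta> z v - \<eta> z v \<odot> P) \<odot> g z"
    unfolding qconj_D_g[OF z] unfolding D_g[OF z]
    by (simp add: qmult_assoc bounded_bilinear.minus_left[OF bounded_bilinear_qmult]
          bounded_bilinear.diff_left[OF bounded_bilinear_qmult] bounded_bilinear.diff_right[OF bounded_bilinear_qmult])
  have 2: "P \<odot> \<eta> z v - \<eta> z v \<odot> P = (2 * \<i>) *s (qI \<odot> \<eta> z v)"
    using eta_1[OF z, of v] eta2[of v] by (simp add: P_def vec_eq_iff forall_4 cquat_nth)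
  show ?thesis
    unfolding frechet_derivative_eqI[OF dG] 1 2 qmult_bilinear by simp
qed

end

section \<open>From the surface to the representation data\<close>

locale flat_frame = adapted_frame +
  assumes eta_2: "z \<in> U \<Longrightarrow> \<eta> z v $ 2 = 0"
begin

lemma omega_closed:
  assumes "z \<in> U"
  shows "D (\<lambda>u. \<omega>1 u x) z v = D (\<lambda>u. \<omega>1 u v) z x" "D (\<lambda>u. \<omega>2 u x) z v = D (\<lambda>u. \<omega>2 u v) z x"
  using structure_equations[OF assms assms, of x v] by (simp_all add: eta_2[OF assms])

text \<open>Symmetry on the dual frame, one relation per normal direction: the source of the real
  functions \<open>h1\<close> and \<open>h2\<close>.\<close>

lemma second_fundamental_form:
  assumes z: "z \<in> U"
  shows "Re (\<eta> z (e1 z) $ 3) = Im (\<eta> z (e2 z) $ 4)" "Im (\<eta> z (e2 z) $ 3) = - Re (\<eta> z (e1 z) $ 4)"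
  using structure_equations[OF z z, of "e2 z" "e1 z"] by (simp_all add: dual_frame[OF z])

text \<open>Products of elements in the span of J and K lie in the span of 1 and I. The commutator
  therefore contributes nothing to the J- and K-components, and its I-component must vanish because
  the I-component of the form is zero throughout.\<close>

lemma maurer_cartan_components:
  assumes z: "z \<in> U"
  shows "\<eta> z v $ 3 * \<eta> z x $ 4 = \<eta> z x $ 3 * \<eta> z v $ 4"
    "D (\<lambda>u. \<eta> u x $ 3) z v = D (\<lambda>u. \<eta> u v $ 3) z x"
    "D (\<lambda>u. \<eta> u x $ 4) z v = D (\<lambda>u. \<eta> u v $ 4) z x"
proof -
  have D2: "D (\<lambda>u. \<eta> u x) z v $ 2 = 0" for x v
  proof -
    have "((\<lambda>u. \<eta> u x $ 2) has_derivative (\<lambda>v. 0)) (at z)"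
      by (rule has_derivative_transform_within_open[OF has_derivative_const U z]) (simp add: eta_2)
    then show ?thesis unfolding D_eta_nth[OF z, symmetric] by (simp add: frechet_derivative_eqI)
  qed
  note mc = maurer_cartan_equation[OF z, of x v]
  have "2 * (\<eta> z v $ 3 * \<eta> z x $ 4) = 2 * (\<eta> z x $ 3 * \<eta> z v $ 4)"
    using arg_cong[OF mc, of "\<lambda>q. q $ 2"]
    by (simp add: D2 qmult_nth eta_1[OF z] eta_2[OF z] algebra_simps)
  then show "\<eta> z v $ 3 * \<eta> z x $ 4 = \<eta> z x $ 3 * \<eta> z v $ 4"
    by simp
  show "D (\<lambda>u. \<eta> u x $ 3) z v = D (\<lambda>u. \<eta> u v $ 3) z x"
    using arg_cong[OF mc, of "\<lambda>q. q $ 3"]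
    by (simp add: D_eta_nth[OF z] qmult_nth eta_1[OF z] eta_2[OF z])
  show "D (\<lambda>u. \<eta> u x $ 4) z v = D (\<lambda>u. \<eta> u v $ 4) z x"
    using arg_cong[OF mc, of "\<lambda>q. q $ 4"]
    by (simp add: D_eta_nth[OF z] qmult_nth eta_1[OF z] eta_2[OF z])
qed

lemma D_gauss_map_zero:
  assumes z: "z \<in> U" and "\<eta> z v $ 3 = 0" "\<eta> z v $ 4 = 0"
  shows "D (gauss_map F) z v = 0"
proof -
  have "\<eta> z v = 0"
    using assms eta_1[OF z] eta_2[OF z] by (simp add: vec_eq_iff forall_4)
  then show ?thesis
    by (simp add: D_gauss_map[OF z eta_2[OF z]] bounded_bilinear.zero_left[OF bounded_bilinear_qmult]
         bounded_bilinear.zero_right[OF bounded_bilinear_qmult])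
qed

lemma qH_D_gauss_map:
  assumes z: "z \<in> U"
  shows "qH (D (gauss_map F) z v) (D (gauss_map F) z v) = - 4 * ((\<eta> z v $ 3)\<^sup>2 + (\<eta> z v $ 4)\<^sup>2)"
proof -
  have s: "of_real (sgn (w z)) * of_real (sgn (w z)) = (1 :: complex)"
    using w_nz[OF z] by (simp add: sgn_if)
  have g1: "qH (g z) (g z) = 1"
    using gS[OF z] by (simp add: Spin31_def)
  have conj: "qH (qconj (g z) \<odot> X \<odot> g z) (qconj (g z) \<odot> X \<odot> g z) = qH X X" for X
    by (simp add: qH_qmult_right qH_qmult_left qH_qconj g1)
  have I: "qH (qI \<odot> \<eta> z v) (qI \<odot> \<eta> z v) = (\<eta> z v $ 3)\<^sup>2 + (\<eta> z v $ 4)\<^sup>2"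
    by (simp add: qH_def sum_4 cquat_nth eta_1[OF z] eta_2[OF z] power2_eq_square)
  have "qH (D (gauss_map F) z v) (D (gauss_map F) z v)
      = (of_real (sgn (w z)) * of_real (sgn (w z))) * ((2 * \<i>) * (2 * \<i>)) * ((\<eta> z v $ 3)\<^sup>2 + (\<eta> z v $ 4)\<^sup>2)"
    unfolding D_gauss_map[OF z eta_2[OF z]] qH_smult conj I by (simp only: mult_ac)
  then show ?thesis
    unfolding s by simp
qed

lemma smooth_dual_frame: "smooth_on U e1" "smooth_on U e2"
proof -
  have smw: "smooth_on U w"
    unfolding w_def[abs_def] by (intro smooth_on_diff smooth_on_mult sm U)
  show "smooth_on U e1" "smooth_on U e2"
    unfolding e1_def[abs_def] e2_def[abs_def] Complex_eq
    by (intro smooth_on_add smooth_on_mult smooth_on_const smooth_on_of_real smooth_on_divide_real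
          smooth_on_minus smw sm w_nz U; assumption)+
qed

text \<open>The coordinate has been chosen so that one of the two Maurer-Cartan components is \<open>dz\<close>.\<close>

lemma representation_exists:
  assumes U': "U \<noteq> {}" "simply_connected U"
    and coord: "k \<in> {3, 4}" "\<And>z v. z \<in> U \<Longrightarrow> \<eta> z v $ k = v"
    and nd: "\<And>z. z \<in> U \<Longrightarrow> (\<eta> z 1 $ 3)\<^sup>2 + (\<eta> z 1 $ 4)\<^sup>2 \<noteq> 0"
  shows "\<exists>f1 f2 h1 h2. representation_data U f1 f2 h1 h2 g \<omega>1 \<omega>2 \<and> primitive_on U (xi g \<omega>1 \<omega>2) F"
proof -
  \<comment> \<open>One component is the identity; linear dependence with the direction 1 as second
    argument makes the other one complex linear.\<close>
  have eta3: "\<eta> z v $ 3 = \<eta> z 1 $ 3 * v" and eta4: "\<eta> z v $ 4 = \<eta> z 1 $ 4 * v" if z: "z \<in> U" for z v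
    using coord(1) coord(2)[OF z, of v] coord(2)[OF z, of 1] maurer_cartan_components(1)[OF z, of v 1]
    by (auto simp: mult.commute)
  \<comment> \<open>The factor \<open>- \<i>\<close> appears because \<open>f2\<close> is the
    coefficient of \<open>\<i>\<close> times K.\<close>
  define f1 f2 where "f1 z = \<eta> z 1 $ 3" and "f2 z = - \<i> * \<eta> z 1 $ 4" for z
  define h1 h2 where "h1 z = - Im (f1 z * e1 z - f2 z * e2 z)" and "h2 z = Re (f1 z * e2 z - f2 z * e1 z)" for z
  have smf: "smooth_on U f1" "smooth_on U f2"
    unfolding f1_def[abs_def] f2_def[abs_def] by (intro smooth_on_mult smooth_on_const smooth_eta_nth U)+
  have smh: "smooth_on U h1" "smooth_on U h2"
    unfolding h1_def[abs_def] h2_def[abs_def]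
    by (intro smooth_on_minus smooth_on_Im smooth_on_Re smooth_on_diff smooth_on_mult smf smooth_dual_frame U)+
  \<comment> \<open>For a closed form f dz, exchanging the two directions gives
    \<open>D f z v = D f z 1 * v\<close>: the differential of the coefficient is complex
    linear.\<close>
  have hol: "(\<lambda>z. \<eta> z 1 $ l) holomorphic_on U"
    if e: "\<And>z v. z \<in> U \<Longrightarrow> \<eta> z v $ l = \<eta> z 1 $ l * v"
      and c: "\<And>z v x. z \<in> U \<Longrightarrow> D (\<lambda>u. \<eta> u x $ l) z v = D (\<lambda>u. \<eta> u v $ l) z x" for l
    unfolding holomorphic_on_open[OF U]
  proof (intro ballI exI)
    fix z assume z: "z \<in> U"
    have d: "((\<lambda>u. \<eta> u 1 $ l) has_derivative D (\<lambda>u. \<eta> u 1 $ l) z) (at z)"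
      by (rule smooth_on_has_derivative[OF smooth_eta_nth z])
    have "D (\<lambda>u. \<eta> u 1 $ l) z v = D (\<lambda>u. \<eta> u 1 $ l) z 1 * v" for v
    proof -
      have "((\<lambda>u. \<eta> u v $ l) has_derivative (\<lambda>x. D (\<lambda>u. \<eta> u 1 $ l) z x * v)) (at z)"
        by (rule has_derivative_transform_within_open[OF has_derivative_mult_left[OF d] U z]) (simp add: e[of _ v])
      then have "D (\<lambda>u. \<eta> u v $ l) z 1 = D (\<lambda>u. \<eta> u 1 $ l) z 1 * v"
        by (simp add: frechet_derivative_eqI)
      then show ?thesis
        using c[OF z, of 1 v] by simp
    qed
    then have "D (\<lambda>u. \<eta> u 1 $ l) z = (*) (D (\<lambda>u. \<eta> u 1 $ l) z 1)"
      by (rule ext)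
    with d show "((\<lambda>z. \<eta> z 1 $ l) has_field_derivative D (\<lambda>u. \<eta> u 1 $ l) z 1) (at z)"
      unfolding has_field_derivative_def by metis
  qed
  have holf: "f1 holomorphic_on U" "f2 holomorphic_on U"
    unfolding f1_def[abs_def] f2_def[abs_def]
    by (intro holomorphic_intros hol eta3 eta4 maurer_cartan_components(2,3); assumption)+
  have nz: "(f1 z)\<^sup>2 - (f2 z)\<^sup>2 \<noteq> 0" if "z \<in> U" for z
    using nd[OF that] by (simp add: f1_def f2_def power_mult_distrib)
  have rel: "f1 z * e1 z - f2 z * e2 z = - \<i> * of_real (h1 z)" "f1 z * e2 z - f2 z * e1 z = of_real (h2 z)"
    if z: "z \<in> U" for z
  proof -
    have 1: "f1 z * e1 z - f2 z * e2 z = \<eta> z (e1 z) $ 3 + \<i> * \<eta> z (e2 z) $ 4"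
      and 2: "f1 z * e2 z - f2 z * e1 z = \<eta> z (e2 z) $ 3 + \<i> * \<eta> z (e1 z) $ 4"
      unfolding eta3[OF z, of "e1 z"] eta3[OF z, of "e2 z"] eta4[OF z, of "e1 z"] eta4[OF z, of "e2 z"]
      by (simp_all add: f1_def f2_def)
    have "Re (f1 z * e1 z - f2 z * e2 z) = 0" "Im (f1 z * e2 z - f2 z * e1 z) = 0"
      unfolding 1 2 using second_fundamental_form[OF z] by simp_all
    then show "f1 z * e1 z - f2 z * e2 z = - \<i> * of_real (h1 z)" "f1 z * e2 z - f2 z * e1 z = of_real (h2 z)"
      unfolding h1_def h2_def by (auto simp: complex_eq_iff simp del: times_complex.sel minus_complex.sel)
  qed
  note alpha = alpha_unique[of f1 _ f2 _ _ h1 h2, OF nz rel]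
  have sm_alpha: "smooth_on U (alpha1 f1 f2 h1 h2)" "smooth_on U (alpha2 f1 f2 h1 h2)"
    by (rule smooth_on_cong[OF U _ smooth_dual_frame(1)], simp add: alpha)
       (rule smooth_on_cong[OF U _ smooth_dual_frame(2)], simp add: alpha)
  have "lie_bracket (alpha1 f1 f2 h1 h2) (alpha2 f1 f2 h1 h2) z = 0" if z: "z \<in> U" for z
  proof -
    have "\<omega>1 z (lie_bracket (alpha1 f1 f2 h1 h2) (alpha2 f1 f2 h1 h2) z)
      = D (\<lambda>u. \<omega>1 u (alpha1 f1 f2 h1 h2 z)) z (alpha2 f1 f2 h1 h2 z)
        - D (\<lambda>u. \<omega>1 u (alpha2 f1 f2 h1 h2 z)) z (alpha1 f1 f2 h1 h2 z)"
      by (rule form_lie_bracket[OF U z lin(1) sm(1) smooth_on_differentiable[OF sm_alpha(1) z]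
           smooth_on_differentiable[OF sm_alpha(2) z], where x=1 and y=0]) (simp_all add: alpha dual_frame)
    moreover have "\<omega>2 z (lie_bracket (alpha1 f1 f2 h1 h2) (alpha2 f1 f2 h1 h2) z)
      = D (\<lambda>u. \<omega>2 u (alpha1 f1 f2 h1 h2 z)) z (alpha2 f1 f2 h1 h2 z)
        - D (\<lambda>u. \<omega>2 u (alpha2 f1 f2 h1 h2 z)) z (alpha1 f1 f2 h1 h2 z)"
      by (rule form_lie_bracket[OF U z lin(2) sm(2) smooth_on_differentiable[OF sm_alpha(1) z]
           smooth_on_differentiable[OF sm_alpha(2) z], where x=0 and y=1]) (simp_all add: alpha dual_frame)
    ultimately have "\<omega>1 z (lie_bracket (alpha1 f1 f2 h1 h2) (alpha2 f1 f2 h1 h2) z) = 0"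
      "\<omega>2 z (lie_bracket (alpha1 f1 f2 h1 h2) (alpha2 f1 f2 h1 h2) z) = 0"
      using omega_closed[OF z, of "alpha1 f1 f2 h1 h2 z" "alpha2 f1 f2 h1 h2 z"] by simp_all
    then show ?thesis
      using frame_expand[OF z, of "lie_bracket (alpha1 f1 f2 h1 h2) (alpha2 f1 f2 h1 h2) z"] by simp
  qed
  moreover have "a = 0 \<and> b = 0"
    if z: "z \<in> U" and ab: "a *\<^sub>R alpha1 f1 f2 h1 h2 z + b *\<^sub>R alpha2 f1 f2 h1 h2 z = 0" for z and a b :: real
  proof (rule area_imp_independent)
    show "Im (cnj (alpha1 f1 f2 h1 h2 z) * alpha2 f1 f2 h1 h2 z) \<noteq> 0"
      using area_form[OF z, of "e1 z" "e2 z"] by (auto simp: alpha[OF z z z] dual_frame[OF z])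
  qed (rule ab)
  moreover have "D g z v \<odot> qinv (g z) = (f1 z * v) *s qJ + (f2 z * v) *s (\<i> *s qK)" if z: "z \<in> U" for z v
  proof -
    have "D g z v \<odot> qinv (g z) = \<eta> z v"
      by (simp add: maurer_cartan_def qinv_Spin31[OF gS[OF z]])
    moreover have "f1 z * v = \<eta> z v $ 3" and "f2 z * v * \<i> = \<eta> z v $ 4"
      unfolding eta3[OF z, of v] eta4[OF z, of v] by (simp_all add: f1_def f2_def complex_eq_iff algebra_simps)
    then have "\<eta> z v = (f1 z * v) *s qJ + (f2 z * v) *s (\<i> *s qK)"
      by (simp add: vec_eq_iff forall_4 cquat_nth eta_1[OF z] eta_2[OF z])
    ultimately show ?thesis by simp
  qed
  ultimately have "representation_data U f1 f2 h1 h2 g \<omega>1 \<omega>2"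
    unfolding representation_data_def dual_coframe_on_def
    using U U' holf smh g smooth_on_differentiable[OF sm_g] lin nz
    by (simp add: alpha dual_frame)
  moreover have "primitive_on U (xi g \<omega>1 \<omega>2) F"
  proof -
    have "xi g \<omega>1 \<omega>2 z = \<xi> z" if "z \<in> U" for z
      by (rule ext) (simp add: xi_eq_lorentz gS[OF that] \<xi>_def)
    then show ?thesis
      using F dF by (simp add: primitive_on_def)
  qed
  ultimately show ?thesis by blast
qed

end

lemma normal_curvature_vanishes_on_subset:
  "normal_curvature_vanishes_on U F \<Longrightarrow> V \<subseteq> U \<Longrightarrow> normal_curvature_vanishes_on V F"
  unfolding normal_curvature_vanishes_on_def by (meson order_trans)

text \<open>The domain is shrunk to a ball, on which the closed form \<open>- \<eta> $ 2\<close> has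
  a primitive \<tau>; it feeds \<open>rotate\<close>.\<close>

lemma local_flat_frame:
  assumes V: "open V" "x0 \<in> V" and F: "timelike_immersion_on V F"
    and K: "\<And>z. z \<in> V \<Longrightarrow> gauss_curvature (induced_metric F) z = 0" and KN: "normal_curvature_vanishes_on V F"
  obtains e g \<omega>1 \<omega>2 where "e > 0" "ball x0 e \<subseteq> V" "flat_frame (ball x0 e) g \<omega>1 \<omega>2 F"
proof -
  obtain N g \<omega>1 \<omega>2 where N: "x0 \<in> N" "N \<subseteq> V" and ad: "adapted_frame N g \<omega>1 \<omega>2 F"
    using local_adapted_frame[OF V F] by blast
  interpret a: adapted_frame N g \<omega>1 \<omega>2 F by (rule ad)
  obtain e where e: "e > 0" "ball x0 e \<subseteq> N"
    using a.U N(1) open_contains_ball by blast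
  interpret b: adapted_frame "ball x0 e" g \<omega>1 \<omega>2 F
    by (rule a.restrict[OF open_ball e(2)])
  have closed: "D (\<lambda>u. - (maurer_cartan g u x $ 2)) z v = D (\<lambda>u. - (maurer_cartan g u v $ 2)) z x"
    if z: "z \<in> ball x0 e" for z v x
  proof -
    have "D (\<lambda>u. - (maurer_cartan g u x $ 2)) z v = - D (\<lambda>u. maurer_cartan g u x $ 2) z v" for x v
      by (rule fun_cong[OF frechet_derivative_eqI])
         (rule has_derivative_minus[OF smooth_on_has_derivative[OF b.smooth_eta_nth z]])
    then show ?thesis
      using b.flat_imp_closed[OF _ normal_curvature_vanishes_on_subset[OF KN] z, of x v] K e(2) N(2)
      by (simp add: subset_iff)
  qed
  obtain \<tau> where \<tau>: "\<And>z. z \<in> ball x0 e \<Longrightarrow> (\<tau> has_derivative (\<lambda>v. - (maurer_cartan g z v $ 2))) (at z)"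
  proof (rule poincare_convex[OF open_ball convex_ball])
    show "linear (\<lambda>v. - (maurer_cartan g z v $ 2))" if "z \<in> ball x0 e" for z
      using linear_compose_neg[OF b.linear_eta_nth[OF that]] .
    show "smooth_on (ball x0 e) (\<lambda>z. - (maurer_cartan g z v $ 2))" for v
      by (intro smooth_on_minus b.smooth_eta_nth open_ball)
  qed (use closed in auto)
  obtain g' \<omega>1' \<omega>2' where "adapted_frame (ball x0 e) g' \<omega>1' \<omega>2' F"
    "\<And>z v. z \<in> ball x0 e \<Longrightarrow> maurer_cartan g' z v $ 2 = 0"
    using b.rotate[OF \<tau>] by blast
  then have "flat_frame (ball x0 e) g' \<omega>1' \<omega>2' F"
    by (intro flat_frame.intro flat_frame_axioms.intro)
  then show ?thesis
    using that e N(2) by blast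
qed

text \<open>Regularity and nondegeneracy enter only at \<open>x0\<close>: the first selects the
  component that becomes dz, the second spreads to a neighbourhood because a continuous function
  stays nonzero. The surface is then read in the coordinate \<zeta>, where
  \<open>representation_exists\<close> applies.\<close>

lemma local_representation:
  assumes V: "open V" "x0 \<in> V" and F: "timelike_immersion_on V F"
    and K: "\<And>z. z \<in> V \<Longrightarrow> gauss_curvature (induced_metric F) z = 0" and KN: "normal_curvature_vanishes_on V F"
    and reg: "inj (D (gauss_map F) x0)" and nd: "qH (D (gauss_map F) x0 v0) (D (gauss_map F) x0 v0) \<noteq> 0"
  obtains N \<zeta> h r f1 f2 h1 h2 g \<omega>1 \<omega>2 where
    "open N" "x0 \<in> N" "N \<subseteq> V" "r > 0" "smooth_on N \<zeta>" "homeomorphism N (ball (\<zeta> x0) r) \<zeta> h"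
    "smooth_on (ball (\<zeta> x0) r) h"
    "representation_data (ball (\<zeta> x0) r) f1 f2 h1 h2 g \<omega>1 \<omega>2"
    "primitive_on (ball (\<zeta> x0) r) (xi g \<omega>1 \<omega>2) (\<lambda>y. F (h y))"
proof -
  obtain e g \<omega>1 \<omega>2 where e: "e > 0" "ball x0 e \<subseteq> V" and ff: "flat_frame (ball x0 e) g \<omega>1 \<omega>2 F"
    using local_flat_frame[OF V F K KN] by blast
  define B where "B = ball x0 e"
  interpret a: flat_frame B g \<omega>1 \<omega>2 F
    unfolding B_def by (rule ff)
  define \<eta> where "\<eta> = maurer_cartan g"
  have x0: "x0 \<in> B" using e by (simp add: B_def)
  have wedge: "\<eta> z v $ 3 * \<eta> z x $ 4 = \<eta> z x $ 3 * \<eta> z v $ 4" if "z \<in> B" for z v x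
    unfolding \<eta>_def by (rule a.maurer_cartan_components(1)[OF that])
  have inj: "v = 0" if "\<eta> x0 v $ 3 = 0" "\<eta> x0 v $ 4 = 0" for v
  proof -
    have "D (gauss_map F) x0 v = 0" "D (gauss_map F) x0 0 = 0"
      using a.D_gauss_map_zero[OF x0] that linear_0[OF a.linear_eta_nth[OF x0]] by (auto simp: \<eta>_def)
    then show ?thesis using reg by (metis injD)
  qed
  have nd': "(\<eta> x0 v0 $ 3)\<^sup>2 + (\<eta> x0 v0 $ 4)\<^sup>2 \<noteq> 0"
    using nd unfolding a.qH_D_gauss_map[OF x0] \<eta>_def by (metis mult_zero_right)
  \<comment> \<open>If \<open>u\<close> and \<open>v\<close> were nonzero kernel vectors of the two
    components, the wedge relation would force one of them into both kernels.\<close>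
  have "\<exists>k\<in>{3,4}. \<forall>v. \<eta> x0 v $ k = 0 \<longrightarrow> v = 0"
  proof (rule ccontr)
    assume "\<not> ?thesis"
    then obtain u v where u: "\<eta> x0 u $ 3 = 0" "u \<noteq> 0" and v: "\<eta> x0 v $ 4 = 0" "v \<noteq> 0" by auto
    have "\<eta> x0 v $ 3 * \<eta> x0 u $ 4 = 0"
      using wedge[OF x0, of v u] u v by simp
    then show False using inj u v by auto
  qed
  then obtain k where k: "k \<in> {3, 4 :: 4}" "\<And>v. \<eta> x0 v $ k = 0 \<Longrightarrow> v = 0" by blast
  define f where "f z = (\<eta> z 1 $ 3)\<^sup>2 + (\<eta> z 1 $ 4)\<^sup>2" for z
  \<comment> \<open>By linear dependence the sum of squares is proportional to the square of either
    component. This carries nonvanishing from the given direction \<open>v0\<close> to the direction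
    1, and later through the change of coordinates.\<close>
  have f_eq: "((\<eta> z v $ 3)\<^sup>2 + (\<eta> z v $ 4)\<^sup>2) * (\<eta> z x $ l)\<^sup>2 = ((\<eta> z x $ 3)\<^sup>2 + (\<eta> z x $ 4)\<^sup>2) * (\<eta> z v $ l)\<^sup>2"
    if "z \<in> B" "l \<in> {3,4}" for z v x and l :: 4
  proof -
    have w: "(\<eta> z v $ 3)\<^sup>2 * (\<eta> z x $ 4)\<^sup>2 = (\<eta> z x $ 3)\<^sup>2 * (\<eta> z v $ 4)\<^sup>2"
      using wedge[OF that(1), of v x] by (metis power_mult_distrib)
    show ?thesis
      using that(2) w by (auto simp: algebra_simps)
  qed
  have fx0: "f x0 \<noteq> 0"
  proof -
    have "\<eta> x0 1 $ k \<noteq> 0" using k(2)[of 1] by auto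
    then show ?thesis
      using f_eq[OF x0 k(1), of v0 1] nd' by (auto simp: f_def)
  qed
  have smf: "smooth_on B f"
    unfolding f_def[abs_def] power2_eq_square \<eta>_def
    by (intro smooth_on_add smooth_on_mult a.smooth_eta_nth a.U)
  define U where "U = B \<inter> f -` (- {0})"
  have U: "open U" "x0 \<in> U" "U \<subseteq> B"
    unfolding U_def using continuous_open_preimage[OF smooth_on_continuous[OF smf] a.U, of "- {0}"] x0 fx0
    by auto
  have closed: "D (\<lambda>u. \<eta> u x $ k) z v = D (\<lambda>u. \<eta> u v $ k) z x" if "z \<in> B" for z v x
    using k(1) a.maurer_cartan_components(2,3)[OF that, of x v] by (auto simp: \<eta>_def)
  \<comment> \<open>The new coordinate: its differential is the chosen component, which therefore
    becomes dz when pulled back by the inverse \<open>h\<close>.\<close>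
  obtain \<zeta> where \<zeta>: "\<And>z. z \<in> B \<Longrightarrow> (\<zeta> has_derivative (\<lambda>v. \<eta> z v $ k)) (at z)"
  proof (rule poincare_convex[of B "\<lambda>z v. \<eta> z v $ k"])
    show "convex B" by (simp add: B_def)
  qed (use closed a.U a.linear_eta_nth a.smooth_eta_nth in \<open>auto simp: \<eta>_def\<close>)
  have D\<zeta>: "D \<zeta> z = (\<lambda>v. \<eta> z v $ k)" if "z \<in> B" for z
    by (rule frechet_derivative_eqI[OF \<zeta>[OF that]])
  have sm\<zeta>: "smooth_on B \<zeta>"
    by (rule smooth_onI_derivative[OF a.U \<zeta>]) (auto simp: \<eta>_def a.smooth_eta_nth)
  have "inj (D \<zeta> x0)"
    using k(2) a.linear_eta_nth[OF x0, of k] by (simp add: D\<zeta>[OF x0] linear_injective_0 \<eta>_def)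
  note inverse = smooth_local_inverse[OF U(1,2) smooth_on_subset[OF sm\<zeta> U(3)] this]
  obtain N h r where N: "open N" "x0 \<in> N" "N \<subseteq> U" "r > 0"
    and hom: "homeomorphism N (ball (\<zeta> x0) r) \<zeta> h" and smh: "smooth_on (ball (\<zeta> x0) r) h"
    and dh: "\<And>y. y \<in> ball (\<zeta> x0) r \<Longrightarrow> (h has_derivative inv (D \<zeta> (h y))) (at y)"
    and bij: "\<And>y. y \<in> N \<Longrightarrow> bij (D \<zeta> y)"
    by (rule inverse) (rule that)
  have hN: "h y \<in> N" if "y \<in> ball (\<zeta> x0) r" for y
    using hom that by (auto simp: homeomorphism_def)
  have hB: "h ` ball (\<zeta> x0) r \<subseteq> B" using hN N(3) U(3) by blast
  have Dh: "D h y = inv (D \<zeta> (h y))" if "y \<in> ball (\<zeta> x0) r" for y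
    by (rule frechet_derivative_eqI[OF dh[OF that]])
  have bijh: "bij (D h y)" if "y \<in> ball (\<zeta> x0) r" for y
    unfolding Dh[OF that] by (rule bij_imp_bij_inv[OF bij[OF hN[OF that]]])
  have mc: "maurer_cartan (\<lambda>y. g (h y)) y v = \<eta> (h y) (D h y v)" if "y \<in> ball (\<zeta> x0) r" for y v
    unfolding \<eta>_def by (rule a.change_coordinates(2)[OF open_ball hB smh bijh that])
  interpret c: flat_frame "ball (\<zeta> x0) r" "\<lambda>y. g (h y)" "\<lambda>y v. \<omega>1 (h y) (D h y v)"
      "\<lambda>y v. \<omega>2 (h y) (D h y v)" "\<lambda>y. F (h y)"
  proof (intro flat_frame.intro flat_frame_axioms.intro a.change_coordinates(1)[OF open_ball hB smh bijh])
    show "maurer_cartan (\<lambda>y. g (h y)) y v $ 2 = 0" if "y \<in> ball (\<zeta> x0) r" for y v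
      unfolding mc[OF that] \<eta>_def by (rule a.eta_2) (use hB that in blast)
  qed
  have coordk: "maurer_cartan (\<lambda>y. g (h y)) y v $ k = v" if y: "y \<in> ball (\<zeta> x0) r" for y v
  proof -
    have "D \<zeta> (h y) (D h y v) = v"
      unfolding Dh[OF y] using bij[OF hN[OF y]] by (simp add: bij_is_surj surj_f_inv_f)
    moreover have "h y \<in> B"
      using hB y by blast
    ultimately show ?thesis
      by (simp add: mc[OF y] D\<zeta>)
  qed
  have "(maurer_cartan (\<lambda>y. g (h y)) y 1 $ 3)\<^sup>2 + (maurer_cartan (\<lambda>y. g (h y)) y 1 $ 4)\<^sup>2 \<noteq> 0"
    if y: "y \<in> ball (\<zeta> x0) r" for y
  proof -
    have z: "h y \<in> B" "f (h y) \<noteq> 0" using hN[OF y] N(3) by (auto simp: U_def)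
    have "\<eta> (h y) (D h y 1) $ k = 1"
      using coordk[OF y, of 1] by (simp add: mc[OF y])
    then have "((\<eta> (h y) (D h y 1) $ 3)\<^sup>2 + (\<eta> (h y) (D h y 1) $ 4)\<^sup>2) * (\<eta> (h y) 1 $ k)\<^sup>2 = f (h y)"
      using f_eq[OF z(1) k(1), of "D h y 1" 1] by (simp add: f_def)
    then show ?thesis
      using z(2) by (auto simp: mc[OF y])
  qed
  moreover have "ball (\<zeta> x0) r \<noteq> {}" "simply_connected (ball (\<zeta> x0) r)"
    using N(4) by (auto intro: convex_imp_simply_connected)
  ultimately obtain f1 f2 h1 h2 where
    "representation_data (ball (\<zeta> x0) r) f1 f2 h1 h2 (\<lambda>y. g (h y)) (\<lambda>y v. \<omega>1 (h y) (D h y v)) (\<lambda>y v. \<omega>2 (h y) (D h y v))"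
    "primitive_on (ball (\<zeta> x0) r) (xi (\<lambda>y. g (h y)) (\<lambda>y v. \<omega>1 (h y) (D h y v)) (\<lambda>y v. \<omega>2 (h y) (D h y v))) (\<lambda>y. F (h y))"
    using c.representation_exists[OF _ _ k(1) coordk] by blast
  moreover have "N \<subseteq> V" "smooth_on N \<zeta>"
    using N(3) U(3) e(2) smooth_on_subset[OF sm\<zeta>] by (auto simp: B_def)
  ultimately show ?thesis
    using that N hom smh by blast
qed

section \<open>Charts\<close>

lemma open_overlap:
  assumes "topological_chart M c" "topological_chart M c'"
  shows "open (overlap c c')"
proof -
  obtain W \<phi> W' \<phi>' where c: "c = (W, \<phi>)" "c' = (W', \<phi>')" by (cases c, cases c') blast
  have W: "openin M W" "open (\<phi> ` W)" "openin M W'"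
    and hom: "homeomorphic_map (subtopology M W) (top_of_set (\<phi> ` W)) \<phi>"
    using assms by (auto simp: c topological_chart_def)
  have "openin (subtopology M W) (W \<inter> W')"
    using W by (simp add: openin_open_subtopology openin_Int)
  then have "openin (top_of_set (\<phi> ` W)) (\<phi> ` (W \<inter> W'))"
    using homeomorphic_imp_open_map[OF hom] by (simp add: open_map_def)
  then show ?thesis
    using W(2) by (simp add: c overlap_def openin_open_eq)
qed

lemma inj_on_chart: "topological_chart M (W, \<phi>) \<Longrightarrow> inj_on \<phi> W"
proof -
  assume "topological_chart M (W, \<phi>)"
  then have "openin M W" "homeomorphic_map (subtopology M W) (top_of_set (\<phi> ` W)) \<phi>"
    by (auto simp: topological_chart_def)
  then have "inj_on \<phi> (topspace (subtopology M W))" "W \<subseteq> topspace M"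
    by (auto simp: homeomorphic_eq_everything_map openin_subset)
  then show ?thesis
    by (simp add: inf_absorb2)
qed

text \<open>The chart is cut down to the preimage of \<open>N\<close> and followed by \<zeta>. Since
  \<zeta> may reverse orientation, the result is a smooth chart compatible with the atlas, not an
  oriented one; transitions are those of the old chart composed with \<open>h\<close> or
  \<zeta>.\<close>

lemma smooth_chart_compose:
  fixes \<phi> :: "'a \<Rightarrow> complex" and \<zeta> h :: "complex \<Rightarrow> complex"
  assumes M: "oriented_smooth_surface M \<A>" and c: "(W, \<phi>) \<in> \<A>"
    and N: "open N" "N \<subseteq> \<phi> ` W" and B: "open B"
    and hom: "homeomorphism N B \<zeta> h" and sm: "smooth_on N \<zeta>" "smooth_on B h"
  defines "W' \<equiv> {q \<in> W. \<phi> q \<in> N}"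
  shows "(\<zeta> \<circ> \<phi>) ` W' = B" "smooth_chart M \<A> (W', \<zeta> \<circ> \<phi>)"
    and "y \<in> B \<Longrightarrow> chart_inv (W', \<zeta> \<circ> \<phi>) y = chart_inv (W, \<phi>) (h y)"
proof -
  have top: "topological_chart M (W, \<phi>)"
    using M c by (auto simp: oriented_smooth_surface_def)
  have W: "openin M W" and hom\<phi>: "homeomorphic_map (subtopology M W) (top_of_set (\<phi> ` W)) \<phi>"
    using top by (auto simp: topological_chart_def)
  have WM: "W \<subseteq> topspace M" using W by (rule openin_subset)
  have inj: "inj_on \<phi> W" by (rule inj_on_chart[OF top])
  have \<phi>W': "\<phi> ` W' = N" using N(2) by (auto simp: W'_def)
  have \<zeta>N: "\<zeta> ` N = B" and hB: "h ` B = N" and h\<zeta>: "\<And>x. x \<in> N \<Longrightarrow> h (\<zeta> x) = x" and \<zeta>h: "\<And>y. y \<in> B \<Longrightarrow> \<zeta> (h y) = y"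
    using hom by (auto simp: homeomorphism_def)
  show im: "(\<zeta> \<circ> \<phi>) ` W' = B"
    unfolding image_comp[symmetric] \<phi>W' \<zeta>N ..
  have inj': "inj_on (\<zeta> \<circ> \<phi>) W'"
    using inj h\<zeta> by (intro inj_onI) (metis (mono_tags, lifting) W'_def comp_apply inj_onD mem_Collect_eq)
  have inv: "inv_into W' (\<zeta> \<circ> \<phi>) y = inv_into W \<phi> (h y)" if y: "y \<in> B" for y
  proof -
    have "h y \<in> \<phi> ` W'" using \<phi>W' hB y by blast
    then obtain q where q: "q \<in> W'" "h y = \<phi> q" by blast
    then have "inv_into W \<phi> (h y) = q"
      using inj by (simp add: W'_def)
    moreover have "inv_into W' (\<zeta> \<circ> \<phi>) ((\<zeta> \<circ> \<phi>) q) = q"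
      by (rule inv_into_f_f[OF inj' q(1)])
    ultimately show ?thesis
      using \<zeta>h[OF y] q(2) by simp
  qed
  then show "y \<in> B \<Longrightarrow> chart_inv (W', \<zeta> \<circ> \<phi>) y = chart_inv (W, \<phi>) (h y)"
    by (simp add: chart_inv_def)
  have topW': "topological_chart M (W', \<zeta> \<circ> \<phi>)"
  proof -
    have "openin (top_of_set (\<phi> ` W)) N"
      using N by (simp add: openin_open_eq top[unfolded topological_chart_def, simplified])
    then have "openin (subtopology M W) {q \<in> topspace (subtopology M W). \<phi> q \<in> N}"
      using homeomorphic_imp_continuous_map[OF hom\<phi>] by (rule openin_continuous_map_preimage[rotated])
    then have oW': "openin M W'"
      using W WM by (simp add: openin_open_subtopology W'_def inf_absorb2)
    have "homeomorphic_map (subtopology (subtopology M W) W') (subtopology (top_of_set (\<phi> ` W)) N) \<phi>"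
      by (rule homeomorphic_map_subtopologies[OF hom\<phi>])
         (use WM N(2) \<phi>W' in \<open>auto simp: W'_def\<close>)
    moreover have "W \<inter> W' = W'" "\<phi> ` W \<inter> N = N"
      using N(2) by (auto simp: W'_def)
    ultimately have 1: "homeomorphic_map (subtopology M W') (top_of_set N) \<phi>"
      by (simp only: subtopology_subtopology)
    have 2: "homeomorphic_map (top_of_set N) (top_of_set B) \<zeta>"
      unfolding homeomorphic_map_maps homeomorphic_maps_def
      by (rule exI[of _ h]) (use hom in \<open>auto simp: homeomorphism_def\<close>)
    have "homeomorphic_map (subtopology M W') (top_of_set B) (\<zeta> \<circ> \<phi>)"
      by (rule homeomorphic_map_compose[OF 1 2])
    then show ?thesis
      using oW' B im by (simp add: topological_chart_def)
  qed
  show "smooth_chart M \<A> (W', \<zeta> \<circ> \<phi>)"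
    unfolding smooth_chart_def
  proof (intro conjI ballI topW')
    fix c' assume c': "c' \<in> \<A>"
    obtain X \<psi> where X: "c' = (X, \<psi>)" by (cases c') blast
    have top': "topological_chart M c'"
      using M c' by (auto simp: oriented_smooth_surface_def)
    have tr: "smooth_on (overlap (W, \<phi>) c') (transition (W, \<phi>) c')"
      "smooth_on (overlap c' (W, \<phi>)) (transition c' (W, \<phi>))"
      using M c c' by (auto simp: oriented_smooth_surface_def)
    have sub: "overlap (W', \<zeta> \<circ> \<phi>) c' \<subseteq> B"
      using im by (auto simp: overlap_def)
    have hsub: "h ` overlap (W', \<zeta> \<circ> \<phi>) c' \<subseteq> overlap (W, \<phi>) c'"
      using h\<zeta> by (auto simp: overlap_def W'_def)
    have "smooth_on (overlap (W', \<zeta> \<circ> \<phi>) c') (\<lambda>y. transition (W, \<phi>) c' (h y))"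
      by (rule smooth_on_compose[OF open_overlap[OF topW' top'] open_overlap[OF top top'] hsub
            smooth_on_subset[OF sm(2) sub] tr(1)])
    then show "smooth_on (overlap (W', \<zeta> \<circ> \<phi>) c') (transition (W', \<zeta> \<circ> \<phi>) c')"
      by (rule smooth_on_cong[OF open_overlap[OF topW' top'], rotated])
         (use sub inv in \<open>auto simp: transition_def chart_inv_def\<close>)
    have sub': "overlap c' (W', \<zeta> \<circ> \<phi>) \<subseteq> overlap c' (W, \<phi>)"
      by (auto simp: overlap_def W'_def)
    have "inv_into X \<psi> (\<psi> q) = q" if "q \<in> X" for q
      using inj_on_chart[OF top'[unfolded X]] that by simp
    then have "transition c' (W, \<phi>) ` overlap c' (W', \<zeta> \<circ> \<phi>) \<subseteq> N"
      by (auto simp: transition_def overlap_def chart_inv_def X W'_def)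
    from smooth_on_compose[OF open_overlap[OF top' topW'] N(1) this smooth_on_subset[OF tr(2) sub'] sm(1)]
    show "smooth_on (overlap c' (W', \<zeta> \<circ> \<phi>)) (transition c' (W', \<zeta> \<circ> \<phi>))"
      by (simp add: transition_def comp_def)
  qed
qed

lemma locally_represented:
  assumes M: "oriented_smooth_surface M \<A>" and F: "in_all_charts \<A> F timelike_immersion_on"
    and K: "in_all_charts \<A> F (\<lambda>V Fc. \<forall>z\<in>V. gauss_curvature (induced_metric Fc) z = 0)"
    and KN: "in_all_charts \<A> F normal_curvature_vanishes_on"
    and reg: "in_all_charts \<A> F regular_gauss_map_on" and nd: "in_all_charts \<A> F nondegenerate_osculating_on"
    and p: "p \<in> topspace M"
  shows "\<exists>W \<zeta>. p \<in> W \<and> smooth_chart M \<A> (W, \<zeta>) \<and>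
     (\<exists>f1 f2 h1 h2 g \<omega>1 \<omega>2. representation_data (\<zeta> ` W) f1 f2 h1 h2 g \<omega>1 \<omega>2 \<and>
        primitive_on (\<zeta> ` W) (xi g \<omega>1 \<omega>2) (F \<circ> chart_inv (W, \<zeta>)))"
proof -
  obtain W \<phi> where c: "(W, \<phi>) \<in> \<A>" and pW: "p \<in> W"
  proof -
    have "p \<in> (\<Union>c\<in>\<A>. fst c)" using M p by (simp add: oriented_smooth_surface_def)
    then show ?thesis using that by force
  qed
  define Fc where "Fc = F \<circ> chart_inv (W, \<phi>)"
  have V: "open (\<phi> ` W)" "\<phi> p \<in> \<phi> ` W"
    using M c pW by (auto simp: oriented_smooth_surface_def topological_chart_def)
  have at_c: "P (\<phi> ` W) Fc" if "in_all_charts \<A> F P" for P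
    using that c by (force simp: in_all_charts_def Fc_def)
  have K': "gauss_curvature (induced_metric Fc) z = 0" if "z \<in> \<phi> ` W" for z
    using at_c[OF K] that by blast
  have reg': "inj (D (gauss_map Fc) (\<phi> p))"
    using at_c[OF reg] V(2) unfolding regular_gauss_map_on_def by blast
  obtain v0 where nd': "qH (D (gauss_map Fc) (\<phi> p) v0) (D (gauss_map Fc) (\<phi> p) v0) \<noteq> 0"
    using at_c[OF nd] V(2) unfolding nondegenerate_osculating_on_def by blast
  obtain N \<zeta> h r f1 f2 h1 h2 g \<omega>1 \<omega>2 where N: "open N" "\<phi> p \<in> N" "N \<subseteq> \<phi> ` W" "r > 0"
    and sm: "smooth_on N \<zeta>" "smooth_on (ball (\<zeta> (\<phi> p)) r) h"
    and hom: "homeomorphism N (ball (\<zeta> (\<phi> p)) r) \<zeta> h"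
    and rep: "representation_data (ball (\<zeta> (\<phi> p)) r) f1 f2 h1 h2 g \<omega>1 \<omega>2"
    and prim: "primitive_on (ball (\<zeta> (\<phi> p)) r) (xi g \<omega>1 \<omega>2) (\<lambda>y. Fc (h y))"
    by (rule local_representation[OF V at_c[OF F] _ at_c[OF KN] reg' nd'], erule K') (rule that)
  define B where "B = ball (\<zeta> (\<phi> p)) r"
  define W' where "W' = {q \<in> W. \<phi> q \<in> N}"
  note cc = smooth_chart_compose[OF M c N(1,3) open_ball hom sm, folded W'_def B_def]
  have "primitive_on B (xi g \<omega>1 \<omega>2) (F \<circ> chart_inv (W', \<zeta> \<circ> \<phi>))"
  proof -
    have eq: "(F \<circ> chart_inv (W', \<zeta> \<circ> \<phi>)) y = Fc (h y)" if "y \<in> B" for y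
      by (simp add: cc(3)[OF that] Fc_def)
    have "((F \<circ> chart_inv (W', \<zeta> \<circ> \<phi>)) has_derivative xi g \<omega>1 \<omega>2 y) (at y)" if "y \<in> B" for y
      by (rule has_derivative_transform_within_open[of "\<lambda>y. Fc (h y)", OF _ _ that])
         (use prim that eq in \<open>auto simp: primitive_on_def B_def\<close>)
    moreover have "(F \<circ> chart_inv (W', \<zeta> \<circ> \<phi>)) ` B \<subseteq> R31"
      using prim eq by (auto simp: primitive_on_def B_def)
    ultimately show ?thesis by (simp add: primitive_on_def)
  qed
  moreover have "p \<in> W'" using pW N(2) by (simp add: W'_def)
  ultimately have "p \<in> W' \<and> smooth_chart M \<A> (W', \<zeta> \<circ> \<phi>) \<and>
     (\<exists>f1 f2 h1 h2 g \<omega>1 \<omega>2. representation_data ((\<zeta> \<circ> \<phi>) ` W') f1 f2 h1 h2 g \<omega>1 \<omega>2 \<and>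
        primitive_on ((\<zeta> \<circ> \<phi>) ` W') (xi g \<omega>1 \<omega>2) (F \<circ> chart_inv (W', \<zeta> \<circ> \<phi>)))"
    unfolding cc(1) using cc(2) rep[folded B_def] by blast
  then show ?thesis
    by (intro exI)
qed

theorem corollary6p8:
  shows "(\<forall>U f1 f2 h1 h2 g \<omega>1 \<omega>2.
      representation_data U f1 f2 h1 h2 g \<omega>1 \<omega>2 \<longrightarrow>
        closed_form_on U (xi g \<omega>1 \<omega>2) \<and>
        (\<forall>z\<in>U. \<forall>v. xi g \<omega>1 \<omega>2 z v \<in> R31) \<and>
        (\<exists>F. primitive_on U (xi g \<omega>1 \<omega>2) F) \<and>
        (\<forall>F. primitive_on U (xi g \<omega>1 \<omega>2) F \<longrightarrow>
           timelike_immersion_on U F \<and>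
           (\<forall>z\<in>U. \<forall>v w. induced_metric F z v w = - \<omega>1 z v * \<omega>1 z w + \<omega>2 z v * \<omega>2 z w) \<and>
           (\<forall>z\<in>U. gauss_curvature (induced_metric F) z = 0) \<and>
           normal_curvature_vanishes_on U F))
    \<and>
    (\<forall>(M :: 'a topology) \<A> F.
      oriented_smooth_surface M \<A> \<and>
      in_all_charts \<A> F timelike_immersion_on \<and>
      in_all_charts \<A> F (\<lambda>V Fc. \<forall>z\<in>V. gauss_curvature (induced_metric Fc) z = 0) \<and>
      in_all_charts \<A> F normal_curvature_vanishes_on \<and>
      in_all_charts \<A> F regular_gauss_map_on \<and>
      in_all_charts \<A> F nondegenerate_osculating_on \<longrightarrow>
        (\<forall>p\<in>topspace M. \<exists>W \<zeta>. p \<in> W \<and> smooth_chart M \<A> (W, \<zeta>) \<and>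
           (\<exists>f1 f2 h1 h2 g \<omega>1 \<omega>2.
              representation_data (\<zeta> ` W) f1 f2 h1 h2 g \<omega>1 \<omega>2 \<and>
              primitive_on (\<zeta> ` W) (xi g \<omega>1 \<omega>2) (F \<circ> chart_inv (W, \<zeta>)))))"
proof (rule conjI, goal_cases)
  case 1
  show ?case
  proof (intro allI impI, goal_cases)
    case (1 U f1 f2 h1 h2 g \<omega>1 \<omega>2)
    then interpret representation U f1 f2 h1 h2 g \<omega>1 \<omega>2
      by (rule representation.intro)
    show ?case
      using closed_form primitive_exists primitive_surface by (auto simp: xi_eq xi_in_R31)
  qed
next
  case 2
  show ?case
    by (intro allI impI ballI, elim conjE, rule locally_represented)
qed

end
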